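(* Suppose that the hierarchical model $X_i\mid\theta_i\sim N(\theta_i,1)$, $\theta_i\mid\xi_i\sim N(\xi_i,c_*^2)$, $\xi_i\overset{iid}{\sim}H^*$ (described in the context) holds for all $i=1,\dots,n$, where $c_*>0$. Let $\hat H_n$ be any nonparametric maximum likelihood estimator, i.e. any maximizer of $\sum_{i=1}^n\log f_H(X_i)$ over $H\in\mathcal P(\mathbb R)$. For any fixed $M\ge\sqrt{10\sigma_*^2\log n}$ and nonempty compact set $S\subseteq\mathbb R$, let $\epsilon_n:=\epsilon_n(M,S,H^* )$. Suppose further that $\epsilon_n=o(1)$. Then for all $t\ge1$, $$\|g_{\hat H_n}-g_{H^*}\|_{L_2}^2\lesssim_{c_*}t^2\epsilon_n^{2\alpha_*}$$ with probability at least $1-2n^{-t^2}$. Moreover, $$\mathbb E_{H^*}\big[\|g_{\hat H_n}-g_{H^*}\|_{L_2}^2\big]\lesssim_{c_*}\epsilon_n^{2\alpha_*}.$$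
   Context: $\mathcal P(\mathbb R)$ is the set of Borel probability measures on $\mathbb R$; $\phi_\sigma$ is the $N(0,\sigma^2)$ density and $\phi=\phi_1$. Model: for $i=1,\dots,n$, $X_i\mid\theta_i\overset{ind}{\sim}N(\theta_i,1)$, $\theta_i\mid\xi_i\overset{ind}{\sim}N(\xi_i,c_*^2)$, $\xi_i\overset{iid}{\sim}H^*\in\mathcal P(\mathbb R)$; only $X_1,\dots,X_n$ are observed, $c_*$ is known, $H^*$ is unknown. $\mathbb E_{H^*},\mathbb P_{H^*}$ denote expectation and probability under this model. Put $\sigma_*^2:=1+c_*^2$ and $\alpha_*:=c_*^2/\sigma_*^2$. For $H\in\mathcal P(\mathbb R)$ let $g_H(\theta):=\int\phi_{c_*}(\theta-\xi)\,dH(\xi)$ (marginal density of $\theta_i$ under $H$) and $f_H(x):=\int\phi_{\sigma_*}(x-\xi)\,dH(\xi)$ (marginal density of $X_i$ under $H$). For nonempty $S\subseteq\mathbb R$, $\mathfrak d_S(x):=\inf_{u\in S}|x-u|$, $S^{\sigma_*}:=\{x:\mathfrak d_S(x)\le\sigma_*\}$, $\mathrm{Vol}$ is Lebesgue measure, and $\mu_p(\mathfrak d_S,H):=\big(\int\mathfrak d_S(\xi)^p\,dH(\xi)\big)^{1/p}$ for $p>0$. For $H\in\mathcal P(\mathbb R)$, nonempty compact $S$, and $M\ge\sqrt{10\sigma_*^2\log n}$, $\epsilon_n(M,S,H)\ge0$ is defined by $$\epsilon_n^2(M,S,H):=\mathrm{Vol}(S^{\sigma_*})\frac{M}{n}(\log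 n)^{3/2}+(\log n)\inf_{p\ge1/\log n}\Big(\frac{2\mu_p(\mathfrak d_S,H)}{M}\Big)^p .$$ Here $M$ and $S$ are deterministic and may depend on $n$; $o(1)$ is as $n\to\infty$. $a\lesssim_{c_*}b$ means $a\le Cb$ for a constant $C>0$ depending only on $c_*$. *)

theory Defs
  imports "HOL-Probability.Probability"
begin

section \<open>Gaussian mixtures\<close>

definition sigma_star :: "real \<Rightarrow> real" where
  "sigma_star c = sqrt (1 + c\<^sup>2)"

definition alpha_star :: "real \<Rightarrow> real" where
  "alpha_star c = c\<^sup>2 / (sigma_star c)\<^sup>2"

text \<open>The second parameter of \<^const>\<open>normal_density\<close> is the standard deviation.\<close>

definition g_dens :: "real \<Rightarrow> real measure \<Rightarrow> real \<Rightarrow> real" where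
  "g_dens c H \<theta> = (LINT \<xi>|H. normal_density 0 c (\<theta> - \<xi>))"

definition f_dens :: "real \<Rightarrow> real measure \<Rightarrow> real \<Rightarrow> real" where
  "f_dens c H x = (LINT \<xi>|H. normal_density 0 (sigma_star c) (x - \<xi>))"

definition L2_norm_sq :: "(real \<Rightarrow> real) \<Rightarrow> ennreal" where
  "L2_norm_sq h = (\<integral>\<^sup>+ x. ennreal ((h x)\<^sup>2) \<partial>lborel)"


section \<open>The hierarchical model\<close>

definition normal_law :: "real \<Rightarrow> real \<Rightarrow> real measure" where
  "normal_law \<mu> \<sigma> = density lborel (\<lambda>x. ennreal (normal_density \<mu> \<sigma> x))"

text \<open>Joint law of one triple \<open>(\<xi>\<^sub>i, \<theta>\<^sub>i, X\<^sub>i)\<close>.\<close>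

definition triple_law :: "real \<Rightarrow> real measure \<Rightarrow> (real \<times> real \<times> real) measure" where
  "triple_law c H =
     H \<bind> (\<lambda>\<xi>. normal_law \<xi> c \<bind> (\<lambda>\<theta>. normal_law \<theta> 1 \<bind> (\<lambda>x. return borel (\<xi>, \<theta>, x))))"

definition model :: "real \<Rightarrow> real measure \<Rightarrow> nat \<Rightarrow> (nat \<Rightarrow> real \<times> real \<times> real) measure" where
  "model c H n = PiM {1..n} (\<lambda>_. triple_law c H)"

definition obs :: "(nat \<Rightarrow> real \<times> real \<times> real) \<Rightarrow> nat \<Rightarrow> real" where
  "obs \<omega> i = snd (snd (\<omega> i))"

definition is_npmle :: "real \<Rightarrow> nat \<Rightarrow> (nat \<Rightarrow> real) \<Rightarrow> real measure \<Rightarrow> bool" where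
  "is_npmle c n X = is_arg_max (\<lambda>H. \<Sum>i=1..n. ln (f_dens c H (X i))) real_distribution"


section \<open>The rate\<close>

text \<open>Real powers with exponent \<open>p > 0\<close>, with \<open>\<infinity>\<^sup>p = \<infinity>\<close>.  The quantities below live in
  \<^typ>\<open>ennreal\<close> because moments of \<open>\<dd>\<^sub>S\<close> may be infinite.\<close>

definition epowr :: "ennreal \<Rightarrow> real \<Rightarrow> ennreal" where
  "epowr x p = (if x = \<infinity> then \<infinity> else ennreal (enn2real x powr p))"

definition dist_moment :: "real \<Rightarrow> real set \<Rightarrow> real measure \<Rightarrow> ennreal" where
  "dist_moment p S H = epowr (\<integral>\<^sup>+ \<xi>. ennreal (infdist \<xi> S powr p) \<partial>H) (1 / p)"

definition enlargement :: "real set \<Rightarrow> real \<Rightarrow> real set" where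
  "enlargement S r = {x. infdist x S \<le> r}"

definition eps_sq :: "real \<Rightarrow> nat \<Rightarrow> real \<Rightarrow> real set \<Rightarrow> real measure \<Rightarrow> ennreal" where
  "eps_sq c n M S H =
     ennreal (measure lborel (enlargement S (sigma_star c)) * (M / real n) * ln (real n) powr (3/2))
     + ennreal (ln (real n)) *
       (INF p\<in>{1 / ln (real n)..}. epowr (2 * dist_moment p S H / ennreal M) p)"

definition eps :: "real \<Rightarrow> nat \<Rightarrow> real \<Rightarrow> real set \<Rightarrow> real measure \<Rightarrow> ennreal" where
  "eps c n M S H = epowr (eps_sq c n M S H) (1/2)"


section \<open>Inner probability and outer expectation\<close>

text \<open>An arbitrary choice of maximizer need not depend measurably on the data.  Probability lower
  bounds are therefore stated for the inner probability and expectation upper bounds for the outer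
  expectation; the two lemmas show that these are the usual notions in the measurable case.\<close>

definition inner_prob :: "'a measure \<Rightarrow> 'a set \<Rightarrow> real" where
  "inner_prob M E = (SUP A\<in>{A \<in> sets M. A \<subseteq> E}. measure M A)"

definition outer_expectation :: "'a measure \<Rightarrow> ('a \<Rightarrow> ennreal) \<Rightarrow> ennreal" where
  "outer_expectation M f =
     (INF Z\<in>{Z \<in> borel_measurable M. \<forall>\<omega>\<in>space M. f \<omega> \<le> Z \<omega>}. \<integral>\<^sup>+ \<omega>. Z \<omega> \<partial>M)"

lemma inner_prob_eq_measure:
  assumes "prob_space M" "E \<in> sets M"
  shows "inner_prob M E = measure M E"
proof -
  interpret prob_space M by fact
  show ?thesis
    unfolding inner_prob_def using assms(2)
    by (intro cSup_eq_maximum) (auto intro!: finite_measure_mono)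
qed

lemma outer_expectation_eq_nn_integral:
  assumes "f \<in> borel_measurable M"
  shows "outer_expectation M f = (\<integral>\<^sup>+ \<omega>. f \<omega> \<partial>M)"
  unfolding outer_expectation_def using assms
  by (intro antisym INF_lower INF_greatest) (auto intro!: nn_integral_mono)

section \<open>The model is well defined: under it each observation has density \<open>f_dens c H\<close>\<close>

lemma measurable_normal_law:
  assumes "\<sigma> > 0"
  shows "(\<lambda>\<mu>. normal_law \<mu> \<sigma>) \<in> borel \<rightarrow>\<^sub>M prob_algebra borel"
proof (rule measurable_prob_algebraI)
  show "prob_space (normal_law \<mu> \<sigma>)" for \<mu>
    unfolding normal_law_def by (rule prob_space_normal_density[OF assms])
  show "(\<lambda>\<mu>. normal_law \<mu> \<sigma>) \<in> borel \<rightarrow>\<^sub>M subprob_algebra borel"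
  proof (rule measurable_subprob_algebra)
    show "subprob_space (normal_law \<mu> \<sigma>)" for \<mu>
      unfolding normal_law_def
      by (rule prob_space_imp_subprob_space[OF prob_space_normal_density[OF assms]])
    show "sets (normal_law \<mu> \<sigma>) = sets borel" for \<mu> by (simp add: normal_law_def)
    show "(\<lambda>\<mu>. emeasure (normal_law \<mu> \<sigma>) A) \<in> borel_measurable borel"
      if [measurable]: "A \<in> sets borel" for A
    proof -
      have "(\<lambda>\<mu>. emeasure (normal_law \<mu> \<sigma>) A) =
        (\<lambda>\<mu>. \<integral>\<^sup>+x. ennreal (normal_density \<mu> \<sigma> x) * indicator A x \<partial>lborel)"
        by (simp add: normal_law_def emeasure_density)
      also have "\<dots> \<in> borel_measurable borel"
        unfolding normal_density_def by measurable
      finally show ?thesis .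
    qed
  qed
qed

lemma conv_normal_law:
  assumes "c > 0" and [measurable]: "A \<in> sets borel"
  shows "(\<integral>\<^sup>+\<theta>. emeasure (normal_law \<theta> 1) A \<partial>normal_law \<xi> c) = emeasure (normal_law \<xi> (sigma_star c)) A"
proof -
  have conv: "(\<integral>\<^sup>+\<theta>. ennreal (normal_density \<xi> c \<theta>) * ennreal (normal_density \<theta> 1 x) \<partial>lborel)
      = ennreal (normal_density \<xi> (sigma_star c) x)" for x
  proof -
    have "(\<integral>\<^sup>+\<theta>. ennreal (normal_density \<xi> c \<theta>) * ennreal (normal_density \<theta> 1 x) \<partial>lborel)
      = (\<integral>\<^sup>+y. ennreal (normal_density \<xi> c (\<xi> + y)) * ennreal (normal_density (\<xi> + y) 1 x) \<partial>lborel)"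
      unfolding normal_density_def by (subst lborel_distr_plus[of \<xi>, symmetric]) (simp add: nn_integral_distr)
    also have "\<dots> = (\<integral>\<^sup>+y. ennreal (normal_density 0 1 ((x - \<xi>) - y) * normal_density 0 c y) \<partial>lborel)"
      by (intro nn_integral_cong) (simp add: normal_density_def ennreal_mult[symmetric] algebra_simps)
    also have "\<dots> = ennreal (normal_density 0 (sigma_star c) (x - \<xi>))"
      using fun_cong[OF conv_normal_density_zero_mean[of 1 c], of "x - \<xi>"] assms(1)
      by (simp add: sigma_star_def)
    also have "\<dots> = ennreal (normal_density \<xi> (sigma_star c) x)"
      by (simp add: normal_density_def)
    finally show ?thesis .
  qed
  have "(\<lambda>\<theta>. emeasure (normal_law \<theta> 1) A) \<in> borel_measurable borel"
    using measurable_compose[OF measurable_prob_algebraD[OF measurable_normal_law[of 1]]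
       measurable_emeasure_subprob_algebra[OF assms(2)]] by simp
  then have [measurable]: "(\<lambda>\<theta>. \<integral>\<^sup>+x. ennreal (normal_density \<theta> 1 x) * indicator A x \<partial>lborel) \<in> borel_measurable borel"
    by (simp add: normal_law_def emeasure_density)
  have "(\<integral>\<^sup>+\<theta>. emeasure (normal_law \<theta> 1) A \<partial>normal_law \<xi> c)
    = (\<integral>\<^sup>+\<theta>. ennreal (normal_density \<xi> c \<theta>) * (\<integral>\<^sup>+x. ennreal (normal_density \<theta> 1 x) * indicator A x \<partial>lborel) \<partial>lborel)"
    unfolding normal_law_def[of \<xi> c] by (subst nn_integral_density) (simp_all add: normal_law_def emeasure_density)
  also have "\<dots> = (\<integral>\<^sup>+\<theta>. (\<integral>\<^sup>+x. ennreal (normal_density \<xi> c \<theta>) * (ennreal (normal_density \<theta> 1 x) * indicator A x) \<partial>lborel) \<partial>lborel)"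
    by (simp add: nn_integral_cmult)
  also have "\<dots> = (\<integral>\<^sup>+x. (\<integral>\<^sup>+\<theta>. ennreal (normal_density \<xi> c \<theta>) * (ennreal (normal_density \<theta> 1 x) * indicator A x) \<partial>lborel) \<partial>lborel)"
    unfolding normal_density_def by (rule lborel_pair.Fubini') measurable
  also have "\<dots> = (\<integral>\<^sup>+x. (\<integral>\<^sup>+\<theta>. ennreal (normal_density \<xi> c \<theta>) * ennreal (normal_density \<theta> 1 x) \<partial>lborel) * indicator A x \<partial>lborel)"
    by (intro nn_integral_cong, subst nn_integral_multc[symmetric])
       (simp_all add: mult.assoc, simp add: normal_density_def)
  also have "\<dots> = emeasure (normal_law \<xi> (sigma_star c)) A"
    by (simp add: conv normal_law_def emeasure_density)
  finally show ?thesis .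
qed

lemma triple_kernel:
  assumes "c > 0"
  shows "(\<lambda>\<xi>. normal_law \<xi> c \<bind> (\<lambda>\<theta>. normal_law \<theta> 1 \<bind> (\<lambda>x. return borel (\<xi>, \<theta>, x)))) \<in> borel \<rightarrow>\<^sub>M prob_algebra borel"
  and "(\<lambda>(\<xi>::real,\<theta>). normal_law \<theta> 1 \<bind> (\<lambda>x. return borel (\<xi>, \<theta>, x))) \<in> borel \<Otimes>\<^sub>M borel \<rightarrow>\<^sub>M prob_algebra borel"
  and "(\<lambda>((\<xi>::real,\<theta>::real),x::real). return borel (\<xi>, \<theta>, x)) \<in> (borel \<Otimes>\<^sub>M borel) \<Otimes>\<^sub>M borel \<rightarrow>\<^sub>M prob_algebra borel"
proof -
  note [measurable] = measurable_normal_law[OF assms] measurable_normal_law[of 1, simplified]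
  show 3: "(\<lambda>((\<xi>::real,\<theta>::real),x::real). return borel (\<xi>, \<theta>, x)) \<in> (borel \<Otimes>\<^sub>M borel) \<Otimes>\<^sub>M borel \<rightarrow>\<^sub>M prob_algebra (borel :: (real \<times> real \<times> real) measure)"
    unfolding borel_prod[symmetric] split_beta by measurable
  show 2: "(\<lambda>(\<xi>::real,\<theta>). normal_law \<theta> 1 \<bind> (\<lambda>x. return borel (\<xi>, \<theta>, x))) \<in> borel \<Otimes>\<^sub>M borel \<rightarrow>\<^sub>M prob_algebra borel"
    unfolding split_beta
    by (rule measurable_bind_prob_space2[where N=borel]) (use 3 in \<open>simp_all add: split_beta\<close>)
  show "(\<lambda>\<xi>. normal_law \<xi> c \<bind> (\<lambda>\<theta>. normal_law \<theta> 1 \<bind> (\<lambda>x. return borel (\<xi>, \<theta>, x)))) \<in> borel \<rightarrow>\<^sub>M prob_algebra borel"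
    by (rule measurable_bind_prob_space2[where N=borel]) (use 2 in \<open>simp_all add: split_beta\<close>)
qed

lemma prob_triple_law:
  assumes "real_distribution H" "c > 0"
  shows "triple_law c H \<in> space (prob_algebra borel)"
proof -
  interpret real_distribution H by fact
  have H: "H \<in> space (prob_algebra borel)" by (simp add: space_prob_algebra prob_space_axioms)
  show ?thesis unfolding triple_law_def
    using prob_space_bind'[OF H triple_kernel(1)[OF assms(2)]] sets_bind'[OF H triple_kernel(1)[OF assms(2)]]
    by (simp add: space_prob_algebra)
qed

lemma f_dens_nn:
  assumes "real_distribution H" "c > 0"
  shows "ennreal (f_dens c H x) = (\<integral>\<^sup>+\<xi>. ennreal (normal_density \<xi> (sigma_star c) x) \<partial>H)"
proof -
  interpret real_distribution H by fact
  have "\<bar>normal_density 0 (sigma_star c) y\<bar> \<le> 1 / sqrt (2 * pi * (sigma_star c)\<^sup>2)" for y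
    unfolding normal_density_def abs_mult by (rule order_trans[OF mult_left_le]) simp_all
  then have "integrable H (\<lambda>\<xi>. normal_density 0 (sigma_star c) (x - \<xi>))"
    unfolding normal_density_def by (intro integrable_const_bound[where B="1 / sqrt (2 * pi * (sigma_star c)\<^sup>2)"]) auto
  then have "ennreal (f_dens c H x) = (\<integral>\<^sup>+\<xi>. ennreal (normal_density 0 (sigma_star c) (x - \<xi>)) \<partial>H)"
    unfolding f_dens_def by (subst nn_integral_eq_integral) auto
  then show ?thesis by (simp add: normal_density_def)
qed

lemma distr_obs:
  assumes "real_distribution H" "c > 0"
  shows "distr (triple_law c H) borel (\<lambda>w. snd (snd w)) = density lborel (\<lambda>x. ennreal (f_dens c H x))"
proof (rule measure_eqI)
  interpret real_distribution H by fact
  have H: "H \<in> space (prob_algebra borel)" by (simp add: space_prob_algebra prob_space_axioms)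
  have sets: "sets (triple_law c H) = sets borel"
    using prob_triple_law[OF assms] by (simp add: space_prob_algebra)
  have s: "0 < sigma_star c" by (simp add: sigma_star_def add_pos_nonneg)
  have [measurable]: "f_dens c H \<in> borel_measurable borel"
    unfolding f_dens_def[abs_def] normal_density_def by measurable
  fix A assume "A \<in> sets (distr (triple_law c H) borel (\<lambda>w. snd (snd w)))"
  then have A[measurable]: "A \<in> sets borel" by simp
  have sp: "normal_law \<mu> t \<in> space (prob_algebra borel)" if "t > 0" for \<mu> t
    using measurable_space[OF measurable_normal_law[OF that], of \<mu>] by simp
  define B :: "(real \<times> real \<times> real) set" where "B = UNIV \<times> UNIV \<times> A"
  have B[measurable]: "B \<in> sets borel" unfolding B_def borel_prod[symmetric] by measurable
  have "emeasure (distr (triple_law c H) borel (\<lambda>w. snd (snd w))) A = emeasure (triple_law c H) B"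
  proof (subst emeasure_distr)
    show "(\<lambda>w. snd (snd w)) \<in> triple_law c H \<rightarrow>\<^sub>M borel"
      by (subst measurable_cong_sets[OF sets refl]) (unfold borel_prod[symmetric], measurable)
    show "emeasure (triple_law c H) ((\<lambda>w. snd (snd w)) -` A \<inter> space (triple_law c H)) = emeasure (triple_law c H) B"
      using sets_eq_imp_space_eq[OF sets] by (intro arg_cong2[where f=emeasure]) (auto simp: B_def)
  qed simp
  also have "\<dots> = (\<integral>\<^sup>+\<xi>. \<integral>\<^sup>+\<theta>. \<integral>\<^sup>+x. emeasure (return borel (\<xi>,\<theta>,x)) B \<partial>normal_law \<theta> 1 \<partial>normal_law \<xi> c \<partial>H)"
  proof -
    have 1: "(\<lambda>\<theta>. normal_law \<theta> 1 \<bind> (\<lambda>x. return borel (\<xi>, \<theta>, x))) \<in> borel \<rightarrow>\<^sub>M prob_algebra borel" for \<xi> :: real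
      using measurable_compose[OF measurable_Pair1'[of \<xi> borel borel] triple_kernel(2)[OF assms(2)]] by simp
    have 2: "(\<lambda>x::real. return borel (\<xi>, \<theta>, x)) \<in> borel \<rightarrow>\<^sub>M prob_algebra borel" for \<xi> \<theta> :: real
      using measurable_compose[OF measurable_Pair1'[of "(\<xi>,\<theta>)" "borel \<Otimes>\<^sub>M borel" borel] triple_kernel(3)[OF assms(2)]]
      by (auto simp: space_pair_measure split_beta)
    show ?thesis unfolding triple_law_def
      by (simp add: emeasure_bind_prob_algebra[OF H triple_kernel(1)[OF assms(2)] B]
         emeasure_bind_prob_algebra[OF sp[OF assms(2)] 1 B] emeasure_bind_prob_algebra[OF sp[of 1] 2 B])
  qed
  also have "\<dots> = (\<integral>\<^sup>+\<xi>. \<integral>\<^sup>+\<theta>. emeasure (normal_law \<theta> 1) A \<partial>normal_law \<xi> c \<partial>H)"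
  proof (intro nn_integral_cong)
    fix \<xi> \<theta>
    have "emeasure (return borel (\<xi>,\<theta>,x)) B = indicator A x" for x
      by (subst emeasure_return[OF B]) (simp add: B_def indicator_def)
    moreover have "sets (normal_law \<theta> 1) = sets borel" by (simp add: normal_law_def)
    ultimately show "(\<integral>\<^sup>+x. emeasure (return borel (\<xi>,\<theta>,x)) B \<partial>normal_law \<theta> 1) = emeasure (normal_law \<theta> 1) A"
      by (simp add: A)
  qed
  also have "\<dots> = (\<integral>\<^sup>+\<xi>. \<integral>\<^sup>+x. ennreal (normal_density \<xi> (sigma_star c) x) * indicator A x \<partial>lborel \<partial>H)"
    by (simp add: conv_normal_law[OF assms(2) A]) (simp add: normal_law_def emeasure_density)
  also have "\<dots> = (\<integral>\<^sup>+x. \<integral>\<^sup>+\<xi>. ennreal (normal_density \<xi> (sigma_star c) x) * indicator A x \<partial>H \<partial>lborel)"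
  proof -
    interpret P: pair_sigma_finite lborel H by unfold_locales
    show ?thesis unfolding normal_density_def by (rule P.Fubini') measurable
  qed
  also have "\<dots> = (\<integral>\<^sup>+x. ennreal (f_dens c H x) * indicator A x \<partial>lborel)"
    unfolding f_dens_nn[OF assms] normal_density_def
    by (intro nn_integral_cong nn_integral_multc) measurable
  also have "\<dots> = emeasure (density lborel (\<lambda>x. ennreal (f_dens c H x))) A"
    by (simp add: emeasure_density)
  finally show "emeasure (distr (triple_law c H) borel (\<lambda>w. snd (snd w))) A = emeasure (density lborel (\<lambda>x. ennreal (f_dens c H x))) A" .
qed simp

end

theory Submission
  imports Defs "HOL-Complex_Analysis.Cauchy_Integral_Formula"
begin

text \<open>
  Let \<open>f\<close> and \<open>g\<close> denote the Gaussian mixtures with standard deviations \<open>\<sigma> = sigma_star c\<close> and \<open>c\<close> of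
  a mixing distribution.  The data come from \<open>f\<close>, the loss concerns \<open>g\<close>, and \<open>f\<close> is \<open>g\<close> smoothed by
  standard normal noise.  The theorem combines a rate for estimating \<open>f\<close> in Hellinger distance with the
  modulus of continuity of the deconvolution problem.

  \<^bold>\<open>Deconvolution.\<close>  By Plancherel's identity (\<open>gauss_mix_parseval\<close>) the squared \<open>L\<^sub>2\<close> distances of two \<open>g\<close>'s
  and of the corresponding \<open>f\<close>'s are integrals of the same bounded function, the squared difference of the
  characteristic functions of the mixing distributions, against \<open>exp (- c\<^sup>2 w\<^sup>2)\<close> and \<open>exp (- (1 + c\<^sup>2) w\<^sup>2)\<close>.
  Cutting at \<open>w\<^sup>2 = a\<close>, low frequencies lose a factor \<open>exp a\<close> and high frequencies contribute
  \<open>O (exp (- c\<^sup>2 a))\<close>.  If the \<open>f\<close>'s are within \<open>\<delta>\<close> (squared), the best cutoff gives the order \<open>\<delta> powr alpha_star c\<close>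
  for the \<open>g\<close>'s (\<open>deconvolution_affinity\<close>).

  \<^bold>\<open>Hellinger rate.\<close>  The maximiser has at least the likelihood of the truth, so it suffices that, with high
  probability, no mixture far from the truth does (\<open>npmle_affinity_concentration\<close>).  For a single mixture this
  is Chernoff's bound: the expected square root of the likelihood ratio of \<open>n\<close> observations is the \<open>n\<close>-th power
  of the affinity.  For all far mixtures at once it needs a finite net.  Mixtures of Gaussians are so smooth that
  on an interval of length of order \<open>\<surd>(ln n)\<close> they are determined up to \<open>n\<close> to the power \<open>-2\<close> by \<open>O (ln n)\<close> Taylor
  coefficients (\<open>gauss_mix_entropy\<close>); covering the \<open>M\<close>-neighbourhood of \<open>S\<close> by such intervals yields a net whose
  log-cardinality is of the order of \<open>n\<close> times the first term of the rate (\<open>likelihood_net\<close>).  Observations outside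
  that neighbourhood are compared with the peak of the kernel instead.  The price is a power of the distance to
  \<open>S\<close>, and raised to the exponent \<open>1 / (2 ln n)\<close> it is controlled by the moments in the second term of the rate
  (\<open>tail_integral\<close>).

  \<^bold>\<open>Expectation.\<close>  The loss is bounded, the bound for \<open>t = 1\<close> fails with probability at most \<open>2 / n\<close>, and the rate
  is at least \<open>1 / n\<close>.

  All exceptional events are unions of finitely many events about the data, hence measurable, no matter how the
  maximiser is selected.  This is what the inner probability and the outer expectation require.
\<close>


section \<open>Gaussian mixtures\<close>

text \<open>The densities of the \<open>\<theta>\<^sub>i\<close> and of the observations are both of this form, with standard
  deviations \<open>c\<close> and \<open>sigma_star c\<close>.\<close>

definition gauss_mix :: "real \<Rightarrow> real measure \<Rightarrow> real \<Rightarrow> real" where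
  "gauss_mix s H x = (LINT \<xi>|H. normal_density 0 s (x - \<xi>))"

lemma sigma_star_pos [simp]: "sigma_star c > 0"
  by (simp add: sigma_star_def add_pos_nonneg)

lemma sigma_star_sq: "(sigma_star c)\<^sup>2 = 1 + c\<^sup>2"
  by (simp add: sigma_star_def)

lemma sigma_star_ge_1: "sigma_star c \<ge> 1"
  by (simp add: sigma_star_def)

lemma g_dens_eq_gauss_mix: "g_dens c = gauss_mix c"
  by (intro ext) (simp add: g_dens_def gauss_mix_def)

lemma f_dens_eq_gauss_mix: "f_dens c = gauss_mix (sigma_star c)"
  by (intro ext) (simp add: f_dens_def gauss_mix_def)

lemma normal_density_le_peak:
  assumes "s > 0"
  shows "normal_density m s x \<le> normal_density 0 s 0"
  unfolding normal_density_def by (simp add: divide_right_mono)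

lemma normal_density_peak: "s > 0 \<Longrightarrow> normal_density 0 s 0 = 1 / (sqrt (2 * pi) * s)"
  by (simp add: normal_density_def real_sqrt_mult)

lemma measurable_normal_density_diff [measurable]:
  "(\<lambda>(x, \<xi>). normal_density 0 s (x - \<xi>)) \<in> borel_measurable (borel \<Otimes>\<^sub>M borel)"
  unfolding normal_density_def by measurable

lemma nn_integral_normal_density_diff:
  assumes s: "s > 0"
  shows "(\<integral>\<^sup>+x. ennreal (normal_density 0 s (x - \<xi>)) \<partial>lborel) = 1"
proof -
  have "(\<integral>\<^sup>+x. ennreal (normal_density 0 s (x - \<xi>)) \<partial>lborel) = (\<integral>\<^sup>+x. ennreal (normal_density \<xi> s x) \<partial>lborel)"
    by (simp add: normal_density_def)
  also have "\<dots> = 1"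
    using prob_space.emeasure_space_1[OF prob_space_normal_density[OF s, of \<xi>]]
    by (simp add: emeasure_density)
  finally show ?thesis .
qed

context real_distribution
begin

lemma integrable_gauss_kernel:
  assumes "s > 0"
  shows "integrable M (\<lambda>\<xi>. normal_density 0 s (x - \<xi>))"
  using normal_density_le_peak[OF assms, of 0]
  by (intro integrable_const_bound[where B = "normal_density 0 s 0"])
     (auto simp: normal_density_nonneg[THEN abs_of_nonneg])

lemma measurable_gauss_mix [measurable]: "gauss_mix s M \<in> borel_measurable borel"
  unfolding gauss_mix_def[abs_def] normal_density_def by measurable

lemma gauss_mix_le_peak:
  assumes "s > 0"
  shows "gauss_mix s M x \<le> normal_density 0 s 0"
proof -
  have "gauss_mix s M x \<le> (LINT \<xi>|M. normal_density 0 s 0)"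
    unfolding gauss_mix_def
    by (intro integral_mono integrable_gauss_kernel assms) (auto intro: normal_density_le_peak[OF assms])
  then show ?thesis using prob_space by simp
qed

lemma gauss_mix_pos:
  assumes "s > 0"
  shows "gauss_mix s M x > 0"
proof -
  have nn: "gauss_mix s M x \<ge> 0"
    unfolding gauss_mix_def by (intro integral_nonneg_AE) (auto simp: normal_density_nonneg)
  moreover have "gauss_mix s M x \<noteq> 0"
  proof
    assume "gauss_mix s M x = 0"
    then have "AE \<xi> in M. normal_density 0 s (x - \<xi>) = 0"
      unfolding gauss_mix_def
      by (subst (asm) integral_nonneg_eq_0_iff_AE[OF integrable_gauss_kernel[OF assms]])
         (auto simp: normal_density_nonneg)
    then have "AE \<xi> in M. False"
      by eventually_elim (use normal_density_pos[OF assms, of 0] in \<open>auto simp: less_le\<close>)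
    then show False by simp
  qed
  ultimately show ?thesis by simp
qed

lemma ennreal_gauss_mix:
  assumes "s > 0"
  shows "ennreal (gauss_mix s M x) = (\<integral>\<^sup>+\<xi>. ennreal (normal_density 0 s (x - \<xi>)) \<partial>M)"
  unfolding gauss_mix_def
  by (subst nn_integral_eq_integral[OF integrable_gauss_kernel[OF assms]]) (auto simp: normal_density_nonneg)

lemma nn_integral_gauss_mix:
  assumes s: "s > 0" and h[measurable]: "h \<in> borel_measurable borel"
  shows "(\<integral>\<^sup>+x. h x * ennreal (gauss_mix s M x) \<partial>lborel)
    = (\<integral>\<^sup>+\<xi>. \<integral>\<^sup>+x. h x * ennreal (normal_density 0 s (x - \<xi>)) \<partial>lborel \<partial>M)"
proof -
  interpret P: pair_sigma_finite lborel M by unfold_locales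
  have "(\<integral>\<^sup>+x. h x * ennreal (gauss_mix s M x) \<partial>lborel)
    = (\<integral>\<^sup>+x. \<integral>\<^sup>+\<xi>. h x * ennreal (normal_density 0 s (x - \<xi>)) \<partial>M \<partial>lborel)"
    unfolding ennreal_gauss_mix[OF s]
    by (intro nn_integral_cong nn_integral_cmult[symmetric]) measurable
  also have "\<dots> = (\<integral>\<^sup>+\<xi>. \<integral>\<^sup>+x. h x * ennreal (normal_density 0 s (x - \<xi>)) \<partial>lborel \<partial>M)"
    by (rule P.Fubini'[symmetric]) measurable
  finally show ?thesis .
qed

lemma nn_integral_gauss_mix_eq_1:
  assumes s: "s > 0"
  shows "(\<integral>\<^sup>+x. ennreal (gauss_mix s M x) \<partial>lborel) = 1"
proof -
  show ?thesis
    using nn_integral_gauss_mix[OF s, of "\<lambda>_. 1"] nn_integral_normal_density_diff[OF s] emeasure_space_1 by simp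
qed

lemma integrable_gauss_mix:
  assumes s: "s > 0"
  shows "integrable lborel (gauss_mix s M)"
  using nn_integral_gauss_mix_eq_1[OF s] gauss_mix_pos[OF s]
  by (intro integrableI_nonneg) (auto simp: less_imp_le)

lemma integral_gauss_mix_eq_1:
  assumes s: "s > 0"
  shows "(LINT x|lborel. gauss_mix s M x) = 1"
  using nn_integral_gauss_mix_eq_1[OF s] gauss_mix_pos[OF s]
  by (subst integral_eq_nn_integral) (auto simp: less_imp_le)

end

section \<open>Plancherel's identity for mixtures\<close>

lemma has_bochner_integral_gauss_exp:
  assumes s: "s > 0"
  shows "has_bochner_integral lborel (\<lambda>w::real. exp (- (s\<^sup>2 * (w - m)\<^sup>2))) (sqrt pi / s)"
proof -
  define \<tau> where "\<tau> = 1 / (sqrt 2 * s)"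
  have \<tau>: "\<tau> > 0" "\<tau>\<^sup>2 = 1 / (2 * s\<^sup>2)" using s by (auto simp: \<tau>_def power_divide power_mult_distrib)
  have e: "sqrt (2 * pi * \<tau>\<^sup>2) = sqrt pi / s" using s by (simp add: \<tau> real_sqrt_divide real_sqrt_mult)
  have "exp (- (s\<^sup>2 * (w - m)\<^sup>2)) = sqrt pi / s * normal_density m \<tau> w" for w
    unfolding normal_density_def e using s by (simp add: \<tau>)
  moreover have "has_bochner_integral lborel (\<lambda>w. sqrt pi / s * normal_density m \<tau> w) (sqrt pi / s * 1)"
    using \<tau>(1) by (intro has_bochner_integral_mult_right) (simp add: has_bochner_integral_iff)
  ultimately show ?thesis by simp
qed

text \<open>Up to normalisation \<open>exp (- s\<^sup>2 w\<^sup>2)\<close> is itself a Gaussian density, so this is its characteristic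
  function, which is again a Gaussian.  It is deduced from the standard normal case by rescaling.\<close>

lemma gauss_fourier:
  assumes s: "s > 0"
  shows "(LINT w|lborel. exp (- (s\<^sup>2 * w\<^sup>2)) * cos (w * u)) = 2 * pi * normal_density 0 (sqrt 2 * s) u"
proof -
  have std: "(LINT x|lborel. std_normal_density x * cos (t * x)) = exp (- t\<^sup>2 / 2)" for t
  proof -
    interpret N: real_distribution std_normal_distribution by (rule real_dist_normal_dist)
    have int: "complex_integrable std_normal_distribution (\<lambda>x. iexp (t * x))"
      by (rule N.integrable_const_bound[where B = 1]) auto
    have "exp (- t\<^sup>2 / 2) = Re (char std_normal_distribution t)"
      by (simp only: char_std_normal_distribution Re_complex_of_real)
    also have "\<dots> = (LINT x|std_normal_distribution. Re (iexp (t * x)))"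
      unfolding char_def by (subst integral_Re[OF int]) simp
    also have "\<dots> = (LINT x|std_normal_distribution. cos (t * x))" by (simp add: Re_exp)
    also have "\<dots> = (LINT x|lborel. std_normal_density x * cos (t * x))"
      by (subst integral_density) (auto simp: normal_density_nonneg)
    finally show ?thesis by simp
  qed
  define k where "k = sqrt 2 * s"
  have k: "k > 0" "k\<^sup>2 = 2 * s\<^sup>2" using s by (auto simp: k_def power_mult_distrib)
  have "exp (- (u / k)\<^sup>2 / 2) = (LINT x|lborel. std_normal_density x * cos (u / k * x))"
    by (rule std[symmetric])
  also have "\<dots> = k * (LINT w|lborel. std_normal_density (k * w) * cos (u / k * (k * w)))"
    using k(1) by (subst lborel_integral_real_affine[where c = k and t = 0]) auto
  also have "(\<lambda>w. std_normal_density (k * w) * cos (u / k * (k * w)))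
      = (\<lambda>w. 1 / sqrt (2 * pi) * (exp (- (s\<^sup>2 * w\<^sup>2)) * cos (w * u)))"
    using k by (intro ext) (simp add: std_normal_density_def power_mult_distrib mult.commute)
  finally have "exp (- (u / k)\<^sup>2 / 2) = k / sqrt (2 * pi) * (LINT w|lborel. exp (- (s\<^sup>2 * w\<^sup>2)) * cos (w * u))"
    by simp
  then have "(LINT w|lborel. exp (- (s\<^sup>2 * w\<^sup>2)) * cos (w * u)) = sqrt (2 * pi) / k * exp (- (u / k)\<^sup>2 / 2)"
    using k(1) by (simp add: field_simps)
  also have "\<dots> = 2 * pi * normal_density 0 k u"
  proof -
    have "sqrt (2 * pi) / k = 2 * pi / (sqrt (2 * pi) * k)"
      using k(1) real_sqrt_mult_self[of "2*pi"] by (simp add: divide_simps)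
    then show ?thesis using k(1) by (simp add: normal_density_def power_divide real_sqrt_mult)
  qed
  finally show ?thesis by (simp add: k_def)
qed

text \<open>Real and imaginary part of the characteristic function, kept apart so that all integrals below
  are integrals of real functions.\<close>

definition cos_transform :: "real measure \<Rightarrow> real \<Rightarrow> real" where
  "cos_transform H w = (LINT \<xi>|H. cos (w * \<xi>))"

definition sin_transform :: "real measure \<Rightarrow> real \<Rightarrow> real" where
  "sin_transform H w = (LINT \<xi>|H. sin (w * \<xi>))"

lemma nn_integral_gauss_kernel_product:
  assumes s: "s > 0"
  shows "(\<integral>\<^sup>+x. ennreal (normal_density 0 s (x - \<xi>)) * ennreal (normal_density 0 s (x - \<eta>)) \<partial>lborel)
    = ennreal (normal_density 0 (sqrt 2 * s) (\<xi> - \<eta>))"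
proof -
  have "(\<integral>\<^sup>+x. ennreal (normal_density 0 s (x - \<xi>)) * ennreal (normal_density 0 s (x - \<eta>)) \<partial>lborel)
    = (\<integral>\<^sup>+y. ennreal (normal_density 0 s (\<eta> + y - \<xi>)) * ennreal (normal_density 0 s (\<eta> + y - \<eta>)) \<partial>lborel)"
    unfolding normal_density_def
    by (subst nn_integral_real_affine[where c = 1 and t = \<eta>]) (auto simp: algebra_simps)
  also have "\<dots> = (\<integral>\<^sup>+y. ennreal (normal_density 0 s ((\<xi> - \<eta>) - y) * normal_density 0 s y) \<partial>lborel)"
  proof (intro nn_integral_cong)
    fix y
    have "(\<eta> + y - \<xi>)\<^sup>2 = ((\<xi> - \<eta>) - y)\<^sup>2" by (simp add: power2_eq_square algebra_simps)
    then have "normal_density 0 s (\<eta> + y - \<xi>) = normal_density 0 s ((\<xi> - \<eta>) - y)"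
      by (simp add: normal_density_def)
    then show "ennreal (normal_density 0 s (\<eta> + y - \<xi>)) * ennreal (normal_density 0 s (\<eta> + y - \<eta>))
        = ennreal (normal_density 0 s ((\<xi> - \<eta>) - y) * normal_density 0 s y)"
      by (simp add: ennreal_mult')
  qed
  also have "\<dots> = ennreal (normal_density 0 (sqrt (s\<^sup>2 + s\<^sup>2)) (\<xi> - \<eta>))"
    using fun_cong[OF conv_normal_density_zero_mean[OF s s]] by simp
  also have "sqrt (s\<^sup>2 + s\<^sup>2) = sqrt 2 * s"
    using s by (simp add: real_sqrt_mult flip: mult_2)
  finally show ?thesis .
qed

context real_distribution
begin

lemma abs_cos_transform_le: "\<bar>cos_transform M w\<bar> \<le> 1"
proof -
  have "integrable M (\<lambda>\<xi>. cos (w * \<xi>))" by (rule integrable_const_bound[where B = 1]) auto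
  then have "\<bar>LINT \<xi>|M. cos (w * \<xi>)\<bar> \<le> (LINT \<xi>|M. 1)"
    by (intro integral_abs_bound_integral) auto
  then show ?thesis using prob_space by (simp add: cos_transform_def)
qed

lemma abs_sin_transform_le: "\<bar>sin_transform M w\<bar> \<le> 1"
proof -
  have "integrable M (\<lambda>\<xi>. sin (w * \<xi>))" by (rule integrable_const_bound[where B = 1]) auto
  then have "\<bar>LINT \<xi>|M. sin (w * \<xi>)\<bar> \<le> (LINT \<xi>|M. 1)"
    by (intro integral_abs_bound_integral) auto
  then show ?thesis using prob_space by (simp add: sin_transform_def)
qed

lemma measurable_cos_transform [measurable]: "cos_transform M \<in> borel_measurable borel"
  unfolding cos_transform_def[abs_def] by measurable

lemma measurable_sin_transform [measurable]: "sin_transform M \<in> borel_measurable borel"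
  unfolding sin_transform_def[abs_def] by measurable

lemma swap_weighted_integral:
  fixes e :: "real \<Rightarrow> real" and F :: "real \<Rightarrow> real \<Rightarrow> real"
  assumes e: "integrable lborel e" and F[measurable]: "case_prod F \<in> borel_measurable (borel \<Otimes>\<^sub>M borel)"
    and B: "\<And>w \<xi>. \<bar>F w \<xi>\<bar> \<le> B"
  shows "(LINT \<xi>|M. LINT w|lborel. e w * F w \<xi>) = (LINT w|lborel. e w * (LINT \<xi>|M. F w \<xi>))"
proof -
  interpret P: pair_sigma_finite lborel M by unfold_locales
  have [measurable]: "e \<in> borel_measurable borel" using e by auto
  have intF: "integrable M (\<lambda>\<xi>. F w \<xi>)" for w
    by (rule integrable_const_bound[where B = B]) (auto simp: B)
  have "integrable (lborel \<Otimes>\<^sub>M M) (\<lambda>(w, \<xi>). e w * F w \<xi>)"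
  proof (rule P.Fubini_integrable)
    show "(\<lambda>(w, \<xi>). e w * F w \<xi>) \<in> borel_measurable (lborel \<Otimes>\<^sub>M M)" by measurable
    have B0: "0 \<le> B" using B[of 0 0] by linarith
    show "integrable lborel (\<lambda>w. LINT \<xi>|M. norm (case (w, \<xi>) of (w, \<xi>) \<Rightarrow> e w * F w \<xi>))"
    proof (rule Bochner_Integration.integrable_bound[of _ "\<lambda>w. B * \<bar>e w\<bar>"])
      show "AE w in lborel. norm (LINT \<xi>|M. norm (case (w, \<xi>) of (w, \<xi>) \<Rightarrow> e w * F w \<xi>)) \<le> norm (B * \<bar>e w\<bar>)"
      proof (intro AE_I2)
        fix w
        have "(LINT \<xi>|M. \<bar>e w\<bar> * \<bar>F w \<xi>\<bar>) = \<bar>e w\<bar> * (LINT \<xi>|M. \<bar>F w \<xi>\<bar>)" by simp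
        also have "(LINT \<xi>|M. \<bar>F w \<xi>\<bar>) \<le> (LINT \<xi>|M. B)"
          using intF by (intro integral_mono) (auto simp: B)
        then have "\<bar>e w\<bar> * (LINT \<xi>|M. \<bar>F w \<xi>\<bar>) \<le> \<bar>e w\<bar> * B"
          using prob_space by (intro mult_left_mono) auto
        finally show "norm (LINT \<xi>|M. norm (case (w, \<xi>) of (w, \<xi>) \<Rightarrow> e w * F w \<xi>)) \<le> norm (B * \<bar>e w\<bar>)"
          using B0 by (simp add: abs_mult mult.commute integral_nonneg_AE)
      qed
    qed (use e in auto)
    show "AE w in lborel. integrable M (\<lambda>\<xi>. case (w, \<xi>) of (w, \<xi>) \<Rightarrow> e w * F w \<xi>)"
      using intF by auto
  qed
  from P.Fubini_integral[OF this]
  have "(LINT \<xi>|M. LINT w|lborel. e w * F w \<xi>) = (LINT w|lborel. LINT \<xi>|M. e w * F w \<xi>)" by simp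
  then show ?thesis by simp
qed

lemma gauss_mix_inversion:
  assumes s: "s > 0"
  shows "2 * pi * gauss_mix (sqrt 2 * s) M x
    = (LINT w|lborel. exp (- (s\<^sup>2 * w\<^sup>2)) * (cos (w * x) * cos_transform M w + sin (w * x) * sin_transform M w))"
proof -
  have e: "integrable lborel (\<lambda>w::real. exp (- (s\<^sup>2 * w\<^sup>2)))"
    using has_bochner_integral_gauss_exp[OF s, of 0] by (simp add: has_bochner_integral_iff)
  have "2 * pi * gauss_mix (sqrt 2 * s) M x
     = (LINT \<xi>|M. LINT w|lborel. exp (- (s\<^sup>2 * w\<^sup>2)) * cos (w * (x - \<xi>)))"
    unfolding gauss_mix_def gauss_fourier[OF s] by simp
  also have "\<dots> = (LINT w|lborel. exp (- (s\<^sup>2 * w\<^sup>2)) * (LINT \<xi>|M. cos (w * (x - \<xi>))))"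
    by (rule swap_weighted_integral[OF e, where B = 1]) auto
  also have "(\<lambda>w. LINT \<xi>|M. cos (w * (x - \<xi>)))
      = (\<lambda>w. cos (w * x) * cos_transform M w + sin (w * x) * sin_transform M w)"
  proof
    fix w
    have [simp]: "integrable M (\<lambda>\<xi>. cos (w * \<xi>))" "integrable M (\<lambda>\<xi>. sin (w * \<xi>))"
      by (auto intro!: integrable_const_bound[where B = 1])
    show "(LINT \<xi>|M. cos (w * (x - \<xi>))) = cos (w * x) * cos_transform M w + sin (w * x) * sin_transform M w"
      by (simp add: right_diff_distrib cos_diff cos_transform_def sin_transform_def)
  qed
  finally show ?thesis .
qed

end

text \<open>Integrating out \<open>x\<close> first leaves, for a pair of locations \<open>\<xi>\<close> and \<open>\<eta>\<close>, a Gaussian with standard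
  deviation \<open>sqrt 2 * s\<close> in \<open>\<xi> - \<eta>\<close>.  Writing that Gaussian as a superposition of cosines separates
  \<open>\<xi>\<close> from \<open>\<eta>\<close> by the addition theorem.\<close>

lemma gauss_mix_inner_product:
  assumes H: "real_distribution H" "real_distribution K" and s: "s > 0"
  shows "integrable lborel (\<lambda>x. gauss_mix s H x * gauss_mix s K x)"
    and "2 * pi * (LINT x|lborel. gauss_mix s H x * gauss_mix s K x)
    = (LINT w|lborel. exp (- (s\<^sup>2 * w\<^sup>2)) *
        (cos_transform H w * cos_transform K w + sin_transform H w * sin_transform K w))"
proof -
  interpret H: real_distribution H by fact
  interpret K: real_distribution K by fact
  have s2: "sqrt 2 * s > 0" using s by simp
  show "integrable lborel (\<lambda>x. gauss_mix s H x * gauss_mix s K x)"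
    using H.gauss_mix_le_peak[OF s] H.gauss_mix_pos[OF s] K.gauss_mix_pos[OF s]
    by (intro Bochner_Integration.integrable_bound[OF integrable_mult_right[OF K.integrable_gauss_mix[OF s], of "normal_density 0 s 0"]])
       (auto simp: abs_mult abs_of_pos intro!: mult_right_mono)
  have "(\<integral>\<^sup>+x. ennreal (gauss_mix s H x * gauss_mix s K x) \<partial>lborel)
      = (\<integral>\<^sup>+x. ennreal (gauss_mix s K x) * ennreal (gauss_mix s H x) \<partial>lborel)"
    using H.gauss_mix_pos[OF s] K.gauss_mix_pos[OF s]
    by (intro nn_integral_cong) (simp add: ennreal_mult'' less_imp_le mult.commute)
  also have "\<dots> = (\<integral>\<^sup>+\<xi>. \<integral>\<^sup>+x. ennreal (normal_density 0 s (x - \<xi>)) * ennreal (gauss_mix s K x) \<partial>lborel \<partial>H)"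
    by (subst H.nn_integral_gauss_mix[OF s]) (auto simp: mult.commute)
  also have "\<dots> = (\<integral>\<^sup>+\<xi>. ennreal (gauss_mix (sqrt 2 * s) K \<xi>) \<partial>H)"
  proof (intro nn_integral_cong)
    fix \<xi>
    show "(\<integral>\<^sup>+x. ennreal (normal_density 0 s (x - \<xi>)) * ennreal (gauss_mix s K x) \<partial>lborel)
      = ennreal (gauss_mix (sqrt 2 * s) K \<xi>)"
      by (subst K.nn_integral_gauss_mix[OF s])
         (simp_all add: nn_integral_gauss_kernel_product[OF s] K.ennreal_gauss_mix[OF s2])
  qed
  finally have "(LINT x|lborel. gauss_mix s H x * gauss_mix s K x) = (LINT \<xi>|H. gauss_mix (sqrt 2 * s) K \<xi>)"
    using H.gauss_mix_pos[OF s] K.gauss_mix_pos[OF s] K.gauss_mix_pos[OF s2]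
    by (subst (1 2) integral_eq_nn_integral) (auto simp: less_imp_le)
  then have "2 * pi * (LINT x|lborel. gauss_mix s H x * gauss_mix s K x)
      = (LINT \<xi>|H. 2 * pi * gauss_mix (sqrt 2 * s) K \<xi>)" by simp
  also have "\<dots> = (LINT \<xi>|H. LINT w|lborel. exp (- (s\<^sup>2 * w\<^sup>2)) *
      (cos (w * \<xi>) * cos_transform K w + sin (w * \<xi>) * sin_transform K w))"
    by (simp only: K.gauss_mix_inversion[OF s])
  also have "\<dots> = (LINT w|lborel. exp (- (s\<^sup>2 * w\<^sup>2)) *
      (LINT \<xi>|H. cos (w * \<xi>) * cos_transform K w + sin (w * \<xi>) * sin_transform K w))"
  proof (rule H.swap_weighted_integral[where B = 2])
    show "integrable lborel (\<lambda>w::real. exp (- (s\<^sup>2 * w\<^sup>2)))"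
      using has_bochner_integral_gauss_exp[OF s, of 0] by (simp add: has_bochner_integral_iff)
    show "\<bar>cos (w * \<xi>) * cos_transform K w + sin (w * \<xi>) * sin_transform K w\<bar> \<le> 2" for w \<xi>
    proof -
      have "\<bar>cos (w * \<xi>) * cos_transform K w\<bar> \<le> 1 * 1" "\<bar>sin (w * \<xi>) * sin_transform K w\<bar> \<le> 1 * 1"
        unfolding abs_mult by (intro mult_mono; simp add: K.abs_cos_transform_le K.abs_sin_transform_le)+
      then show ?thesis by linarith
    qed
  qed simp
  also have "(\<lambda>w. LINT \<xi>|H. cos (w * \<xi>) * cos_transform K w + sin (w * \<xi>) * sin_transform K w)
      = (\<lambda>w. cos_transform H w * cos_transform K w + sin_transform H w * sin_transform K w)"
  proof
    fix w
    have [simp]: "integrable H (\<lambda>\<xi>. cos (w * \<xi>))" "integrable H (\<lambda>\<xi>. sin (w * \<xi>))"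
      by (auto intro!: H.integrable_const_bound[where B = 1])
    show "(LINT \<xi>|H. cos (w * \<xi>) * cos_transform K w + sin (w * \<xi>) * sin_transform K w)
      = cos_transform H w * cos_transform K w + sin_transform H w * sin_transform K w"
      by (simp add: cos_transform_def sin_transform_def)
  qed
  finally show "2 * pi * (LINT x|lborel. gauss_mix s H x * gauss_mix s K x)
    = (LINT w|lborel. exp (- (s\<^sup>2 * w\<^sup>2)) *
        (cos_transform H w * cos_transform K w + sin_transform H w * sin_transform K w))" .
qed

text \<open>The squared modulus of the difference of the two characteristic functions.\<close>

definition transform_gap :: "real measure \<Rightarrow> real measure \<Rightarrow> real \<Rightarrow> real" where
  "transform_gap H K w = (cos_transform H w - cos_transform K w)\<^sup>2 + (sin_transform H w - sin_transform K w)\<^sup>2"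

lemma transform_gap_bounds:
  assumes "real_distribution H" "real_distribution K"
  shows "0 \<le> transform_gap H K w" "transform_gap H K w \<le> 8"
proof -
  interpret H: real_distribution H by fact
  interpret K: real_distribution K by fact
  show "0 \<le> transform_gap H K w" by (simp add: transform_gap_def)
  have "\<bar>cos_transform H w - cos_transform K w\<bar> \<le> 2" "\<bar>sin_transform H w - sin_transform K w\<bar> \<le> 2"
    using H.abs_cos_transform_le[of w] K.abs_cos_transform_le[of w]
      H.abs_sin_transform_le[of w] K.abs_sin_transform_le[of w] by linarith+
  from this[THEN power_mono[of _ _ 2]] show "transform_gap H K w \<le> 8" by (simp add: transform_gap_def)
qed

text \<open>Plancherel's identity for the difference of two mixtures: expand the square and apply the inner
  product formula three times.\<close>

lemma gauss_mix_parseval: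
  assumes H: "real_distribution H" "real_distribution K" and s: "s > 0"
  shows "integrable lborel (\<lambda>x. (gauss_mix s H x - gauss_mix s K x)\<^sup>2)"
    and "integrable lborel (\<lambda>w. exp (- (s\<^sup>2 * w\<^sup>2)) * transform_gap H K w)"
    and "2 * pi * (LINT x|lborel. (gauss_mix s H x - gauss_mix s K x)\<^sup>2)
      = (LINT w|lborel. exp (- (s\<^sup>2 * w\<^sup>2)) * transform_gap H K w)"
proof -
  interpret H: real_distribution H by fact
  interpret K: real_distribution K by fact
  define I where "I A B w = exp (- (s\<^sup>2 * w\<^sup>2)) *
        (cos_transform A w * cos_transform B w + sin_transform A w * sin_transform B w)" for A B and w :: real
  have e: "integrable lborel (\<lambda>w::real. exp (- (s\<^sup>2 * w\<^sup>2)))"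
    using has_bochner_integral_gauss_exp[OF s, of 0] by (simp add: has_bochner_integral_iff)
  have I: "integrable lborel (I A B)" if "real_distribution A" "real_distribution B" for A B
  proof (rule Bochner_Integration.integrable_bound[OF integrable_mult_right[OF e, of 2]])
    interpret A: real_distribution A by fact
    interpret B: real_distribution B by fact
    show "I A B \<in> borel_measurable lborel" unfolding I_def by simp
    have "\<bar>cos_transform A w * cos_transform B w + sin_transform A w * sin_transform B w\<bar> \<le> 2" for w
    proof -
      have "\<bar>cos_transform A w * cos_transform B w\<bar> \<le> 1 * 1" "\<bar>sin_transform A w * sin_transform B w\<bar> \<le> 1 * 1"
        unfolding abs_mult
        by (intro mult_mono; simp add: A.abs_cos_transform_le A.abs_sin_transform_le B.abs_cos_transform_le B.abs_sin_transform_le)+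
      then show ?thesis by linarith
    qed
    then show "AE w in lborel. norm (I A B w) \<le> norm (2 * exp (- (s\<^sup>2 * w\<^sup>2)))"
      by (auto simp: I_def abs_mult)
  qed
  have sq: "(\<lambda>x. (gauss_mix s H x - gauss_mix s K x)\<^sup>2) =
      (\<lambda>x. gauss_mix s H x * gauss_mix s H x - 2 * (gauss_mix s H x * gauss_mix s K x) + gauss_mix s K x * gauss_mix s K x)"
    by (intro ext) (simp add: power2_eq_square algebra_simps)
  have gap: "(\<lambda>w. exp (- (s\<^sup>2 * w\<^sup>2)) * transform_gap H K w) = (\<lambda>w. I H H w - 2 * I H K w + I K K w)"
    by (intro ext) (simp add: I_def transform_gap_def power2_eq_square algebra_simps)
  note G = gauss_mix_inner_product[OF _ _ s]
  show "integrable lborel (\<lambda>x. (gauss_mix s H x - gauss_mix s K x)\<^sup>2)"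
    unfolding sq using G(1) H by auto
  show "integrable lborel (\<lambda>w. exp (- (s\<^sup>2 * w\<^sup>2)) * transform_gap H K w)"
    unfolding gap using I H by auto
  have "2 * pi * (LINT x|lborel. (gauss_mix s H x - gauss_mix s K x)\<^sup>2)
      = 2 * pi * (LINT x|lborel. gauss_mix s H x * gauss_mix s H x)
       - 2 * (2 * pi * (LINT x|lborel. gauss_mix s H x * gauss_mix s K x))
       + 2 * pi * (LINT x|lborel. gauss_mix s K x * gauss_mix s K x)"
    unfolding sq using G(1)[OF H(1) H(1)] G(1)[OF H(1) H(2)] G(1)[OF H(2) H(2)] by (simp add: algebra_simps)
  also have "\<dots> = integral\<^sup>L lborel (I H H) - 2 * integral\<^sup>L lborel (I H K) + integral\<^sup>L lborel (I K K)"
    unfolding G(2)[OF H(1) H(1)] G(2)[OF H(1) H(2)] G(2)[OF H(2) H(2)] I_def by simp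
  also have "\<dots> = (LINT w|lborel. exp (- (s\<^sup>2 * w\<^sup>2)) * transform_gap H K w)"
    unfolding gap using I[OF H(1) H(1)] I[OF H(1) H(2)] I[OF H(2) H(2)] by simp
  finally show "2 * pi * (LINT x|lborel. (gauss_mix s H x - gauss_mix s K x)\<^sup>2)
      = (LINT w|lborel. exp (- (s\<^sup>2 * w\<^sup>2)) * transform_gap H K w)" .
qed

section \<open>Hellinger affinity and deconvolution\<close>

text \<open>The Bhattacharyya coefficient: \<open>1 - affinity s H K\<close> is half the squared Hellinger distance of
  the two mixtures.\<close>

definition affinity :: "real \<Rightarrow> real measure \<Rightarrow> real measure \<Rightarrow> real" where
  "affinity s H K = (LINT x|lborel. sqrt (gauss_mix s H x * gauss_mix s K x))"

lemma sqrt_mult_le_half_sum: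
  fixes a b :: real
  assumes "a \<ge> 0" "b \<ge> 0"
  shows "sqrt (a * b) \<le> (a + b) / 2"
  using arith_geo_mean_sqrt[OF assms] by simp

lemma integrable_affinity:
  assumes H: "real_distribution H" "real_distribution K" and s: "s > 0"
  shows "integrable lborel (\<lambda>x. sqrt (gauss_mix s H x * gauss_mix s K x))"
proof -
  interpret H: real_distribution H by fact
  interpret K: real_distribution K by fact
  show ?thesis
  proof (rule Bochner_Integration.integrable_bound)
    show "integrable lborel (\<lambda>x. (gauss_mix s H x + gauss_mix s K x) / 2)"
      using H.integrable_gauss_mix[OF s] K.integrable_gauss_mix[OF s] by auto
    show "AE x in lborel. norm (sqrt (gauss_mix s H x * gauss_mix s K x)) \<le> norm ((gauss_mix s H x + gauss_mix s K x) / 2)"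
    proof (intro AE_I2)
      fix x
      have p: "gauss_mix s H x > 0" "gauss_mix s K x > 0" using H.gauss_mix_pos[OF s] K.gauss_mix_pos[OF s] by auto
      then show "norm (sqrt (gauss_mix s H x * gauss_mix s K x)) \<le> norm ((gauss_mix s H x + gauss_mix s K x) / 2)"
        using sqrt_mult_le_half_sum[of "gauss_mix s H x" "gauss_mix s K x"] by simp
    qed
  qed simp
qed

lemma affinity_nonneg:
  assumes H: "real_distribution H" "real_distribution K" and s: "s > 0"
  shows "affinity s H K \<ge> 0"
  unfolding affinity_def
  using real_distribution.gauss_mix_pos[OF H(1) s] real_distribution.gauss_mix_pos[OF H(2) s]
  by (intro integral_nonneg_AE) (auto simp: less_imp_le)

text \<open>Pointwise \<open>(f - g)\<^sup>2 = (\<surd>f - \<surd>g)\<^sup>2 (\<surd>f + \<surd>g)\<^sup>2\<close>.  The second factor is at most four times the peak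
  of the kernel, and the first integrates to twice \<open>1 - affinity\<close>.\<close>

lemma L2_distance_le_affinity:
  assumes H: "real_distribution H" "real_distribution K" and s: "s > 0"
  shows "(LINT x|lborel. (gauss_mix s H x - gauss_mix s K x)\<^sup>2)
    \<le> 8 * normal_density 0 s 0 * (1 - affinity s H K)"
proof -
  interpret H: real_distribution H by fact
  interpret K: real_distribution K by fact
  let ?f = "gauss_mix s H" and ?g = "gauss_mix s K"
  define p where "p = normal_density 0 s 0"
  have "(LINT x|lborel. (?f x - ?g x)\<^sup>2) \<le> (LINT x|lborel. 4 * p * (?f x + ?g x - 2 * sqrt (?f x * ?g x)))"
  proof (rule integral_mono)
    show "integrable lborel (\<lambda>x. (?f x - ?g x)\<^sup>2)" by (rule gauss_mix_parseval(1)[OF H s])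
    show "integrable lborel (\<lambda>x. 4 * p * (?f x + ?g x - 2 * sqrt (?f x * ?g x)))"
      using H.integrable_gauss_mix[OF s] K.integrable_gauss_mix[OF s] integrable_affinity[OF H s] by auto
    fix x
    have pos: "?f x > 0" "?g x > 0" using H.gauss_mix_pos[OF s] K.gauss_mix_pos[OF s] by auto
    have le: "?f x \<le> p" "?g x \<le> p" using H.gauss_mix_le_peak[OF s] K.gauss_mix_le_peak[OF s] by (auto simp: p_def)
    define a where "a = sqrt (?f x)"
    define b where "b = sqrt (?g x)"
    have a2: "a\<^sup>2 = ?f x" "b\<^sup>2 = ?g x" using pos by (auto simp: a_def b_def)
    have ab: "a * b = sqrt (?f x * ?g x)" by (simp add: a_def b_def real_sqrt_mult)
    have "(a + b)\<^sup>2 \<le> 2 * a\<^sup>2 + 2 * b\<^sup>2" by (smt (verit) power2_sum sum_squares_bound)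
    then have "(a + b)\<^sup>2 \<le> 4 * p" using a2 le by linarith
    then have "(a - b)\<^sup>2 * (a + b)\<^sup>2 \<le> (a - b)\<^sup>2 * (4 * p)" by (rule mult_left_mono) simp
    moreover have "(?f x - ?g x)\<^sup>2 = (a - b)\<^sup>2 * (a + b)\<^sup>2"
      unfolding a2[symmetric] by (simp add: power2_eq_square algebra_simps)
    moreover have "(a - b)\<^sup>2 = ?f x + ?g x - 2 * sqrt (?f x * ?g x)"
      using a2 ab by (simp add: power2_diff mult.assoc)
    ultimately show "(?f x - ?g x)\<^sup>2 \<le> 4 * p * (?f x + ?g x - 2 * sqrt (?f x * ?g x))"
      by (simp add: mult.commute)
  qed
  also have "\<dots> = 4 * p * (1 + 1 - 2 * affinity s H K)"
    using H.integrable_gauss_mix[OF s] K.integrable_gauss_mix[OF s] integrable_affinity[OF H s]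
    by (simp add: affinity_def H.integral_gauss_mix_eq_1[OF s] K.integral_gauss_mix_eq_1[OF s])
  finally show ?thesis by (simp add: p_def algebra_simps)
qed

text \<open>The weight with exponent \<open>c\<^sup>2\<close> belongs to \<open>g_dens\<close> and the one with \<open>1 + c\<^sup>2\<close> to \<open>f_dens\<close>.  At
  frequencies with \<open>w\<^sup>2 \<le> a\<close> their ratio is at most \<open>exp a\<close>.  At higher frequencies
  \<open>w\<^sup>2 \<ge> a + (\<bar>w\<bar> - \<surd>a)\<^sup>2\<close>, so that the first weight is a factor \<open>exp (- c\<^sup>2 a)\<close> times a Gaussian
  centred at one of the two cutoffs \<open>\<plusminus>\<surd>a\<close>.\<close>

lemma frequency_split:
  fixes c a w :: real
  assumes c: "c > 0" and a: "a \<ge> 0"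
  shows "exp (- (c\<^sup>2 * w\<^sup>2)) \<le> exp a * exp (- ((1 + c\<^sup>2) * w\<^sup>2))
    + exp (- (c\<^sup>2 * a)) * (exp (- (c\<^sup>2 * (w - sqrt a)\<^sup>2)) + exp (- (c\<^sup>2 * (w + sqrt a)\<^sup>2)))"
proof (cases "w\<^sup>2 \<le> a")
  case True
  then have "- (c\<^sup>2 * w\<^sup>2) \<le> a + - ((1 + c\<^sup>2) * w\<^sup>2)" by (simp add: algebra_simps)
  then have "exp (- (c\<^sup>2 * w\<^sup>2)) \<le> exp a * exp (- ((1 + c\<^sup>2) * w\<^sup>2))" by (simp flip: exp_add)
  then show ?thesis by (rule add_increasing2[rotated]) simp
next
  case False
  define T where "T = sqrt a"
  have T: "T \<ge> 0" "T\<^sup>2 = a" using a by (auto simp: T_def)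
  have key: "exp (- (c\<^sup>2 * w\<^sup>2)) \<le> exp (- (c\<^sup>2 * a)) * exp (- (c\<^sup>2 * (w - r)\<^sup>2))"
    if r: "r\<^sup>2 = a" "r * w \<ge> r\<^sup>2" for r
  proof -
    have "c\<^sup>2 * (a + (w - r)\<^sup>2) \<le> c\<^sup>2 * w\<^sup>2"
      using r by (intro mult_left_mono) (auto simp: power2_eq_square algebra_simps)
    then show ?thesis by (simp add: algebra_simps flip: exp_add)
  qed
  have wT: "\<bar>w\<bar> > T" using False T by (metis abs_le_square_iff abs_of_nonneg not_le)
  have "exp (- (c\<^sup>2 * w\<^sup>2)) \<le> exp (- (c\<^sup>2 * a)) * (exp (- (c\<^sup>2 * (w - T)\<^sup>2)) + exp (- (c\<^sup>2 * (w + T)\<^sup>2)))"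
  proof (cases "w \<ge> 0")
    case True
    then have "T * T \<le> T * w" using wT T by (intro mult_left_mono) auto
    then have "exp (- (c\<^sup>2 * w\<^sup>2)) \<le> exp (- (c\<^sup>2 * a)) * exp (- (c\<^sup>2 * (w - T)\<^sup>2))"
      using T by (intro key) (auto simp: power2_eq_square)
    also have "\<dots> \<le> exp (- (c\<^sup>2 * a)) * (exp (- (c\<^sup>2 * (w - T)\<^sup>2)) + exp (- (c\<^sup>2 * (w + T)\<^sup>2)))"
      by (intro mult_left_mono) auto
    finally show ?thesis .
  next
    case False
    then have "T * T \<le> T * (- w)" using wT T by (intro mult_left_mono) auto
    then have "exp (- (c\<^sup>2 * w\<^sup>2)) \<le> exp (- (c\<^sup>2 * a)) * exp (- (c\<^sup>2 * (w - (- T))\<^sup>2))"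
      using T by (intro key) (auto simp: power2_eq_square)
    also have "\<dots> \<le> exp (- (c\<^sup>2 * a)) * (exp (- (c\<^sup>2 * (w - T)\<^sup>2)) + exp (- (c\<^sup>2 * (w + T)\<^sup>2)))"
      by (intro mult_left_mono) auto
    finally show ?thesis .
  qed
  then show ?thesis unfolding T_def by (rule add_increasing[rotated]) simp
qed

text \<open>Undoing the smoothing by the standard normal noise is ill-posed: recovering the frequencies
  below the cutoff \<open>\<surd>a\<close> amplifies the error by \<open>exp a\<close>, and giving up on the others costs
  \<open>exp (- c\<^sup>2 a)\<close>.\<close>

lemma deconvolution_tradeoff:
  assumes H: "real_distribution H" "real_distribution K" and c: "c > 0" and a: "a \<ge> 0"
  shows "(LINT x|lborel. (gauss_mix c H x - gauss_mix c K x)\<^sup>2)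
    \<le> exp a * (LINT x|lborel. (gauss_mix (sigma_star c) H x - gauss_mix (sigma_star c) K x)\<^sup>2)
      + exp (- (c\<^sup>2 * a)) * (8 / (sqrt pi * c))"
proof -
  define \<Lambda> where "\<Lambda> = transform_gap H K"
  have \<Lambda>: "0 \<le> \<Lambda> w" "\<Lambda> w \<le> 8" for w using transform_gap_bounds[OF H] by (auto simp: \<Lambda>_def)
  define s where "s = sigma_star c"
  have s: "s > 0" "s\<^sup>2 = 1 + c\<^sup>2" by (auto simp: s_def sigma_star_sq)
  define G where "G r w = exp (- (c\<^sup>2 * (w - r)\<^sup>2))" for r w :: real
  have G: "has_bochner_integral lborel (G r) (sqrt pi / c)" for r
    unfolding G_def[abs_def] by (rule has_bochner_integral_gauss_exp[OF c])
  note Pc = gauss_mix_parseval[OF H c, folded \<Lambda>_def]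
  note Ps = gauss_mix_parseval[OF H s(1), folded \<Lambda>_def]
  have "2 * pi * (LINT x|lborel. (gauss_mix c H x - gauss_mix c K x)\<^sup>2)
      = (LINT w|lborel. exp (- (c\<^sup>2 * w\<^sup>2)) * \<Lambda> w)" by (rule Pc(3))
  also have "\<dots> \<le> (LINT w|lborel. exp a * (exp (- (s\<^sup>2 * w\<^sup>2)) * \<Lambda> w)
      + exp (- (c\<^sup>2 * a)) * 8 * (G (sqrt a) w + G (- sqrt a) w))"
  proof (rule integral_mono[OF Pc(2)])
    show "integrable lborel (\<lambda>w. exp a * (exp (- (s\<^sup>2 * w\<^sup>2)) * \<Lambda> w)
      + exp (- (c\<^sup>2 * a)) * 8 * (G (sqrt a) w + G (- sqrt a) w))"
      using Ps(2) G by (auto simp: has_bochner_integral_iff)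
    fix w
    have "exp (- (c\<^sup>2 * w\<^sup>2)) \<le> exp a * exp (- (s\<^sup>2 * w\<^sup>2)) + exp (- (c\<^sup>2 * a)) * (G (sqrt a) w + G (- sqrt a) w)"
      using frequency_split[OF c a, of w] by (simp add: s(2) G_def)
    then have "exp (- (c\<^sup>2 * w\<^sup>2)) * \<Lambda> w
      \<le> (exp a * exp (- (s\<^sup>2 * w\<^sup>2)) + exp (- (c\<^sup>2 * a)) * (G (sqrt a) w + G (- sqrt a) w)) * \<Lambda> w"
      using \<Lambda>(1) by (rule mult_right_mono)
    also have "\<dots> = exp a * (exp (- (s\<^sup>2 * w\<^sup>2)) * \<Lambda> w) + exp (- (c\<^sup>2 * a)) * (G (sqrt a) w + G (- sqrt a) w) * \<Lambda> w"
      by (simp add: algebra_simps)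
    also have "exp (- (c\<^sup>2 * a)) * (G (sqrt a) w + G (- sqrt a) w) * \<Lambda> w
      \<le> exp (- (c\<^sup>2 * a)) * (G (sqrt a) w + G (- sqrt a) w) * 8"
      using \<Lambda>(2) by (intro mult_left_mono) (auto simp: G_def)
    finally show "exp (- (c\<^sup>2 * w\<^sup>2)) * \<Lambda> w \<le> exp a * (exp (- (s\<^sup>2 * w\<^sup>2)) * \<Lambda> w)
      + exp (- (c\<^sup>2 * a)) * 8 * (G (sqrt a) w + G (- sqrt a) w)" by (simp add: algebra_simps)
  qed
  also have "\<dots> = exp a * (LINT w|lborel. exp (- (s\<^sup>2 * w\<^sup>2)) * \<Lambda> w) + exp (- (c\<^sup>2 * a)) * 8 * (sqrt pi / c + sqrt pi / c)"
    using Ps(2) G by (simp add: has_bochner_integral_iff)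
  also have "\<dots> = 2 * pi * (exp a * (LINT x|lborel. (gauss_mix s H x - gauss_mix s K x)\<^sup>2)
      + exp (- (c\<^sup>2 * a)) * (8 / (sqrt pi * c)))"
  proof -
    have "sqrt pi = pi / sqrt pi" by (simp add: real_div_sqrt)
    then show ?thesis unfolding Ps(3)[symmetric] using c by (simp add: field_simps)
  qed
  finally show ?thesis by (simp add: s_def)
qed

definition deconv_const :: "real \<Rightarrow> real" where
  "deconv_const c = 8 * normal_density 0 (sigma_star c) 0 + 8 / (sqrt pi * c)"

lemma deconv_const_pos: "c > 0 \<Longrightarrow> deconv_const c > 0"
  unfolding deconv_const_def by (intro add_nonneg_pos) (auto simp: normal_density_nonneg)

lemma alpha_star_bounds:
  assumes "c > 0"
  shows "0 < alpha_star c" "alpha_star c < 1" "1 - alpha_star c = 1 / (sigma_star c)\<^sup>2"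
proof -
  have "1 + c\<^sup>2 > 0" by (simp add: add_pos_nonneg)
  then show "0 < alpha_star c" "alpha_star c < 1" "1 - alpha_star c = 1 / (sigma_star c)\<^sup>2"
    using assms by (auto simp: alpha_star_def sigma_star_sq divide_simps)
qed

text \<open>The cutoff with \<open>exp (- (1 + c\<^sup>2) a) = y\<close> balances the two terms, and each of them is then of order
  \<open>y powr alpha_star c\<close>.  This is where the exponent of the theorem comes from.\<close>

lemma deconvolution_affinity:
  assumes H: "real_distribution H" "real_distribution K" and c: "c > 0"
    and y: "y > 0" "1 - affinity (sigma_star c) H K \<le> y"
  shows "(LINT x|lborel. (gauss_mix c H x - gauss_mix c K x)\<^sup>2) \<le> deconv_const c * y powr alpha_star c"
proof -
  define s where "s = sigma_star c"
  have s: "s > 0" by (simp add: s_def)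
  \<comment> \<open>the squared cutoff \<open>a\<close> below has to be nonnegative; truncation loses nothing because
      \<open>1 - affinity\<close> never exceeds 1\<close>
  define z where "z = min y 1"
  have z: "0 < z" "z \<le> 1" "z \<le> y" using y by (auto simp: z_def)
  have zk: "1 - affinity s H K \<le> z"
    using y affinity_nonneg[OF H s] by (auto simp: z_def s_def)
  define a where "a = - ln z / s\<^sup>2"
  have a: "a \<ge> 0" using z s by (simp add: a_def divide_le_0_iff)
  have e1: "exp a = z powr (alpha_star c - 1)"
  proof -
    have "alpha_star c - 1 = - (1 / s\<^sup>2)" using alpha_star_bounds(3)[OF c] unfolding s_def by linarith
    then show ?thesis using z by (simp add: a_def powr_def)
  qed
  have e2: "exp (- (c\<^sup>2 * a)) = z powr alpha_star c"
    using z by (simp add: a_def powr_def alpha_star_def s_def)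
  have "(LINT x|lborel. (gauss_mix c H x - gauss_mix c K x)\<^sup>2)
    \<le> exp a * (LINT x|lborel. (gauss_mix s H x - gauss_mix s K x)\<^sup>2) + exp (- (c\<^sup>2 * a)) * (8 / (sqrt pi * c))"
    unfolding s_def by (rule deconvolution_tradeoff[OF H c a])
  also have "\<dots> \<le> exp a * (8 * normal_density 0 s 0 * z) + exp (- (c\<^sup>2 * a)) * (8 / (sqrt pi * c))"
  proof (intro add_mono mult_left_mono order_refl)
    have "(LINT x|lborel. (gauss_mix s H x - gauss_mix s K x)\<^sup>2) \<le> 8 * normal_density 0 s 0 * (1 - affinity s H K)"
      by (rule L2_distance_le_affinity[OF H s])
    also have "\<dots> \<le> 8 * normal_density 0 s 0 * z"
      using zk by (intro mult_left_mono) (auto simp: normal_density_nonneg)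
    finally show "(LINT x|lborel. (gauss_mix s H x - gauss_mix s K x)\<^sup>2) \<le> 8 * normal_density 0 s 0 * z" .
  qed simp_all
  also have "\<dots> = deconv_const c * z powr alpha_star c"
  proof -
    have "z powr (alpha_star c - 1) * z = z powr alpha_star c"
      using z by (simp add: powr_diff)
    then show ?thesis unfolding e1 e2 by (simp add: deconv_const_def s_def algebra_simps)
  qed
  also have "\<dots> \<le> deconv_const c * y powr alpha_star c"
    using z deconv_const_pos[OF c] alpha_star_bounds[OF c] by (intro mult_left_mono powr_mono2) auto
  finally show ?thesis .
qed

section \<open>Entropy of Gaussian mixtures\<close>

lemma norm_complex_gauss_le:
  assumes s: "s > 0" and z: "\<bar>Im z\<bar> \<le> R"
  shows "norm (exp (- (z\<^sup>2) / of_real (2 * s\<^sup>2))) \<le> exp (R\<^sup>2 / (2 * s\<^sup>2))"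
proof -
  have "(Im z)\<^sup>2 \<le> R\<^sup>2" using power_mono[OF z, of 2] by simp
  then have "Re (- (z\<^sup>2)) \<le> R\<^sup>2" by (simp add: power2_eq_square) (smt (verit) zero_le_square)
  moreover have "Re (- (z\<^sup>2) / of_real (2 * s\<^sup>2)) = Re (- (z\<^sup>2)) / (2 * s\<^sup>2)"
    by (rule Re_divide_of_real)
  ultimately have "Re (- (z\<^sup>2) / of_real (2 * s\<^sup>2)) \<le> R\<^sup>2 / (2 * s\<^sup>2)"
    using divide_right_mono[of "Re (- (z\<^sup>2))" "R\<^sup>2" "2 * s\<^sup>2"] by simp
  then show ?thesis by (simp only: norm_exp_eq_Re exp_le_cancel_iff)
qed

text \<open>The kernel is entire.  On the circle of radius \<open>R\<close> about any real centre its modulus is at most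
  \<open>exp (R\<^sup>2 / (2 s\<^sup>2))\<close>, and Cauchy's estimates bound the Taylor coefficients.  The bound is uniform in
  the centre \<open>w\<close>; hence it passes to mixtures over arbitrary mixing distributions.\<close>

lemma gauss_taylor_coefficients:
  assumes s: "s > 0"
  obtains b :: "nat \<Rightarrow> real \<Rightarrow> real" where
    "\<And>k. b k \<in> borel_measurable borel"
    "\<And>k w R. R > 0 \<Longrightarrow> \<bar>b k w\<bar> \<le> exp (R\<^sup>2 / (2 * s\<^sup>2)) / R ^ k"
    "\<And>w u. (\<lambda>k. b k w * u ^ k) sums exp (- (w + u)\<^sup>2 / (2 * s\<^sup>2))"
proof -
  define E :: "complex \<Rightarrow> complex" where "E z = exp (- (z\<^sup>2) / of_real (2 * s\<^sup>2))" for z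
  have hol: "E holomorphic_on A" for A
    unfolding E_def using s by (intro holomorphic_intros) auto
  have holn: "(deriv ^^ k) E holomorphic_on UNIV" for k
    by (rule holomorphic_higher_deriv[OF hol open_UNIV])
  define b where "b k w = Re ((deriv ^^ k) E (of_real w)) / fact k" for k w
  have "b k \<in> borel_measurable borel" for k
  proof (rule borel_measurable_continuous_onI)
    have "continuous_on UNIV (\<lambda>w. (deriv ^^ k) E (complex_of_real w))"
      by (rule continuous_on_compose2[OF holomorphic_on_imp_continuous_on[OF holn]])
         (auto intro: continuous_intros)
    then show "continuous_on UNIV (b k)" unfolding b_def by (intro continuous_intros) auto
  qed
  moreover have "\<bar>b k w\<bar> \<le> exp (R\<^sup>2 / (2 * s\<^sup>2)) / R ^ k" if R: "R > 0" for k w R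
  proof -
    have "norm ((deriv ^^ k) E (of_real w)) \<le> fact k * exp (R\<^sup>2 / (2 * s\<^sup>2)) / R ^ k"
    proof (rule Cauchy_inequality[OF hol holomorphic_on_imp_continuous_on[OF hol] R])
      fix x assume "norm (complex_of_real w - x) = R"
      then have "\<bar>Im x\<bar> \<le> R" using abs_Im_le_cmod[of "complex_of_real w - x"] by simp
      then show "norm (E x) \<le> exp (R\<^sup>2 / (2 * s\<^sup>2))" unfolding E_def by (rule norm_complex_gauss_le[OF s])
    qed
    moreover have "\<bar>Re ((deriv ^^ k) E (of_real w))\<bar> \<le> norm ((deriv ^^ k) E (of_real w))"
      by (rule abs_Re_le_cmod)
    ultimately have "\<bar>Re ((deriv ^^ k) E (of_real w))\<bar> \<le> fact k * (exp (R\<^sup>2 / (2 * s\<^sup>2)) / R ^ k)" by simp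
    then show ?thesis unfolding b_def by (simp add: abs_divide divide_le_eq mult.commute)
  qed
  moreover have "(\<lambda>k. b k w * u ^ k) sums exp (- (w + u)\<^sup>2 / (2 * s\<^sup>2))" for w u
  proof -
    have "(\<lambda>k. (deriv ^^ k) E (of_real w) / fact k * (of_real (w + u) - of_real w) ^ k) sums E (of_real (w + u))"
      by (rule holomorphic_power_series[OF hol, of _ _ "\<bar>u\<bar> + 1"]) (auto simp: dist_norm)
    then have "(\<lambda>k. Re ((deriv ^^ k) E (of_real w) / fact k * (of_real (w + u) - of_real w) ^ k)) sums Re (E (of_real (w + u)))"
      by (rule sums_Re)
    moreover have "Re ((deriv ^^ k) E (of_real w) / fact k * (of_real (w + u) - of_real w) ^ k) = b k w * u ^ k" for k
    proof -
      have "(deriv ^^ k) E (of_real w) / fact k * (of_real (w + u) - of_real w) ^ k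
        = (deriv ^^ k) E (of_real w) * of_real (u ^ k / fact k)" by simp
      also have "Re \<dots> = Re ((deriv ^^ k) E (of_real w)) * (u ^ k / fact k)" by (simp only: Re_complex_of_real times_complex.sel Im_complex_of_real)
      finally show ?thesis by (simp add: b_def)
    qed
    moreover have "E (of_real (w + u)) = of_real (exp (- (w + u)\<^sup>2 / (2 * s\<^sup>2)))"
      unfolding E_def by (simp add: exp_of_real[symmetric])
    ultimately show ?thesis by (simp only: Re_complex_of_real)
  qed
  ultimately show thesis by (rule that)
qed

lemma geometric_half_tail:
  assumes sums: "(\<lambda>k. f k) sums (S::real)" and bd: "\<And>k. \<bar>f k\<bar> \<le> E * (1/2) ^ k"
  shows "\<bar>S - (\<Sum>k<K. f k)\<bar> \<le> 2 * E / 2 ^ K"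
proof -
  have g: "(\<lambda>k. E * (1/2) ^ (k + K)) sums (E * (1/2) ^ K * 2)"
    using sums_mult[OF geometric_sums[of "1/2::real"], of "E * (1/2) ^ K"] by (simp add: power_add algebra_simps)
  have f: "(\<lambda>k. f (k + K)) sums (S - (\<Sum>k<K. f k))"
    using sums by (rule sums_split_initial_segment)
  have "S - (\<Sum>k<K. f k) \<le> E * (1/2) ^ K * 2"
    using f g by (rule sums_le[rotated]) (use bd abs_le_D1 in blast)
  moreover have "- (S - (\<Sum>k<K. f k)) \<le> E * (1/2) ^ K * 2"
    using sums_minus[OF f] g by (rule sums_le[rotated]) (use bd abs_le_D2 in blast)
  ultimately show ?thesis by (simp add: power_divide abs_le_iff mult.commute)
qed

text \<open>Within distance \<open>L\<close> of a centre \<open>z\<close>, a mixture is determined up to a geometrically small error by its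
  first \<open>K\<close> Taylor coefficients at \<open>z\<close>; the coefficient bound is used with \<open>R = 2 L\<close>, which makes the
  ratio \<open>1/2\<close>.  Rounding these coefficients, rescaled by \<open>L ^ k\<close>, to multiples of \<open>\<gamma>\<close> gives a code with
  \<open>card X0 * K\<close> entries of at most \<open>2 m + 1\<close> values each.  The net picks one member of \<open>\<H>\<close> per code that
  occurs; therefore it consists of members of \<open>\<H>\<close> itself, as needed when \<open>\<H>\<close> collects the mixing
  distributions that are far from the truth.\<close>

lemma gauss_mix_entropy:
  fixes X0 :: "real set" and \<H> :: "real measure set"
  assumes s: "s > 0" and \<H>: "\<And>H. H \<in> \<H> \<Longrightarrow> real_distribution H"
    and X0: "finite X0" and L: "L > 0" and \<gamma>: "\<gamma> > 0"
    and m: "exp (2 * L\<^sup>2 / s\<^sup>2) \<le> real m * \<gamma>"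
  obtains \<N> where "finite \<N>" "\<N> \<subseteq> \<H>" "card \<N> \<le> (2 * m + 1) ^ (card X0 * K)"
    "\<And>H. H \<in> \<H> \<Longrightarrow> \<exists>H'\<in>\<N>. \<forall>x. (\<exists>z\<in>X0. \<bar>x - z\<bar> \<le> L) \<longrightarrow>
       gauss_mix s H x \<le> gauss_mix s H' x + normal_density 0 s 0 * (real K * \<gamma> + 4 * exp (2 * L\<^sup>2 / s\<^sup>2) / 2 ^ K)"
proof -
  define E where "E = exp (2 * L\<^sup>2 / s\<^sup>2)"
  define p where "p = normal_density 0 s 0"
  have p: "p \<ge> 0" by (simp add: p_def normal_density_nonneg)
  obtain b :: "nat \<Rightarrow> real \<Rightarrow> real" where
    b_meas[measurable]: "\<And>k. b k \<in> borel_measurable borel" and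
    b_bound: "\<And>k w R. R > 0 \<Longrightarrow> \<bar>b k w\<bar> \<le> exp (R\<^sup>2 / (2 * s\<^sup>2)) / R ^ k" and
    b_sums: "\<And>w u. (\<lambda>k. b k w * u ^ k) sums exp (- (w + u)\<^sup>2 / (2 * s\<^sup>2))"
    using gauss_taylor_coefficients[OF s] by blast
  have bE: "\<bar>b k w\<bar> \<le> E / (2 * L) ^ k" for k w
    using b_bound[of "2 * L" k w] L by (simp add: E_def power_mult_distrib)
  define A where "A H z k = (LINT \<xi>|H. b k (z - \<xi>)) * L ^ k" for H z k
  have intb: "integrable H (\<lambda>\<xi>. b k (z - \<xi>))" if "H \<in> \<H>" for H z k
  proof -
    interpret real_distribution H by (rule \<H>[OF that])
    show ?thesis by (rule integrable_const_bound[where B = "E / (2 * L) ^ k"]) (use bE in auto)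
  qed
  have A_bound: "\<bar>A H z k\<bar> \<le> E" if "H \<in> \<H>" for H z k
  proof -
    interpret real_distribution H by (rule \<H>[OF that])
    have "\<bar>LINT \<xi>|H. b k (z - \<xi>)\<bar> \<le> (LINT \<xi>|H. E / (2 * L) ^ k)"
      using intb[OF that] bE by (intro integral_abs_bound_integral) auto
    then have "\<bar>LINT \<xi>|H. b k (z - \<xi>)\<bar> \<le> E / (2 * L) ^ k" using prob_space by simp
    then have "\<bar>A H z k\<bar> \<le> E / (2 * L) ^ k * L ^ k"
      unfolding A_def abs_mult using L by (intro mult_mono) auto
    also have "\<dots> = E / 2 ^ k" using L by (simp add: power_mult_distrib)
    also have "\<dots> \<le> E / 1" by (rule divide_left_mono) (auto simp: E_def)
    finally show ?thesis by simp
  qed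
  have approx: "\<bar>gauss_mix s H x - p * (\<Sum>k<K. A H z k * ((x - z) / L) ^ k)\<bar> \<le> p * (2 * E / 2 ^ K)"
    if H: "H \<in> \<H>" and x: "\<bar>x - z\<bar> \<le> L" for H x z
  proof -
    interpret real_distribution H by (rule \<H>[OF H])
    have pt: "\<bar>exp (- (x - \<xi>)\<^sup>2 / (2 * s\<^sup>2)) - (\<Sum>k<K. b k (z - \<xi>) * (x - z) ^ k)\<bar> \<le> 2 * E / 2 ^ K" for \<xi>
    proof (rule geometric_half_tail)
      show "(\<lambda>k. b k (z - \<xi>) * (x - z) ^ k) sums exp (- (x - \<xi>)\<^sup>2 / (2 * s\<^sup>2))"
        using b_sums[of "z - \<xi>" "x - z"] by (simp add: algebra_simps)
      fix k
      have "\<bar>b k (z - \<xi>) * (x - z) ^ k\<bar> \<le> E / (2 * L) ^ k * L ^ k"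
        unfolding abs_mult power_abs using bE x L by (intro mult_mono power_mono) (auto simp: E_def)
      also have "\<dots> = E * (1/2) ^ k" using L by (simp add: power_mult_distrib power_divide)
      finally show "\<bar>b k (z - \<xi>) * (x - z) ^ k\<bar> \<le> E * (1/2) ^ k" .
    qed
    have int1: "integrable H (\<lambda>\<xi>. exp (- (x - \<xi>)\<^sup>2 / (2 * s\<^sup>2)))"
      by (rule integrable_const_bound[where B = 1]) auto
    have int2: "integrable H (\<lambda>\<xi>. \<Sum>k<K. b k (z - \<xi>) * (x - z) ^ k)"
      using intb[OF H] by auto
    have "gauss_mix s H x = p * (LINT \<xi>|H. exp (- (x - \<xi>)\<^sup>2 / (2 * s\<^sup>2)))"
      unfolding gauss_mix_def p_def by (simp add: normal_density_def)
    moreover have "(LINT \<xi>|H. (\<Sum>k<K. b k (z - \<xi>) * (x - z) ^ k)) = (\<Sum>k<K. A H z k * ((x - z) / L) ^ k)"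
      using intb[OF H] L by (simp add: Bochner_Integration.integral_sum A_def power_divide)
    moreover have "\<bar>(LINT \<xi>|H. exp (- (x - \<xi>)\<^sup>2 / (2 * s\<^sup>2))) - (LINT \<xi>|H. (\<Sum>k<K. b k (z - \<xi>) * (x - z) ^ k))\<bar>
      \<le> 2 * E / 2 ^ K"
    proof -
      have "\<bar>LINT \<xi>|H. exp (- (x - \<xi>)\<^sup>2 / (2 * s\<^sup>2)) - (\<Sum>k<K. b k (z - \<xi>) * (x - z) ^ k)\<bar> \<le> (LINT \<xi>|H. 2 * E / 2 ^ K)"
        using int1 int2 pt by (intro integral_abs_bound_integral Bochner_Integration.integrable_diff) auto
      then show ?thesis using int1 int2 prob_space by simp
    qed
    ultimately have eq: "gauss_mix s H x = p * (LINT \<xi>|H. exp (- (x - \<xi>)\<^sup>2 / (2 * s\<^sup>2)))"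
      and d: "\<bar>(LINT \<xi>|H. exp (- (x - \<xi>)\<^sup>2 / (2 * s\<^sup>2))) - (\<Sum>k<K. A H z k * ((x - z) / L) ^ k)\<bar> \<le> 2 * E / 2 ^ K"
      by auto
    show ?thesis
      unfolding eq right_diff_distrib[symmetric] abs_mult abs_of_nonneg[OF p] using d p by (rule mult_left_mono)
  qed
  define code where "code H = (\<lambda>zk\<in>X0 \<times> {..<K}. \<lfloor>A H (fst zk) (snd zk) / \<gamma>\<rfloor>)" for H
  have code_range: "code ` \<H> \<subseteq> PiE (X0 \<times> {..<K}) (\<lambda>_. {- int m..int m})"
  proof (intro subsetI, elim imageE)
    fix y H assume y: "y = code H" and H: "H \<in> \<H>"
    have "\<lfloor>A H z k / \<gamma>\<rfloor> \<in> {- int m..int m}" for z k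
    proof -
      have "\<bar>A H z k\<bar> \<le> real m * \<gamma>" using A_bound[OF H, of z k] m by (simp add: E_def)
      then have "- real m \<le> A H z k / \<gamma>" "A H z k / \<gamma> \<le> real m" using \<gamma> by (auto simp: field_simps abs_le_iff)
      then show ?thesis by (auto simp: le_floor_iff floor_le_iff)
    qed
    then show "y \<in> PiE (X0 \<times> {..<K}) (\<lambda>_. {- int m..int m})" unfolding y code_def by auto
  qed
  have fin: "finite (PiE (X0 \<times> {..<K}) (\<lambda>_. {- int m..int m}))" using X0 by (intro finite_PiE) auto
  have card: "card (PiE (X0 \<times> {..<K}) (\<lambda>_. {- int m..int m})) = (2 * m + 1) ^ (card X0 * K)"
  proof -
    have "nat (2 * int m + 1) = 2 * m + 1" by simp
    then show ?thesis using X0 by (simp add: card_PiE card_cartesian_product)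
  qed
  define \<N> where "\<N> = inv_into \<H> code ` (code ` \<H>)"
  have finc: "finite (code ` \<H>)" using code_range fin by (rule finite_subset)
  show thesis
  proof (rule that[of \<N>])
    show "finite \<N>" using finc by (simp add: \<N>_def)
    show "\<N> \<subseteq> \<H>" by (auto simp: \<N>_def intro: inv_into_into)
    have "card \<N> \<le> card (code ` \<H>)" unfolding \<N>_def by (rule card_image_le[OF finc])
    also have "\<dots> \<le> (2 * m + 1) ^ (card X0 * K)" using card_mono[OF fin code_range] card by simp
    finally show "card \<N> \<le> (2 * m + 1) ^ (card X0 * K)" .
    fix H assume H: "H \<in> \<H>"
    define H' where "H' = inv_into \<H> code (code H)"
    have H': "H' \<in> \<N>" "H' \<in> \<H>" "code H' = code H"
      using H by (auto simp: H'_def \<N>_def f_inv_into_f intro: inv_into_into)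
    show "\<exists>H'\<in>\<N>. \<forall>x. (\<exists>z\<in>X0. \<bar>x - z\<bar> \<le> L) \<longrightarrow>
       gauss_mix s H x \<le> gauss_mix s H' x + normal_density 0 s 0 * (real K * \<gamma> + 4 * exp (2 * L\<^sup>2 / s\<^sup>2) / 2 ^ K)"
    proof (intro bexI[OF _ H'(1)] allI impI, elim bexE)
      fix x z assume z: "z \<in> X0" and x: "\<bar>x - z\<bar> \<le> L"
      define v where "v = (x - z) / L"
      have v: "\<bar>v\<bar> \<le> 1" using x L by (simp add: v_def abs_divide)
      have diff: "A H z k - A H' z k \<le> \<gamma>" "A H' z k - A H z k \<le> \<gamma>" if "k < K" for k
      proof -
        have "code H (z, k) = code H' (z, k)" using H'(3) by simp
        then have "\<lfloor>A H z k / \<gamma>\<rfloor> = \<lfloor>A H' z k / \<gamma>\<rfloor>" using z that by (simp add: code_def)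
        then have "A H z k / \<gamma> < A H' z k / \<gamma> + 1" "A H' z k / \<gamma> < A H z k / \<gamma> + 1" by linarith+
        then show "A H z k - A H' z k \<le> \<gamma>" "A H' z k - A H z k \<le> \<gamma>" using \<gamma> by (simp_all add: field_simps)
      qed
      have "(\<Sum>k<K. A H z k * v ^ k) - (\<Sum>k<K. A H' z k * v ^ k) = (\<Sum>k<K. (A H z k - A H' z k) * v ^ k)"
        by (simp add: sum_subtractf left_diff_distrib)
      also have "\<dots> \<le> (\<Sum>k<K. \<gamma>)"
      proof (rule sum_mono)
        fix k assume "k \<in> {..<K}"
        then have "\<bar>(A H z k - A H' z k) * v ^ k\<bar> \<le> \<gamma> * 1"
          unfolding abs_mult using diff[of k] v \<gamma>
          by (intro mult_mono) (auto simp: abs_le_iff power_abs intro!: power_le_one)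
        then show "(A H z k - A H' z k) * v ^ k \<le> \<gamma>" by linarith
      qed
      finally have "p * ((\<Sum>k<K. A H z k * v ^ k) - (\<Sum>k<K. A H' z k * v ^ k)) \<le> p * (real K * \<gamma>)"
        using p by (intro mult_left_mono) auto
      moreover have "gauss_mix s H x - p * (\<Sum>k<K. A H z k * v ^ k) \<le> p * (2 * E / 2 ^ K)"
        using approx[OF H x] by (simp add: v_def abs_le_iff)
      moreover have "p * (\<Sum>k<K. A H' z k * v ^ k) - gauss_mix s H' x \<le> p * (2 * E / 2 ^ K)"
        using approx[OF H'(2) x] by (simp add: v_def abs_le_iff)
      moreover have "p * (real K * \<gamma> + 4 * E / 2 ^ K) = p * (real K * \<gamma>) + 2 * (p * (2 * E / 2 ^ K))"
        by (simp add: distrib_left)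
      ultimately show "gauss_mix s H x \<le> gauss_mix s H' x + normal_density 0 s 0 * (real K * \<gamma> + 4 * exp (2 * L\<^sup>2 / s\<^sup>2) / 2 ^ K)"
        unfolding p_def[symmetric] E_def[symmetric] right_diff_distrib by linarith
    qed
  qed
qed

section \<open>Covering neighbourhoods of compact sets\<close>

text \<open>\<open>J\<close> indexes the cells of a grid of mesh \<open>r\<close> that meet \<open>S\<close>.  Each such cell lies entirely within
  distance \<open>r\<close> of \<open>S\<close>, so the volume of the enlargement controls their number.\<close>

lemma cell_cover:
  fixes S :: "real set"
  assumes S: "compact S" "S \<noteq> {}" and r: "r > 0"
  obtains J :: "int set" where "finite J" "J \<noteq> {}" "real (card J) * r \<le> measure lborel (enlargement S r)"
    "\<And>s. s \<in> S \<Longrightarrow> \<exists>j\<in>J. r * of_int j \<le> s \<and> s \<le> r * of_int j + r"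
proof -
  define J where "J = (\<lambda>s. \<lfloor>s / r\<rfloor>) ` S"
  define cell where "cell j = {r * of_int j ..< r * of_int j + r}" for j :: int
  have in_cell: "s \<in> cell \<lfloor>s / r\<rfloor>" for s
  proof -
    have "of_int \<lfloor>s / r\<rfloor> \<le> s / r" "s / r < of_int \<lfloor>s / r\<rfloor> + 1" by linarith+
    then show ?thesis
      using r mult_left_mono[of "of_int \<lfloor>s / r\<rfloor>" "s / r" r] mult_strict_left_mono[of "s / r" "of_int \<lfloor>s / r\<rfloor> + 1" r]
      by (simp add: cell_def distrib_left)
  qed
  have cell_floor: "\<lfloor>x / r\<rfloor> = j" if "x \<in> cell j" for x j
    using that r by (intro floor_unique) (auto simp: cell_def field_simps)
  obtain B where B: "\<And>s. s \<in> S \<Longrightarrow> \<bar>s\<bar> \<le> B"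
    using compact_imp_bounded[OF S(1)] by (auto simp: bounded_iff)
  have "J \<subseteq> {\<lfloor>- B / r\<rfloor>..\<lfloor>B / r\<rfloor>}"
  proof
    fix j assume "j \<in> J"
    then obtain s where s: "s \<in> S" "j = \<lfloor>s / r\<rfloor>" by (auto simp: J_def)
    have "- B \<le> s" "s \<le> B" using B[OF s(1)] by linarith+
    then have "- B / r \<le> s / r" "s / r \<le> B / r" using r by (intro divide_right_mono; simp)+
    then show "j \<in> {\<lfloor>- B / r\<rfloor>..\<lfloor>B / r\<rfloor>}" unfolding s(2) atLeastAtMost_iff by (intro conjI floor_mono)
  qed
  then have fin: "finite J" by (rule finite_subset) simp
  have ecpt: "compact (enlargement S r)"
    unfolding enlargement_def by (rule compact_infdist_le[OF S(2) S(1) r])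
  have sub: "(\<Union>j\<in>J. cell j) \<subseteq> enlargement S r"
  proof
    fix x assume "x \<in> (\<Union>j\<in>J. cell j)"
    then obtain s where s: "s \<in> S" "x \<in> cell \<lfloor>s / r\<rfloor>" by (auto simp: J_def)
    with in_cell[of s] have "dist x s \<le> r" by (auto simp: cell_def dist_real_def)
    then show "x \<in> enlargement S r" using s(1) by (auto simp: enlargement_def intro: infdist_le2)
  qed
  have disj: "disjoint_family_on cell J"
    unfolding disjoint_family_on_def
  proof (intro ballI impI equals0I)
    fix m n x assume "m \<noteq> n" "x \<in> cell m \<inter> cell n"
    then show False using cell_floor[of x m] cell_floor[of x n] by auto
  qed
  have "ennreal (real (card J) * r) = (\<Sum>j\<in>J. emeasure lborel (cell j))"
    using r by (simp add: cell_def ennreal_mult' ennreal_of_nat_eq_real_of_nat)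
  also have "\<dots> = emeasure lborel (\<Union>j\<in>J. cell j)"
    by (intro sum_emeasure fin disj) (auto simp: cell_def)
  also have "\<dots> \<le> emeasure lborel (enlargement S r)"
    using ecpt by (intro emeasure_mono[OF sub]) (simp add: borel_compact)
  also have "\<dots> = ennreal (measure lborel (enlargement S r))"
    using emeasure_bounded_finite[OF compact_imp_bounded[OF ecpt]]
    by (intro emeasure_eq_ennreal_measure) auto
  finally have "real (card J) * r \<le> measure lborel (enlargement S r)" by simp
  moreover have "\<exists>j\<in>J. r * of_int j \<le> s \<and> s \<le> r * of_int j + r" if "s \<in> S" for s
  proof (rule bexI)
    show "r * of_int \<lfloor>s / r\<rfloor> \<le> s \<and> s \<le> r * of_int \<lfloor>s / r\<rfloor> + r"
      using in_cell[of s] by (simp add: cell_def)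
    show "\<lfloor>s / r\<rfloor> \<in> J" using that by (auto simp: J_def)
  qed
  moreover have "J \<noteq> {}" using S(2) by (simp add: J_def)
  ultimately show thesis by (intro that[OF fin])
qed

text \<open>A point within \<open>M\<close> of \<open>S\<close> is within \<open>M\<close> of one of the cells, that is, in an interval of length
  \<open>2 M + r\<close>; each of these intervals is cut into pieces of length \<open>2 L\<close>.\<close>

lemma interval_cover:
  fixes J :: "int set"
  assumes J: "finite J" and S: "closed S" "S \<noteq> {}" and r: "r > 0" and L: "L > 0" and M: "M \<ge> 0"
    and cover: "\<And>s. s \<in> S \<Longrightarrow> \<exists>j\<in>J. r * of_int j \<le> s \<and> s \<le> r * of_int j + r"
  obtains X0 :: "real set" where "finite X0" "real (card X0) \<le> real (card J) * ((2 * M + r) / (2 * L) + 1)"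
    "\<And>x. infdist x S \<le> M \<Longrightarrow> \<exists>z\<in>X0. \<bar>x - z\<bar> \<le> L"
proof -
  define q where "q = nat \<lfloor>(2 * M + r) / (2 * L)\<rfloor>"
  have q: "real q \<le> (2 * M + r) / (2 * L)" using M r L by (simp add: q_def)
  define ctr where "ctr = (\<lambda>(j, i). r * of_int j - M + (2 * real i + 1) * L)"
  define X0 where "X0 = ctr ` (J \<times> {..q})"
  have fin: "finite X0" using J by (simp add: X0_def)
  have "card X0 \<le> card (J \<times> {..q})" unfolding X0_def by (rule card_image_le) (use J in simp)
  then have "card X0 \<le> card J * (q + 1)" by (simp add: card_cartesian_product)
  then have "real (card X0) \<le> real (card J * (q + 1))" by (rule of_nat_mono)
  then have "real (card X0) \<le> real (card J) * (real q + 1)" by (simp add: distrib_left)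
  also have "\<dots> \<le> real (card J) * ((2 * M + r) / (2 * L) + 1)" using q by (intro mult_left_mono) auto
  finally have card: "real (card X0) \<le> real (card J) * ((2 * M + r) / (2 * L) + 1)" .
  have "\<exists>z\<in>X0. \<bar>x - z\<bar> \<le> L" if x: "infdist x S \<le> M" for x
  proof -
    obtain s where s: "s \<in> S" "infdist x S = dist x s" by (rule infdist_attains_inf[OF S])
    obtain j where j: "j \<in> J" "r * of_int j \<le> s" "s \<le> r * of_int j + r" using cover[OF s(1)] by blast
    define y where "y = (x - (r * of_int j - M)) / (2 * L)"
    have xs: "\<bar>x - s\<bar> \<le> M" using x s by (simp add: dist_real_def)
    have y0: "y \<ge> 0" using xs j L by (auto simp: y_def intro!: divide_nonneg_pos)
    have "y \<le> (2 * M + r) / (2 * L)" unfolding y_def using xs j L by (intro divide_right_mono) auto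
    then have i: "nat \<lfloor>y\<rfloor> \<le> q" unfolding q_def by (intro nat_mono floor_mono)
    have fl: "real (nat \<lfloor>y\<rfloor>) \<le> y" "y < real (nat \<lfloor>y\<rfloor>) + 1" using y0 by linarith+
    have xy: "x = r * of_int j - M + 2 * L * y" using L by (simp add: y_def)
    have "x - ctr (j, nat \<lfloor>y\<rfloor>) = 2 * L * (y - real (nat \<lfloor>y\<rfloor>)) - L"
      unfolding ctr_def by (subst xy) (simp add: algebra_simps)
    moreover have "2 * L * (y - real (nat \<lfloor>y\<rfloor>)) \<ge> 0" using fl L by simp
    moreover have "2 * L * (y - real (nat \<lfloor>y\<rfloor>)) \<le> 2 * L * 1" using fl L by (intro mult_left_mono) linarith+
    ultimately have "\<bar>x - ctr (j, nat \<lfloor>y\<rfloor>)\<bar> \<le> L" by linarith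
    then show ?thesis using i j(1) by (auto simp: X0_def)
  qed
  with fin card show thesis by (rule that)
qed

lemma nn_integral_cauchy_bump:
  assumes M: "M > 0"
  shows "(\<integral>\<^sup>+x. ennreal (1 / (1 + ((x - z) / M)\<^sup>2)) \<partial>lborel) = ennreal (pi * M)"
proof -
  have int: "integrable lborel (\<lambda>x::real. inverse (1 + x\<^sup>2))" "(LINT x|lborel. inverse (1 + x\<^sup>2)) = pi"
    using integrable_inverse_1_plus_square LBINT_inverse_1_plus_square
    by (simp_all add: set_integrable_def interval_lebesgue_integral_def set_lebesgue_integral_def einterval_def)
  have "(\<integral>\<^sup>+x. ennreal (1 / (1 + ((x - z) / M)\<^sup>2)) \<partial>lborel)
    = ennreal M * (\<integral>\<^sup>+x. ennreal (1 / (1 + ((z + M * x - z) / M)\<^sup>2)) \<partial>lborel)"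
    using M by (subst nn_integral_real_affine[where c = M and t = z]) auto
  also have "(\<integral>\<^sup>+x. ennreal (1 / (1 + ((z + M * x - z) / M)\<^sup>2)) \<partial>lborel) = (\<integral>\<^sup>+x. ennreal (inverse (1 + x\<^sup>2)) \<partial>lborel)"
    using M by (simp add: inverse_eq_divide)
  also have "\<dots> = ennreal pi"
    using int by (subst nn_integral_eq_integral) (auto simp: add_nonneg_nonneg)
  finally show ?thesis using M by (simp add: mult.commute flip: ennreal_mult)
qed

text \<open>The shape of the correction that is added to the members of the net: constant on the
  \<open>M\<close>-neighbourhood of \<open>S\<close>, where the net approximates uniformly, and outside it integrable but
  decaying only polynomially, so that the likelihood ratio can be compensated by a power of the
  distance to \<open>S\<close>.\<close>

definition envelope :: "real set \<Rightarrow> real \<Rightarrow> real \<Rightarrow> real" where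
  "envelope S M x = 1 / (max 1 (infdist x S / M))\<^sup>2"

lemma measurable_infdist [measurable]: "(\<lambda>x::real. infdist x S) \<in> borel_measurable borel"
  by (intro borel_measurable_continuous_onI continuous_intros)

lemma measurable_envelope [measurable]: "envelope S M \<in> borel_measurable borel"
  unfolding envelope_def[abs_def] by measurable

lemma envelope_pos: "envelope S M x > 0"
  unfolding envelope_def by (intro divide_pos_pos zero_less_power) (auto simp: less_max_iff_disj)

text \<open>Every \<open>x\<close> is within \<open>infdist x S + r\<close> of the left end of some cell.  Hence the envelope is dominated by a
  sum of Cauchy bumps of width \<open>M\<close>, one for each cell.\<close>

lemma nn_integral_envelope_le:
  fixes J :: "int set"
  assumes J: "finite J" and S: "closed S" "S \<noteq> {}" and r: "r \<le> M" and M: "M > 0"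
    and cover: "\<And>s. s \<in> S \<Longrightarrow> \<exists>j\<in>J. r * of_int j \<le> s \<and> s \<le> r * of_int j + r"
  shows "(\<integral>\<^sup>+x. ennreal (envelope S M x) \<partial>lborel) \<le> ennreal (5 * pi * M * real (card J))"
proof -
  have pt: "envelope S M x \<le> 5 * (\<Sum>j\<in>J. 1 / (1 + ((x - r * of_int j) / M)\<^sup>2))" for x
  proof -
    define D where "D = max 1 (infdist x S / M)"
    have D: "D \<ge> 1" "infdist x S \<le> D * M" using M by (auto simp: D_def field_simps max_def)
    obtain s where s: "s \<in> S" "infdist x S = dist x s" by (rule infdist_attains_inf[OF S])
    obtain j where j: "j \<in> J" "r * of_int j \<le> s" "s \<le> r * of_int j + r" using cover[OF s(1)] by blast
    have "\<bar>x - r * of_int j\<bar> \<le> D * M + M" using D s j r by (auto simp: dist_real_def)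
    also have "\<dots> \<le> 2 * D * M" using D M by (simp add: algebra_simps)
    finally have "\<bar>(x - r * of_int j) / M\<bar> \<le> 2 * D" using M by (simp add: abs_divide divide_le_eq)
    then have "((x - r * of_int j) / M)\<^sup>2 \<le> (2 * D)\<^sup>2" by (metis abs_ge_zero power2_abs power_mono)
    moreover have "1 \<le> D\<^sup>2" using D by simp
    ultimately have "1 + ((x - r * of_int j) / M)\<^sup>2 \<le> 5 * D\<^sup>2" by (simp add: power_mult_distrib)
    moreover have "1 + ((x - r * of_int j) / M)\<^sup>2 > 0" by (simp add: add_pos_nonneg)
    ultimately have "1 / D\<^sup>2 \<le> 5 * (1 / (1 + ((x - r * of_int j) / M)\<^sup>2))"
      using D by (simp add: divide_simps)
    also have "1 / (1 + ((x - r * of_int j) / M)\<^sup>2) \<le> (\<Sum>j\<in>J. 1 / (1 + ((x - r * of_int j) / M)\<^sup>2))"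
      using J j(1) by (intro member_le_sum) (auto simp: add_nonneg_nonneg)
    finally show ?thesis by (simp add: envelope_def D_def)
  qed
  have "(\<integral>\<^sup>+x. ennreal (envelope S M x) \<partial>lborel)
    \<le> (\<integral>\<^sup>+x. ennreal 5 * (\<Sum>j\<in>J. ennreal (1 / (1 + ((x - r * of_int j) / M)\<^sup>2))) \<partial>lborel)"
  proof (intro nn_integral_mono)
    fix x
    have "ennreal (envelope S M x) \<le> ennreal (5 * (\<Sum>j\<in>J. 1 / (1 + ((x - r * of_int j) / M)\<^sup>2)))"
      using pt by (intro ennreal_leI)
    also have "\<dots> = ennreal 5 * (\<Sum>j\<in>J. ennreal (1 / (1 + ((x - r * of_int j) / M)\<^sup>2)))"
      by (subst ennreal_mult') (auto simp: sum_ennreal add_nonneg_nonneg)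
    finally show "ennreal (envelope S M x) \<le> ennreal 5 * (\<Sum>j\<in>J. ennreal (1 / (1 + ((x - r * of_int j) / M)\<^sup>2)))" .
  qed
  also have "\<dots> = ennreal 5 * (\<Sum>j\<in>J. ennreal (pi * M))"
    by (subst nn_integral_cmult, simp, subst nn_integral_sum, simp) (simp only: nn_integral_cauchy_bump[OF M])
  also have "\<dots> = ennreal 5 * ennreal (pi * M * real (card J))"
    using M by (subst sum_ennreal) (simp_all add: mult_ac)
  also have "\<dots> = ennreal (5 * (pi * M * real (card J)))"
    using M by (intro ennreal_mult[symmetric]) auto
  finally show ?thesis by (simp add: mult.assoc)
qed

section \<open>Chernoff bounds and tails in the model\<close>

lemma prob_space_triple_law:
  assumes "real_distribution H" "c > 0"
  shows "prob_space (triple_law c H)" "sets (triple_law c H) = sets borel"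
  using prob_triple_law[OF assms] by (auto simp: space_prob_algebra)

lemma prob_space_model:
  assumes "real_distribution H" "c > 0"
  shows "prob_space (model c H n)"
  unfolding model_def by (intro prob_space_PiM prob_space_triple_law[OF assms])

lemma measurable_snd_snd_triple_law:
  assumes "real_distribution H" "c > 0"
  shows "(\<lambda>w. snd (snd w)) \<in> triple_law c H \<rightarrow>\<^sub>M borel"
  by (subst measurable_cong_sets[OF prob_space_triple_law(2)[OF assms] refl])
     (unfold borel_prod[symmetric], measurable)

lemma measurable_obs:
  assumes "real_distribution H" "c > 0" "i \<in> {1..n}"
  shows "(\<lambda>\<omega>. obs \<omega> i) \<in> borel_measurable (model c H n)"
  unfolding obs_def model_def
  by (rule measurable_compose[OF measurable_component_singleton[OF assms(3)] measurable_snd_snd_triple_law[OF assms(1,2)]])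

lemma nn_integral_model_prod:
  assumes H: "real_distribution H" "c > 0" and h[measurable]: "h \<in> borel_measurable borel"
  shows "(\<integral>\<^sup>+\<omega>. (\<Prod>i=1..n. h (obs \<omega> i)) \<partial>model c H n)
    = (\<integral>\<^sup>+x. h x * ennreal (gauss_mix (sigma_star c) H x) \<partial>lborel) ^ n"
proof -
  interpret H: real_distribution H by fact
  interpret T: prob_space "triple_law c H" by (rule prob_space_triple_law[OF H])
  interpret product_sigma_finite "\<lambda>_::nat. triple_law c H" by unfold_locales
  note ms = measurable_snd_snd_triple_law[OF H]
  have "(\<integral>\<^sup>+\<omega>. (\<Prod>i=1..n. h (obs \<omega> i)) \<partial>model c H n)
    = (\<Prod>i=1..n. \<integral>\<^sup>+w. h (snd (snd w)) \<partial>triple_law c H)"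
    unfolding model_def obs_def
    by (rule product_nn_integral_prod) (auto intro: measurable_compose[OF ms h])
  also have "(\<integral>\<^sup>+w. h (snd (snd w)) \<partial>triple_law c H)
    = (\<integral>\<^sup>+x. h x \<partial>distr (triple_law c H) borel (\<lambda>w. snd (snd w)))"
    by (rule nn_integral_distr[symmetric, OF ms]) simp
  also have "\<dots> = (\<integral>\<^sup>+x. h x * ennreal (gauss_mix (sigma_star c) H x) \<partial>lborel)"
    unfolding distr_obs[OF H] f_dens_eq_gauss_mix by (subst nn_integral_density) (auto simp: mult.commute)
  finally show ?thesis by simp
qed

text \<open>Markov's inequality for the exponential of the sum, which factorises over the independent
  observations; each of them has density \<open>f_dens c H\<close>.\<close>

lemma chernoff_model:
  assumes H: "real_distribution H" "c > 0" and w[measurable]: "w \<in> borel_measurable borel"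
  shows "{\<omega>\<in>space (model c H n). b \<le> (\<Sum>i=1..n. w (obs \<omega> i))} \<in> sets (model c H n)"
    and "emeasure (model c H n) {\<omega>\<in>space (model c H n). b \<le> (\<Sum>i=1..n. w (obs \<omega> i))}
      \<le> ennreal (exp (- b)) * (\<integral>\<^sup>+x. ennreal (exp (w x)) * ennreal (gauss_mix (sigma_star c) H x) \<partial>lborel) ^ n"
proof -
  let ?P = "model c H n"
  have [measurable]: "(\<lambda>\<omega>. obs \<omega> i) \<in> borel_measurable ?P" if "i \<in> {1..n}" for i
    by (rule measurable_obs[OF H that])
  have [measurable]: "(\<lambda>\<omega>. \<Sum>i=1..n. w (obs \<omega> i)) \<in> borel_measurable ?P"
    by (intro borel_measurable_sum) (rule measurable_compose[OF measurable_obs[OF H] w], simp)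
  show "{\<omega>\<in>space ?P. b \<le> (\<Sum>i=1..n. w (obs \<omega> i))} \<in> sets ?P" by measurable
  have "emeasure ?P {\<omega>\<in>space ?P. b \<le> (\<Sum>i=1..n. w (obs \<omega> i))}
    = emeasure ?P {\<omega>\<in>space ?P. 1 \<le> ennreal (exp (- b)) * ennreal (exp (\<Sum>i=1..n. w (obs \<omega> i)))}"
    by (intro arg_cong2[where f = emeasure] refl Collect_cong conj_cong)
       (simp add: ennreal_mult''[symmetric] exp_add[symmetric] ennreal_ge_1)
  also have "\<dots> \<le> ennreal (exp (- b)) * (\<integral>\<^sup>+\<omega>. ennreal (exp (\<Sum>i=1..n. w (obs \<omega> i))) * indicator (space ?P) \<omega> \<partial>?P)"
    by (rule nn_integral_Markov_inequality) auto
  also have "(\<integral>\<^sup>+\<omega>. ennreal (exp (\<Sum>i=1..n. w (obs \<omega> i))) * indicator (space ?P) \<omega> \<partial>?P)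
    = (\<integral>\<^sup>+\<omega>. (\<Prod>i=1..n. ennreal (exp (w (obs \<omega> i)))) \<partial>?P)"
    by (intro nn_integral_cong) (simp add: exp_sum prod_ennreal)
  also have "\<dots> = (\<integral>\<^sup>+x. ennreal (exp (w x)) * ennreal (gauss_mix (sigma_star c) H x) \<partial>lborel) ^ n"
    by (rule nn_integral_model_prod[OF H]) measurable
  finally show "emeasure ?P {\<omega>\<in>space ?P. b \<le> (\<Sum>i=1..n. w (obs \<omega> i))}
      \<le> ennreal (exp (- b)) * (\<integral>\<^sup>+x. ennreal (exp (w x)) * ennreal (gauss_mix (sigma_star c) H x) \<partial>lborel) ^ n" .
qed

text \<open>Turns the moment term of the rate into an integral, also when the moment is infinite.\<close>

lemma epowr_scaled_dist_moment:
  assumes p: "p > 0" and M: "M > 0" and H: "real_distribution H"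
  shows "epowr (2 * dist_moment p S H / ennreal M) p = (\<integral>\<^sup>+\<xi>. ennreal ((2 * infdist \<xi> S / M) powr p) \<partial>H)"
proof -
  interpret real_distribution H by fact
  define I where "I = (\<integral>\<^sup>+\<xi>. ennreal (infdist \<xi> S powr p) \<partial>H)"
  have "(\<integral>\<^sup>+\<xi>. ennreal ((2 * infdist \<xi> S / M) powr p) \<partial>H) = (\<integral>\<^sup>+\<xi>. ennreal ((2 / M) powr p) * ennreal (infdist \<xi> S powr p) \<partial>H)"
    using M by (intro nn_integral_cong) (simp add: powr_mult powr_divide infdist_nonneg flip: ennreal_mult)
  also have "\<dots> = ennreal ((2 / M) powr p) * I" unfolding I_def by (rule nn_integral_cmult) measurable
  finally have R: "(\<integral>\<^sup>+\<xi>. ennreal ((2 * infdist \<xi> S / M) powr p) \<partial>H) = ennreal ((2 / M) powr p) * I" .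
  show ?thesis
  proof (cases "I = \<infinity>")
    case True
    have a: "dist_moment p S H = \<infinity>" using True by (simp add: dist_moment_def epowr_def I_def)
    have "2 * dist_moment p S H / ennreal M = \<infinity>"
      unfolding a by (simp add: ennreal_mult_top ennreal_top_divide)
    then show ?thesis unfolding R using M True by (simp add: epowr_def ennreal_mult_top)
  next
    case False
    then obtain r where r: "I = ennreal r" "r \<ge> 0" by (cases I) auto
    have "dist_moment p S H = ennreal (r powr (1 / p))"
      using r by (simp add: dist_moment_def epowr_def I_def[symmetric])
    then have "2 * dist_moment p S H / ennreal M = ennreal (2 * r powr (1 / p) / M)"
      using M ennreal_mult''[of "r powr (1 / p)" 2] divide_ennreal[of "2 * r powr (1 / p)" M] by simp
    then have "epowr (2 * dist_moment p S H / ennreal M) p = ennreal ((2 * r powr (1 / p) / M) powr p)"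
      using M by (simp add: epowr_def)
    also have "(2 * r powr (1 / p) / M) powr p = (2 / M) powr p * r"
    proof -
      have "(r powr (1 / p)) powr p = r" using r p by (simp add: powr_powr)
      then show ?thesis using M by (simp add: powr_mult powr_divide)
    qed
    finally show ?thesis unfolding R r(1) using r(2) by (simp add: ennreal_mult'')
  qed
qed

text \<open>The tilted kernel is \<open>\<surd>5\<close> times the Gaussian density with standard deviation \<open>\<surd>5 s\<close>.\<close>

lemma nn_integral_gauss_exp_square:
  assumes s: "s > 0"
  shows "(\<integral>\<^sup>+x. ennreal (exp (2 / 5 * (x - \<xi>)\<^sup>2 / s\<^sup>2)) * ennreal (normal_density 0 s (x - \<xi>)) \<partial>lborel) = ennreal (sqrt 5)"
proof -
  have s5: "sqrt 5 * s > 0" using s by simp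
  have "exp (2 / 5 * (x - \<xi>)\<^sup>2 / s\<^sup>2) * normal_density 0 s (x - \<xi>) = sqrt 5 * normal_density \<xi> (sqrt 5 * s) x" for x
  proof -
    have "exp (2 / 5 * (x - \<xi>)\<^sup>2 / s\<^sup>2) * exp (- (x - \<xi>)\<^sup>2 / (2 * s\<^sup>2)) = exp (- (x - \<xi>)\<^sup>2 / (2 * (sqrt 5 * s)\<^sup>2))"
      using s by (simp add: power_mult_distrib field_simps flip: exp_add)
    moreover have "sqrt (2 * pi * (sqrt 5 * s)\<^sup>2) = sqrt 5 * sqrt (2 * pi * s\<^sup>2)"
    proof -
      have "2 * pi * (sqrt 5 * s)\<^sup>2 = 5 * (2 * pi * s\<^sup>2)" by (simp add: power_mult_distrib)
      then show ?thesis by (simp only: real_sqrt_mult[of 5 "2 * pi * s\<^sup>2"])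
    qed
    ultimately show ?thesis using s by (simp add: normal_density_def)
  qed
  then have "(\<integral>\<^sup>+x. ennreal (exp (2 / 5 * (x - \<xi>)\<^sup>2 / s\<^sup>2)) * ennreal (normal_density 0 s (x - \<xi>)) \<partial>lborel)
    = (\<integral>\<^sup>+x. ennreal (sqrt 5) * ennreal (normal_density \<xi> (sqrt 5 * s) x) \<partial>lborel)"
    by (intro nn_integral_cong) (simp flip: ennreal_mult)
  also have "\<dots> = ennreal (sqrt 5)"
    using prob_space.emeasure_space_1[OF prob_space_normal_density[OF s5, of \<xi>]]
    by (subst nn_integral_cmult) (auto simp: emeasure_density)
  finally show ?thesis .
qed

lemma le_two_powr:
  fixes x :: real
  assumes "x \<ge> 1"
  shows "x \<le> 2 powr x"
proof -
  have "x = 1 + (x - 1)" by simp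
  also have "\<dots> \<le> 2 * (1 + (x - 1) * ln 2)" using assms ln2_ge_two_thirds
    mult_left_mono[of "2/3" "ln 2" "x - 1"] by (simp add: distrib_left)
  also have "\<dots> \<le> 2 * exp ((x - 1) * ln 2)" by (intro mult_left_mono exp_ge_add_one_self) auto
  also have "\<dots> = 2 powr x" by (simp add: powr_def exp_diff left_diff_distrib)
  finally show ?thesis .
qed

text \<open>An observation \<open>x\<close> at distance more than \<open>M\<close> from \<open>S\<close> with mean \<open>\<xi>\<close> has \<open>\<xi>\<close> at distance more than
  \<open>M / 2\<close>, or noise larger than \<open>M / 2\<close>.  In the first case raising the exponent from \<open>1 / ln n\<close> to \<open>p\<close> only
  increases the power.  In the second the power is at most \<open>y\<^sup>2\<close> with \<open>y = 2 \<bar>x - \<xi>\<bar> / M > 1\<close>, and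
  \<open>y\<^sup>2 \<le> 2 powr y\<^sup>2 \<le> 2 / n * n powr y\<^sup>2\<close>; the lower bound on \<open>M\<close> turns \<open>y\<^sup>2 ln n\<close> into at most \<open>2/5\<close> times
  the squared standardised noise, whose exponential is integrable.\<close>

lemma tail_pointwise:
  fixes S :: "real set" and n :: nat
  assumes n: "n \<ge> 2" and s: "s > 0" and M: "M \<ge> sqrt (10 * s\<^sup>2 * ln (real n))"
    and p: "p \<ge> 1 / ln (real n)" and x: "infdist x S > M"
  shows "(infdist x S / M) powr (1 / ln (real n))
    \<le> (2 * infdist \<xi> S / M) powr p + 2 / real n * exp (2 / 5 * (x - \<xi>)\<^sup>2 / s\<^sup>2)"
proof -
  define l where "l = ln (real n)"
  have l: "l \<ge> ln 2" "l > 0" using n by (auto simp: l_def)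
  have M2: "M\<^sup>2 \<ge> 10 * s\<^sup>2 * l" using M l(2) by (simp add: l_def sqrt_le_D)
  have "sqrt (10 * s\<^sup>2 * ln (real n)) > 0" using l s by (simp add: l_def)
  then have M0: "M > 0" using M by linarith
  have tri: "infdist x S \<le> infdist \<xi> S + \<bar>x - \<xi>\<bar>" using infdist_triangle[of x S \<xi>] by (simp add: dist_real_def)
  show ?thesis
  proof (cases "\<bar>x - \<xi>\<bar> \<le> infdist \<xi> S")
    case True
    define y where "y = 2 * infdist \<xi> S / M"
    have y: "infdist x S / M \<le> y" using True tri M0 by (simp add: y_def divide_right_mono)
    moreover have "infdist x S / M > 1" using x M0 by simp
    ultimately have "(infdist x S / M) powr (1 / l) \<le> y powr (1 / l)" using l by (intro powr_mono2) auto
    also have "\<dots> \<le> y powr p" using y \<open>infdist x S / M > 1\<close> p by (intro powr_mono) (auto simp: l_def)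
    also have "\<dots> \<le> y powr p + 2 / real n * exp (2 / 5 * (x - \<xi>)\<^sup>2 / s\<^sup>2)" by simp
    finally show ?thesis by (simp add: y_def l_def)
  next
    case False
    define y where "y = 2 * \<bar>x - \<xi>\<bar> / M"
    have y: "infdist x S / M \<le> y" using False tri M0 by (simp add: y_def divide_right_mono)
    moreover have x1: "infdist x S / M > 1" using x M0 by simp
    ultimately have y1: "y > 1" by linarith
    have "1 / l \<le> 2" using l ln2_ge_two_thirds by (simp add: divide_le_eq)
    have "(infdist x S / M) powr (1 / l) \<le> y powr (1 / l)" using y x1 l by (intro powr_mono2) auto
    also have "\<dots> \<le> y powr 2" using y1 \<open>1 / l \<le> 2\<close> by (intro powr_mono) auto
    also have "\<dots> = y\<^sup>2" using y1 by (simp add: powr_numeral)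
    also have "\<dots> \<le> 2 powr (y\<^sup>2)" using y1 by (intro le_two_powr) (simp add: one_le_power)
    also have "\<dots> = 2 * 2 powr (y\<^sup>2 - 1)" by (simp add: powr_diff)
    also have "\<dots> \<le> 2 * real n powr (y\<^sup>2 - 1)"
      using n y1 by (intro mult_left_mono powr_mono2) (auto simp: one_le_power)
    also have "\<dots> = 2 / real n * exp (y\<^sup>2 * l)" using n by (simp add: powr_def l_def left_diff_distrib exp_diff)
    also have "\<dots> \<le> 2 / real n * exp (2 / 5 * (x - \<xi>)\<^sup>2 / s\<^sup>2)"
    proof -
      have "y\<^sup>2 * l = (x - \<xi>)\<^sup>2 * (4 * l / M\<^sup>2)" by (simp add: y_def power_divide power_mult_distrib)
      also have "\<dots> \<le> (x - \<xi>)\<^sup>2 * (2 / 5 / s\<^sup>2)"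
        using M2 M0 s by (intro mult_left_mono) (auto simp: field_simps)
      finally show ?thesis by (intro mult_left_mono) (auto simp: field_simps)
    qed
    also have "\<dots> \<le> (2 * infdist \<xi> S / M) powr p + 2 / real n * exp (2 / 5 * (x - \<xi>)\<^sup>2 / s\<^sup>2)" by simp
    finally show ?thesis by (simp add: l_def)
  qed
qed

text \<open>The power \<open>1 / ln n\<close> is the smallest one admitted in the infimum of the rate, so a bound for it follows
  from the moment of every admitted order.\<close>

definition tail_factor :: "nat \<Rightarrow> real set \<Rightarrow> real \<Rightarrow> real \<Rightarrow> real" where
  "tail_factor n S M x = (if infdist x S \<le> M then 0 else (infdist x S / M) powr (1 / ln (real n)))"

lemma measurable_tail_factor [measurable]: "tail_factor n S M \<in> borel_measurable borel"
  unfolding tail_factor_def[abs_def] by measurable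

lemma tail_integral:
  fixes S :: "real set" and n :: nat
  assumes n: "n \<ge> 2" and s: "s > 0" and M: "M \<ge> sqrt (10 * s\<^sup>2 * ln (real n))" and H: "real_distribution H"
  shows "(\<integral>\<^sup>+x. ennreal (tail_factor n S M x) * ennreal (gauss_mix s H x) \<partial>lborel)
    \<le> (INF p\<in>{1 / ln (real n)..}. epowr (2 * dist_moment p S H / ennreal M) p) + ennreal (2 * sqrt 5 / real n)"
proof -
  interpret real_distribution H by fact
  have ln: "ln (real n) > 0" using n by simp
  have "sqrt (10 * s\<^sup>2 * ln (real n)) > 0" using ln s by simp
  then have M0: "M > 0" using M by linarith
  have bound: "(\<integral>\<^sup>+x. ennreal (tail_factor n S M x) * ennreal (gauss_mix s H x) \<partial>lborel)
    \<le> epowr (2 * dist_moment p S H / ennreal M) p + ennreal (2 * sqrt 5 / real n)"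
    if p: "p \<ge> 1 / ln (real n)" for p
  proof -
    have p0: "p > 0" using p ln by (smt (verit) zero_less_divide_iff)
    have inner: "(\<integral>\<^sup>+x. ennreal (tail_factor n S M x) * ennreal (normal_density 0 s (x - \<xi>)) \<partial>lborel)
      \<le> ennreal ((2 * infdist \<xi> S / M) powr p) + ennreal (2 * sqrt 5 / real n)" for \<xi>
    proof -
      have [measurable]: "(\<lambda>x. normal_density 0 s (x - \<xi>)) \<in> borel_measurable borel"
        unfolding normal_density_def by measurable
      have "(\<integral>\<^sup>+x. ennreal (tail_factor n S M x) * ennreal (normal_density 0 s (x - \<xi>)) \<partial>lborel)
        \<le> (\<integral>\<^sup>+x. ennreal ((2 * infdist \<xi> S / M) powr p) * ennreal (normal_density 0 s (x - \<xi>))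
           + ennreal (2 / real n) * (ennreal (exp (2 / 5 * (x - \<xi>)\<^sup>2 / s\<^sup>2)) * ennreal (normal_density 0 s (x - \<xi>))) \<partial>lborel)"
      proof (intro nn_integral_mono)
        fix x
        have "tail_factor n S M x \<le> (2 * infdist \<xi> S / M) powr p + 2 / real n * exp (2 / 5 * (x - \<xi>)\<^sup>2 / s\<^sup>2)"
          using tail_pointwise[OF n s M p, of x S \<xi>] by (auto simp: tail_factor_def)
        then have "ennreal (tail_factor n S M x)
          \<le> ennreal ((2 * infdist \<xi> S / M) powr p) + ennreal (2 / real n) * ennreal (exp (2 / 5 * (x - \<xi>)\<^sup>2 / s\<^sup>2))"
          by (simp flip: ennreal_mult ennreal_plus)
        from mult_right_mono[OF this, of "ennreal (normal_density 0 s (x - \<xi>))"]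
        show "ennreal (tail_factor n S M x) * ennreal (normal_density 0 s (x - \<xi>))
          \<le> ennreal ((2 * infdist \<xi> S / M) powr p) * ennreal (normal_density 0 s (x - \<xi>))
           + ennreal (2 / real n) * (ennreal (exp (2 / 5 * (x - \<xi>)\<^sup>2 / s\<^sup>2)) * ennreal (normal_density 0 s (x - \<xi>)))"
          by (simp add: distrib_right mult.assoc)
      qed
      also have "\<dots> = ennreal ((2 * infdist \<xi> S / M) powr p) + ennreal (2 / real n) * ennreal (sqrt 5)"
        by (simp add: nn_integral_add nn_integral_cmult nn_integral_normal_density_diff[OF s] nn_integral_gauss_exp_square[OF s] del: times_divide_eq_left)
      also have "ennreal (2 / real n) * ennreal (sqrt 5) = ennreal (2 * sqrt 5 / real n)"
        by (simp flip: ennreal_mult)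
      finally show ?thesis .
    qed
    have "(\<integral>\<^sup>+x. ennreal (tail_factor n S M x) * ennreal (gauss_mix s H x) \<partial>lborel)
      \<le> (\<integral>\<^sup>+\<xi>. ennreal ((2 * infdist \<xi> S / M) powr p) + ennreal (2 * sqrt 5 / real n) \<partial>H)"
      by (subst nn_integral_gauss_mix[OF s]) (auto intro!: nn_integral_mono inner)
    also have "\<dots> = epowr (2 * dist_moment p S H / ennreal M) p + ennreal (2 * sqrt 5 / real n)"
      unfolding epowr_scaled_dist_moment[OF p0 M0 H]
      using emeasure_space_1 by (subst nn_integral_add) auto
    finally show ?thesis .
  qed
  have "(\<integral>\<^sup>+x. ennreal (tail_factor n S M x) * ennreal (gauss_mix s H x) \<partial>lborel) - ennreal (2 * sqrt 5 / real n)
    \<le> (INF p\<in>{1 / ln (real n)..}. epowr (2 * dist_moment p S H / ennreal M) p)"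
  proof (rule INF_greatest)
    fix p assume "p \<in> {1 / ln (real n)..}"
    then show "(\<integral>\<^sup>+x. ennreal (tail_factor n S M x) * ennreal (gauss_mix s H x) \<partial>lborel) - ennreal (2 * sqrt 5 / real n)
      \<le> epowr (2 * dist_moment p S H / ennreal M) p"
      using bound[of p] by (simp add: ennreal_minus_le_iff add.commute)
  qed
  then show ?thesis by (simp add: ennreal_minus_le_iff add.commute)
qed

section \<open>A net for the likelihood\<close>

text \<open>The exponential is the square root of the likelihood ratio, and its expectation is the integral
  of \<open>\<surd>((k + v) f) \<le> \<surd>(k f) + \<surd>(v f)\<close>.  The first term gives the affinity; the second is split by the
  inequality of arithmetic and geometric means with a free weight \<open>a\<close>.\<close>

lemma likelihood_ratio_moment:
  assumes K: "real_distribution K" and H: "real_distribution H" and s: "s > 0"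
    and v[measurable]: "v \<in> borel_measurable borel" and v0: "\<And>x. v x \<ge> 0"
    and I: "(\<integral>\<^sup>+x. ennreal (v x) \<partial>lborel) \<le> ennreal I" "I \<ge> 0" and a: "a > 0"
  shows "(\<integral>\<^sup>+x. ennreal (exp ((ln (gauss_mix s K x + v x) - ln (gauss_mix s H x)) / 2)) * ennreal (gauss_mix s H x) \<partial>lborel)
    \<le> ennreal (affinity s K H + (a * I + 1 / a) / 2)"
proof -
  interpret K: real_distribution K by fact
  interpret H: real_distribution H by fact
  let ?k = "gauss_mix s K" and ?f = "gauss_mix s H"
  have pt: "exp ((ln (?k x + v x) - ln (?f x)) / 2) * ?f x \<le> sqrt (?k x * ?f x) + a / 2 * v x + 1 / (2 * a) * ?f x" for x
  proof -
    have pos: "?k x > 0" "?f x > 0" using K.gauss_mix_pos[OF s] H.gauss_mix_pos[OF s] by auto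
    have pos': "?k x + v x > 0" using pos v0[of x] by linarith
    define e where "e = exp ((ln (?k x + v x) - ln (?f x)) / 2)"
    have "e\<^sup>2 = exp (ln (?k x + v x) - ln (?f x))" by (simp add: e_def power2_eq_square flip: exp_add)
    also have "\<dots> = (?k x + v x) / ?f x" using pos pos' by (simp add: exp_diff)
    finally have e2: "e\<^sup>2 = (?k x + v x) / ?f x" .
    have "(e * ?f x)\<^sup>2 = (?k x + v x) / ?f x * (?f x)\<^sup>2" unfolding power_mult_distrib e2 ..
    then have "(e * ?f x)\<^sup>2 = (?k x + v x) * ?f x" using pos by (simp add: power2_eq_square)
    then have "e * ?f x = sqrt ((?k x + v x) * ?f x)"
      using pos by (intro real_sqrt_unique[symmetric]) (auto simp: e_def)
    also have "\<dots> = sqrt (?k x * ?f x + v x * ?f x)" by (simp add: distrib_right)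
    also have "\<dots> \<le> sqrt (?k x * ?f x) + sqrt (v x * ?f x)"
      using pos v0[of x] by (intro sqrt_add_le_add_sqrt) auto
    also have "sqrt (v x * ?f x) = sqrt ((a * v x) * (?f x / a))" using a by simp
    also have "\<dots> \<le> (a * v x + ?f x / a) / 2"
      using a pos v0[of x] by (intro sqrt_mult_le_half_sum) auto
    finally show ?thesis by (simp add: e_def field_simps)
  qed
  have aff: "(\<integral>\<^sup>+x. ennreal (sqrt (?k x * ?f x)) \<partial>lborel) = ennreal (affinity s K H)"
    unfolding affinity_def using K.gauss_mix_pos[OF s] H.gauss_mix_pos[OF s]
    by (intro nn_integral_eq_integral integrable_affinity[OF K H s]) (auto simp: less_imp_le)
  have "(\<integral>\<^sup>+x. ennreal (exp ((ln (?k x + v x) - ln (?f x)) / 2)) * ennreal (?f x) \<partial>lborel)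
    \<le> (\<integral>\<^sup>+x. ennreal (sqrt (?k x * ?f x)) + ennreal (a / 2) * ennreal (v x) + ennreal (1 / (2 * a)) * ennreal (?f x) \<partial>lborel)"
  proof (intro nn_integral_mono)
    fix x
    have pos: "?k x > 0" "?f x > 0" using K.gauss_mix_pos[OF s] H.gauss_mix_pos[OF s] by auto
    have "ennreal (exp ((ln (?k x + v x) - ln (?f x)) / 2)) * ennreal (?f x)
        = ennreal (exp ((ln (?k x + v x) - ln (?f x)) / 2) * ?f x)"
      using pos by (intro ennreal_mult[symmetric]) auto
    also have "\<dots> \<le> ennreal (sqrt (?k x * ?f x) + a / 2 * v x + 1 / (2 * a) * ?f x)"
      by (intro ennreal_leI pt)
    also have "\<dots> = ennreal (sqrt (?k x * ?f x)) + ennreal (a / 2) * ennreal (v x) + ennreal (1 / (2 * a)) * ennreal (?f x)"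
      using a pos v0[of x] by (simp add: ennreal_plus ennreal_mult del: times_divide_eq_left)
    finally show "ennreal (exp ((ln (?k x + v x) - ln (?f x)) / 2)) * ennreal (?f x)
      \<le> ennreal (sqrt (?k x * ?f x)) + ennreal (a / 2) * ennreal (v x) + ennreal (1 / (2 * a)) * ennreal (?f x)" .
  qed
  also have "\<dots> = ennreal (affinity s K H) + ennreal (a / 2) * (\<integral>\<^sup>+x. ennreal (v x) \<partial>lborel) + ennreal (1 / (2 * a))"
    by (simp add: nn_integral_add nn_integral_cmult aff H.nn_integral_gauss_mix_eq_1[OF s])
  also have "\<dots> \<le> ennreal (affinity s K H) + ennreal (a / 2) * ennreal I + ennreal (1 / (2 * a))"
    using I by (intro add_mono mult_left_mono order_refl) auto
  also have "\<dots> = ennreal (affinity s K H + a / 2 * I + 1 / (2 * a))"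
    using a I affinity_nonneg[OF K H s] by (simp add: ennreal_plus ennreal_mult del: times_divide_eq_left)
  also have "affinity s K H + a / 2 * I + 1 / (2 * a) = affinity s K H + (a * I + 1 / a) / 2"
    using a by (simp add: field_simps)
  finally show ?thesis .
qed

text \<open>The logarithm of the ratio of the peak of the kernel to the correction
  \<open>peak / n\<^sup>2 * envelope S M x\<close> outside the \<open>M\<close>-neighbourhood: there a likelihood is bounded only by the
  peak.\<close>

definition log_excess :: "nat \<Rightarrow> real set \<Rightarrow> real \<Rightarrow> real \<Rightarrow> real" where
  "log_excess n S M x = (if infdist x S \<le> M then 0 else 2 * ln (real n) + 2 * ln (infdist x S / M))"

lemma measurable_log_excess [measurable]: "log_excess n S M \<in> borel_measurable borel"
  unfolding log_excess_def[abs_def] by measurable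

text \<open>The exponent \<open>1 / (2 ln n)\<close> is chosen so that the factor \<open>n\<^sup>2\<close> contributes just \<open>exp 1\<close>.\<close>

lemma exp_log_excess:
  assumes n: "n \<ge> 2" and M: "M > 0"
  shows "exp (log_excess n S M x / (2 * ln (real n))) \<le> 1 + exp 1 * tail_factor n S M x"
proof (cases "infdist x S \<le> M")
  case False
  have l: "ln (real n) > 0" using n by simp
  have d: "infdist x S / M > 0" using False M by (simp add: divide_pos_pos)
  have "log_excess n S M x / (2 * ln (real n)) = 1 + (1 / ln (real n)) * ln (infdist x S / M)"
    using False l by (simp add: log_excess_def add_divide_distrib)
  then have "exp (log_excess n S M x / (2 * ln (real n))) = exp 1 * tail_factor n S M x"
    using False d by (simp only: exp_add) (auto simp: tail_factor_def powr_def)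
  then show ?thesis by simp
qed (simp add: log_excess_def tail_factor_def)

lemma tail_likelihood_moment:
  assumes n: "n \<ge> 2" and M: "M > 0" and s: "s > 0" and H: "real_distribution H"
    and T: "(\<integral>\<^sup>+x. ennreal (tail_factor n S M x) * ennreal (gauss_mix s H x) \<partial>lborel) \<le> ennreal T" "T \<ge> 0"
  shows "(\<integral>\<^sup>+x. ennreal (exp (log_excess n S M x / (2 * ln (real n)))) * ennreal (gauss_mix s H x) \<partial>lborel)
    \<le> ennreal (1 + exp 1 * T)"
proof -
  interpret H: real_distribution H by fact
  have tf: "tail_factor n S M x \<ge> 0" for x by (simp add: tail_factor_def)
  have "(\<integral>\<^sup>+x. ennreal (exp (log_excess n S M x / (2 * ln (real n)))) * ennreal (gauss_mix s H x) \<partial>lborel)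
    \<le> (\<integral>\<^sup>+x. ennreal (gauss_mix s H x) + ennreal (exp 1) * (ennreal (tail_factor n S M x) * ennreal (gauss_mix s H x)) \<partial>lborel)"
  proof (intro nn_integral_mono)
    fix x
    have "ennreal (exp (log_excess n S M x / (2 * ln (real n)))) \<le> 1 + ennreal (exp 1) * ennreal (tail_factor n S M x)"
      using ennreal_leI[OF exp_log_excess[OF n M, of S x]] tf[of x] by (simp add: ennreal_plus ennreal_mult)
    from mult_right_mono[OF this, of "ennreal (gauss_mix s H x)"]
    show "ennreal (exp (log_excess n S M x / (2 * ln (real n)))) * ennreal (gauss_mix s H x)
      \<le> ennreal (gauss_mix s H x) + ennreal (exp 1) * (ennreal (tail_factor n S M x) * ennreal (gauss_mix s H x))"
      by (simp add: distrib_right mult.assoc)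
  qed
  also have "\<dots> = 1 + ennreal (exp 1) * (\<integral>\<^sup>+x. ennreal (tail_factor n S M x) * ennreal (gauss_mix s H x) \<partial>lborel)"
    by (simp add: nn_integral_add nn_integral_cmult H.nn_integral_gauss_mix_eq_1[OF s])
  also have "\<dots> \<le> 1 + ennreal (exp 1) * ennreal T" using T(1) by (intro add_mono mult_left_mono) auto
  also have "\<dots> = ennreal (1 + exp 1 * T)" using T(2) by (simp add: ennreal_plus ennreal_mult)
  finally show ?thesis .
qed

text \<open>The form in which the net is used: a mixture is at most the corrected member of the net, times
  a factor that exceeds 1 only outside the \<open>M\<close>-neighbourhood of \<open>S\<close>.\<close>

lemma gauss_mix_dominated:
  assumes K: "real_distribution K" "real_distribution K'" and s: "s > 0" and n: "n \<ge> 2" and M: "M > 0"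
    and near: "infdist x S \<le> M \<Longrightarrow> gauss_mix s K x \<le> gauss_mix s K' x + normal_density 0 s 0 / (real n)\<^sup>2"
  shows "ln (gauss_mix s K x)
    \<le> ln (gauss_mix s K' x + normal_density 0 s 0 / (real n)\<^sup>2 * envelope S M x) + log_excess n S M x"
proof -
  interpret K: real_distribution K by fact
  interpret K': real_distribution K' by fact
  define p where "p = normal_density 0 s 0"
  have p: "p \<ge> 0" by (simp add: p_def)
  define q where "q = gauss_mix s K' x + p / (real n)\<^sup>2 * envelope S M x"
  have k: "gauss_mix s K x > 0" "gauss_mix s K x \<le> p" using K.gauss_mix_pos[OF s] K.gauss_mix_le_peak[OF s] by (auto simp: p_def)
  have q: "q > 0" using K'.gauss_mix_pos[OF s, of x] p envelope_pos[of S M x] by (auto simp: q_def intro!: add_pos_nonneg)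
  have "gauss_mix s K x \<le> q * exp (log_excess n S M x)"
  proof (cases "infdist x S \<le> M")
    case True
    then have "infdist x S / M \<le> 1" using M by simp
    then have "envelope S M x = 1" by (simp add: envelope_def max_def)
    then show ?thesis using near True by (simp add: q_def p_def log_excess_def)
  next
    case False
    define d where "d = infdist x S / M"
    have d: "d > 1" using False M by (simp add: d_def)
    have env: "envelope S M x = 1 / d\<^sup>2" using d by (simp add: envelope_def d_def[symmetric] max_def)
    have "exp (log_excess n S M x) = (exp (ln (real n)) * exp (ln d))\<^sup>2"
      using False by (simp add: log_excess_def d_def[symmetric] power2_eq_square flip: exp_add)
    also have "\<dots> = (real n)\<^sup>2 * d\<^sup>2" using n d by (simp add: power_mult_distrib)
    finally have ex: "exp (log_excess n S M x) = (real n)\<^sup>2 * d\<^sup>2" .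
    have "p = (p / (real n)\<^sup>2 * envelope S M x) * exp (log_excess n S M x)"
      unfolding env ex using n d by (simp add: field_simps)
    also have "\<dots> \<le> q * exp (log_excess n S M x)"
      unfolding q_def using K'.gauss_mix_pos[OF s, of x] by (intro mult_right_mono) auto
    finally show ?thesis using k by linarith
  qed
  then have "ln (gauss_mix s K x) \<le> ln (q * exp (log_excess n S M x))" using k by (intro ln_mono) auto
  also have "\<dots> = ln q + log_excess n S M x" using q by (simp add: ln_mult)
  finally show ?thesis by (simp add: q_def p_def)
qed

text \<open>The entropy bound with all parameters tied to \<open>n\<close>: pieces of half-length \<open>L = s \<surd>(ln n)\<close> and
  about \<open>11 ln n\<close> coefficients per piece.  With this \<open>L\<close> the coefficient bound \<open>exp (2 L\<^sup>2 / s\<^sup>2)\<close> is \<open>n\<^sup>2\<close>, so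
  \<open>O (ln n)\<close> coefficients reach accuracy \<open>1 / n\<^sup>2\<close>, and each coefficient takes polynomially many values,
  costing \<open>O (ln n)\<close>.  There are \<open>O (V M / \<surd>(ln n))\<close> pieces, hence the total log-cardinality is of order
  \<open>V M (ln n) powr (3/2)\<close>.  Longer pieces would need more coefficients than their smaller number saves, and
  shorter ones would multiply the number of pieces by more than they save in coefficients.\<close>

lemma likelihood_net:
  fixes S :: "real set" and n :: nat and J :: "int set" and \<H> :: "real measure set"
  assumes n: "n \<ge> 2" and s: "s \<ge> 1" and M: "M \<ge> 3 * s * sqrt (ln (real n))" and S: "closed S" "S \<noteq> {}"
    and J: "finite J" "real (card J) * s \<le> V"
    and cover: "\<And>z. z \<in> S \<Longrightarrow> \<exists>j\<in>J. s * of_int j \<le> z \<and> z \<le> s * of_int j + s"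
    and \<H>: "\<And>H. H \<in> \<H> \<Longrightarrow> real_distribution H"
  obtains \<N> where "finite \<N>" "\<N> \<subseteq> \<H>" "real (card \<N>) \<le> exp (312 * (V * M * (ln (real n) * sqrt (ln (real n)))))"
    "\<And>H. H \<in> \<H> \<Longrightarrow> \<exists>H'\<in>\<N>. \<forall>x. infdist x S \<le> M \<longrightarrow>
       gauss_mix s H x \<le> gauss_mix s H' x + normal_density 0 s 0 / (real n)\<^sup>2"
proof -
  define l where "l = ln (real n)"
  have l2: "l \<ge> ln 2" using n by (simp add: l_def)
  then have l: "l \<ge> ln 2" "l \<ge> 2/3" "l > 0" using ln2_ge_two_thirds by linarith+
  have exp_l: "exp l = real n" using n by (simp add: l_def)
  have sl: "sqrt l \<ge> 2/3" using l(2) by (intro real_le_rsqrt) (auto simp: power2_eq_square)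
  define L where "L = s * sqrt l"
  have L: "L > 0" unfolding L_def using s sl by (intro mult_pos_pos) linarith+
  have M3L: "M \<ge> 3 * L" using M by (simp add: L_def l_def)
  have Ms: "M \<ge> s"
  proof -
    have "s * 1 \<le> s * (3 * sqrt l)" using s sl by (intro mult_left_mono) auto
    then show ?thesis using M3L by (simp add: L_def)
  qed
  have s0: "s > 0" using s by simp
  have M0: "M > 0" using Ms s0 by linarith
  have E: "exp (2 * L\<^sup>2 / s\<^sup>2) = (real n)\<^sup>2"
  proof -
    have "2 * L\<^sup>2 / s\<^sup>2 = l + l" using s0 l by (simp add: L_def power_mult_distrib)
    then show ?thesis by (simp only: exp_add exp_l power2_eq_square)
  qed
  obtain X0 where X0: "finite X0" "real (card X0) \<le> real (card J) * ((2 * M + s) / (2 * L) + 1)"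
    "\<And>x. infdist x S \<le> M \<Longrightarrow> \<exists>z\<in>X0. \<bar>x - z\<bar> \<le> L"
    using interval_cover[OF J(1) S s0 L less_imp_le[OF M0] cover] by blast
  define K0 where "K0 = nat \<lceil>11 * l\<rceil>"
  have K0: "real K0 \<ge> 11 * l" "real K0 \<le> 13 * l" "K0 \<ge> 1" using l by (auto simp: K0_def; linarith)+
  define m where "m = 2 * K0 * n ^ 4"
  \<comment> \<open>rounding and truncation each take half of the admissible error \<open>1 / n\<^sup>2\<close>\<close>
  define \<gamma> where "\<gamma> = 1 / (2 * real K0 * (real n)\<^sup>2)"
  have \<gamma>: "\<gamma> > 0" using n K0 by (simp add: \<gamma>_def)
  have m: "exp (2 * L\<^sup>2 / s\<^sup>2) \<le> real m * \<gamma>"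
    unfolding E using n K0 by (simp add: m_def \<gamma>_def power2_eq_square power4_eq_xxxx)
  have err: "real K0 * \<gamma> + 4 * exp (2 * L\<^sup>2 / s\<^sup>2) / 2 ^ K0 \<le> 1 / (real n)\<^sup>2"
  proof -
    \<comment> \<open>the truncation error is \<open>4 n\<^sup>2 / 2 ^ K0\<close>\<close>
    have "8 * real n ^ 4 \<le> 2 ^ K0"
    proof -
      have "8 * real n ^ 4 = exp (3 * ln 2 + 4 * l)"
      proof -
        have "exp (3 * ln 2 + 4 * l) = exp (ln 2) ^ 3 * exp l ^ 4" by (simp only: exp_add exp_of_nat_mult[symmetric]) simp
        then show ?thesis by (simp add: exp_l)
      qed
      also have "\<dots> \<le> exp (real K0 * ln 2)"
      proof -
        have "3 * ln 2 + 4 * l \<le> 7 * l" using l by simp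
        also have "\<dots> \<le> (11 * l) * (2 / 3)" using l by simp
        also have "\<dots> \<le> real K0 * ln 2" using K0 l ln2_ge_two_thirds by (intro mult_mono) auto
        finally show ?thesis by simp
      qed
      also have "\<dots> = 2 ^ K0" by (simp add: exp_of_nat_mult)
      finally show ?thesis .
    qed
    then have "4 * (real n)\<^sup>2 / 2 ^ K0 \<le> 4 * (real n)\<^sup>2 / (8 * real n ^ 4)"
      using n by (intro divide_left_mono) auto
    also have "\<dots> = 1 / (2 * (real n)\<^sup>2)" using n by (simp add: power2_eq_square power4_eq_xxxx)
    finally have "4 * (real n)\<^sup>2 / 2 ^ K0 \<le> 1 / (2 * (real n)\<^sup>2)" .
    moreover have "real K0 * \<gamma> = 1 / (2 * (real n)\<^sup>2)" using K0 by (simp add: \<gamma>_def)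
    ultimately show ?thesis unfolding E by (simp add: field_simps)
  qed
  have m12: "real (2 * m + 1) \<le> real n ^ 12"
  proof -
    have n1: "real n \<ge> 1" using n by simp
    have "real K0 \<le> 13 * real n" using K0(2) ln_le_minus_one[of "real n"] n by (simp add: l_def)
    then have "4 * real K0 * real n ^ 4 + 1 \<le> 4 * (13 * real n) * real n ^ 4 + 1" by (intro add_mono mult_mono) auto
    also have "4 * (13 * real n) * real n ^ 4 = 52 * real n ^ 5" by (simp add: eval_nat_numeral)
    also have "52 * real n ^ 5 + 1 \<le> 52 * real n ^ 5 + real n ^ 5" using n1 by (simp add: one_le_power)
    also have "\<dots> \<le> 2 ^ 7 * real n ^ 5" using n1 by simp
    also have "\<dots> \<le> real n ^ 7 * real n ^ 5" using n by (intro mult_right_mono power_mono) auto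
    also have "\<dots> = real n ^ 12" by (simp flip: power_add)
    finally show ?thesis by (simp add: m_def)
  qed
  obtain \<N> where N: "finite \<N>" "\<N> \<subseteq> \<H>" "card \<N> \<le> (2 * m + 1) ^ (card X0 * K0)"
    "\<And>H. H \<in> \<H> \<Longrightarrow> \<exists>H'\<in>\<N>. \<forall>x. (\<exists>z\<in>X0. \<bar>x - z\<bar> \<le> L) \<longrightarrow>
       gauss_mix s H x \<le> gauss_mix s H' x + normal_density 0 s 0 * (real K0 * \<gamma> + 4 * exp (2 * L\<^sup>2 / s\<^sup>2) / 2 ^ K0)"
    using gauss_mix_entropy[where \<H> = \<H> and K = K0, OF s0 \<H> X0(1) L \<gamma> m] by blast
  have cardN: "real (card \<N>) \<le> exp (312 * (V * M * (l * sqrt l)))"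
  proof -
    have "real (card X0) \<le> 2 * V * M / (s * L)"
    proof -
      have "(2 * M + s) / (2 * L) + 1 = (2 * M + s + 2 * L) / (2 * L)" using L by (simp add: field_simps)
      also have "\<dots> \<le> (4 * M) / (2 * L)" using M3L Ms L M0 by (intro divide_right_mono) auto
      also have "\<dots> = 2 * M / L" by simp
      finally have "real (card J) * ((2 * M + s) / (2 * L) + 1) \<le> real (card J) * (2 * M / L)"
        by (intro mult_left_mono) auto
      with X0(2) have "real (card X0) \<le> real (card J) * (2 * M / L)" by linarith
      also have "\<dots> \<le> (V / s) * (2 * M / L)"
        using J(2) s0 M0 L by (intro mult_right_mono) (auto simp: pos_le_divide_eq)
      finally show ?thesis by (simp add: mult_ac)
    qed
    also have "\<dots> \<le> 2 * V * M / sqrt l"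
    proof -
      have "sqrt l \<le> s * L"
      proof -
        have "1 * sqrt l \<le> (s * s) * sqrt l" using s l mult_mono[of 1 s 1 s] by (intro mult_right_mono) auto
        then show ?thesis by (simp add: L_def mult.assoc)
      qed
      moreover have "V \<ge> 0" using order_trans[OF mult_nonneg_nonneg[OF of_nat_0_le_iff less_imp_le[OF s0]] J(2)] .
      moreover have "sqrt l > 0" "s * L > 0" using l s0 L by simp_all
      ultimately show ?thesis using M0 s0 L by (intro divide_left_mono mult_pos_pos) auto
    qed
    finally have X: "real (card X0) \<le> 2 * V * M / sqrt l" .
    have XK: "real (card X0) * real K0 \<le> (2 * V * M / sqrt l) * (13 * l)"
      using X K0 by (intro mult_mono) auto
    have "real (card \<N>) \<le> real (2 * m + 1) ^ (card X0 * K0)"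
      using N(3) by (metis of_nat_mono of_nat_power)
    also have "\<dots> \<le> (real n ^ 12) ^ (card X0 * K0)" using m12 by (intro power_mono) auto
    also have "\<dots> = exp (12 * l * (real (card X0) * real K0))"
    proof -
      have "(real n ^ 12) ^ (card X0 * K0) = exp l ^ (12 * (card X0 * K0))" by (simp add: exp_l power_mult)
      also have "\<dots> = exp (real (12 * (card X0 * K0)) * l)" by (rule exp_of_nat_mult[symmetric])
      finally show ?thesis by (simp add: mult_ac)
    qed
    also have "\<dots> \<le> exp (12 * l * ((2 * V * M / sqrt l) * (13 * l)))"
      unfolding exp_le_cancel_iff by (rule mult_left_mono[OF XK]) (use l in simp)
    also have "12 * l * ((2 * V * M / sqrt l) * (13 * l)) = 312 * (V * M * (l * sqrt l))"
    proof -
      define q where "q = sqrt l"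
      have q: "q > 0" "l = q * q" using l by (auto simp: q_def)
      show ?thesis unfolding q_def[symmetric] unfolding q(2) using q(1) by (simp add: field_simps)
    qed
    finally show ?thesis .
  qed
  show thesis
  proof (rule that[OF N(1,2)])
    show "real (card \<N>) \<le> exp (312 * (V * M * (ln (real n) * sqrt (ln (real n)))))" using cardN by (simp add: l_def)
    fix H assume "H \<in> \<H>"
    then obtain H' where H': "H' \<in> \<N>" "\<And>x. (\<exists>z\<in>X0. \<bar>x - z\<bar> \<le> L) \<Longrightarrow>
       gauss_mix s H x \<le> gauss_mix s H' x + normal_density 0 s 0 * (real K0 * \<gamma> + 4 * exp (2 * L\<^sup>2 / s\<^sup>2) / 2 ^ K0)"
      using N(4) by blast
    show "\<exists>H'\<in>\<N>. \<forall>x. infdist x S \<le> M \<longrightarrow>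
       gauss_mix s H x \<le> gauss_mix s H' x + normal_density 0 s 0 / (real n)\<^sup>2"
    proof (intro bexI[OF _ H'(1)] allI impI)
      fix x assume x: "infdist x S \<le> M"
      have "normal_density 0 s 0 * (real K0 * \<gamma> + 4 * exp (2 * L\<^sup>2 / s\<^sup>2) / 2 ^ K0) \<le> normal_density 0 s 0 * (1 / (real n)\<^sup>2)"
        using err by (intro mult_left_mono) auto
      then show "gauss_mix s H x \<le> gauss_mix s H' x + normal_density 0 s 0 / (real n)\<^sup>2"
        using H'(2)[OF X0(3)[OF x]] by simp
    qed
  qed
qed

section \<open>Concentration of the maximum likelihood estimator\<close>

lemma ln_sample_size:
  fixes n :: nat
  assumes "n \<ge> 2"
  shows "ln (real n) \<ge> 2/3" "ln (real n) > 0" "sqrt (ln (real n)) \<ge> 2/3"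
proof -
  have "ln (real n) \<ge> ln 2" using assms by simp
  then show l: "ln (real n) \<ge> 2/3" using ln2_ge_two_thirds by linarith
  then show "ln (real n) > 0" by linarith
  show "sqrt (ln (real n)) \<ge> 2/3" using l by (intro real_le_rsqrt) (auto simp: power2_eq_square)
qed

text \<open>What is used about the rate: it dominates the order of the entropy of the net per
  observation and, after division by \<open>ln n\<close>, the tail moments.  Moreover, as the enlargement of a nonempty
  set has volume at least \<open>sigma_star c\<close>, it cannot be smaller than \<open>3 (ln n)\<^sup>2 / n\<close>.\<close>

lemma rate_bounds:
  fixes S :: "real set" and n :: nat
  assumes n: "n \<ge> 2" and M: "M \<ge> sqrt (10 * (sigma_star c)\<^sup>2 * ln (real n))"
    and S: "compact S" "S \<noteq> {}" and E: "eps_sq c n M S H = ennreal E" "E \<ge> 0"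
  shows "M \<ge> 3 * sigma_star c * sqrt (ln (real n))"
    and "measure lborel (enlargement S (sigma_star c)) \<ge> sigma_star c"
    and "measure lborel (enlargement S (sigma_star c)) * M * (ln (real n) * sqrt (ln (real n))) \<le> real n * E"
    and "(INF p\<in>{1 / ln (real n)..}. epowr (2 * dist_moment p S H / ennreal M) p) \<le> ennreal (E / ln (real n))"
    and "3 * (ln (real n))\<^sup>2 \<le> real n * E"
proof -
  define l where "l = ln (real n)"
  define s where "s = sigma_star c"
  define V where "V = measure lborel (enlargement S s)"
  note l = ln_sample_size[OF n, folded l_def]
  have s: "s \<ge> 1" "s > 0" by (auto simp: s_def sigma_star_ge_1)
  have "(3 * s * sqrt l)\<^sup>2 = 9 * s\<^sup>2 * l" using l by (simp add: power_mult_distrib)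
  also have "\<dots> \<le> 10 * s\<^sup>2 * l" using l by (intro mult_right_mono) auto
  finally have "3 * s * sqrt l \<le> sqrt (10 * s\<^sup>2 * l)" by (rule real_le_rsqrt)
  then have M3: "M \<ge> 3 * s * sqrt l" using M by (simp add: l_def s_def)
  then show "M \<ge> 3 * sigma_star c * sqrt (ln (real n))" by (simp add: l_def s_def)
  have Vs: "V \<ge> s"
  proof -
    obtain J where J: "finite J" "J \<noteq> {}" "real (card J) * s \<le> V"
      "\<And>z. z \<in> S \<Longrightarrow> \<exists>j\<in>J. s * of_int j \<le> z \<and> z \<le> s * of_int j + s"
      by (rule cell_cover[OF S s(2), folded V_def], rule that)
    then have "card J \<ge> 1" by (simp add: Suc_le_eq card_gt_0_iff)
    then have "1 * s \<le> real (card J) * s" using s by (intro mult_right_mono) auto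
    then show ?thesis using J by linarith
  qed
  then show "measure lborel (enlargement S (sigma_star c)) \<ge> sigma_star c" by (simp add: V_def s_def)
  define Q where "Q = (INF p\<in>{1 / l..}. epowr (2 * dist_moment p S H / ennreal M) p)"
  define W where "W = V * (M / real n) * l powr (3/2)"
  have "s * 0 \<le> s * (3 * sqrt l)" using s l by (intro mult_left_mono) auto
  then have M0: "M \<ge> 0" using M3 by simp
  have W0: "W \<ge> 0" using Vs s M0 by (simp add: W_def)
  have eq: "ennreal W + ennreal l * Q = ennreal E"
    using E(1) by (simp add: eps_sq_def W_def V_def s_def l_def Q_def)
  have "Q \<noteq> top"
  proof
    assume "Q = top"
    then have "ennreal l * Q = top" using l by (simp add: ennreal_mult_top)
    then show False using eq by simp
  qed
  then obtain q where q: "Q = ennreal q" "q \<ge> 0" by (cases Q) auto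
  have "ennreal (W + l * q) = ennreal E" using eq q l W0 by (simp add: ennreal_plus ennreal_mult)
  then have WE: "W + l * q = E" using W0 q l E(2) by (subst (asm) ennreal_inj) auto
  have "l powr (3/2) = l powr (1 + 1/2)" by simp
  also have "\<dots> = l * sqrt l" unfolding powr_add using l by (simp add: powr_half_sqrt)
  finally have "real n * W = V * M * (l * sqrt l)" using n by (simp add: W_def)
  moreover have "real n * W \<le> real n * E" using WE q l by (intro mult_left_mono) (auto simp flip: WE)
  ultimately have VM: "V * M * (l * sqrt l) \<le> real n * E" by simp
  then show "measure lborel (enlargement S (sigma_star c)) * M * (ln (real n) * sqrt (ln (real n))) \<le> real n * E"
    by (simp add: V_def s_def l_def)
  have "q \<le> E / l" using WE W0 l by (simp add: pos_le_divide_eq mult.commute)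
  then show "(INF p\<in>{1 / ln (real n)..}. epowr (2 * dist_moment p S H / ennreal M) p) \<le> ennreal (E / ln (real n))"
    using q by (simp add: Q_def l_def ennreal_leI)
  have "3 * l\<^sup>2 = (1 * (3 * 1 * sqrt l)) * (l * sqrt l)" using l by (simp add: power2_eq_square)
  also have "\<dots> \<le> (V * M) * (l * sqrt l)"
  proof (intro mult_right_mono mult_mono)
    have "3 * 1 * sqrt l \<le> 3 * s * sqrt l" using s l by (intro mult_right_mono) auto
    then show "3 * 1 * sqrt l \<le> M" using M3 by linarith
  qed (use Vs s l in auto)
  finally show "3 * (ln (real n))\<^sup>2 \<le> real n * E" using VM by (simp add: l_def)
qed

lemma emeasure_le_ennreal_imp_measure_le:
  assumes "emeasure P A \<le> ennreal r" "r \<ge> 0"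
  shows "measure P A \<le> r"
  unfolding measure_def using enn2real_mono[OF assms(1)] assms(2) by simp

text \<open>With high probability no mixing distribution at squared Hellinger distance more than a multiple of
  \<open>t\<^sup>2 E\<close> from the truth has at least the likelihood of the truth.  If \<open>K\<close> were one, the member \<open>K'\<close> of
  the net near it would dominate its likelihood up to the correction \<open>v\<close> and the excess from observations
  outside the \<open>M\<close>-neighbourhood of \<open>S\<close>.  So the corrected likelihood ratio of \<open>K'\<close> has to reach
  \<open>exp (- \<tau>)\<close>, or the total excess has to reach \<open>\<tau>\<close>.  The first event is excluded by the affinity bound and a
  union over the net, the second by the tail moments.

  Dividing all exponents by \<open>X = n E\<close>: in the first event the net costs 312, the correction 10 and
  \<open>\<tau> = 24 t\<^sup>2 X\<close> costs \<open>12 t\<^sup>2\<close>, while the threshold gains \<open>335 t\<^sup>2\<close>; as \<open>t \<ge> 1\<close>, at most \<open>- t\<^sup>2 X\<close> is left.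
  In the second event, in units of \<open>X / ln n\<close>, the gain \<open>12 t\<^sup>2\<close> outweighs the tail moments, which cost 11.\<close>

theorem npmle_affinity_concentration:
  fixes S :: "real set" and n :: nat
  assumes c: "c > 0" and H: "real_distribution H" and n: "n \<ge> 2"
    and M: "M \<ge> sqrt (10 * (sigma_star c)\<^sup>2 * ln (real n))"
    and S: "compact S" "S \<noteq> {}" and E: "eps_sq c n M S H = ennreal E" "E \<ge> 0" and t: "t \<ge> 1"
  obtains G where "G \<in> sets (model c H n)" "measure (model c H n) G \<le> 2 * real n powr (- (t\<^sup>2))"
    "\<And>\<omega> K. \<lbrakk>\<omega> \<in> space (model c H n); \<omega> \<notin> G; real_distribution K;
       (\<Sum>i=1..n. ln (f_dens c H (obs \<omega> i))) \<le> (\<Sum>i=1..n. ln (f_dens c K (obs \<omega> i)))\<rbrakk>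
       \<Longrightarrow> 1 - affinity (sigma_star c) K H \<le> 335 * t\<^sup>2 * E"
proof -
  interpret H: real_distribution H by fact
  interpret P: prob_space "model c H n" by (rule prob_space_model[OF H c])
  define l where "l = ln (real n)"
  define s where "s = sigma_star c"
  define V where "V = measure lborel (enlargement S s)"
  define X where "X = real n * E"
  note l = ln_sample_size[OF n, folded l_def]
  have s: "s \<ge> 1" "s > 0" by (auto simp: s_def sigma_star_ge_1)
  note RB = rate_bounds[OF n M S E, folded l_def s_def, folded V_def X_def]
  have n0: "real n > 0" using n by simp
  have t2: "t\<^sup>2 \<ge> 1" using t by simp
  have Xl: "X / l \<ge> 3 * l" using RB(5) l by (simp add: pos_le_divide_eq power2_eq_square)
  have Xl': "X \<ge> 2 * l"
  proof -
    have "2 * l \<le> 3 * l * l" using l by (intro mult_right_mono) auto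
    then show ?thesis using RB(5) by (simp add: power2_eq_square)
  qed
  have X0: "X > 0" using Xl' l by linarith
  have Ms: "M \<ge> s"
  proof -
    have "s * 1 \<le> s * (3 * sqrt l)" using s l by (intro mult_left_mono) auto
    then show ?thesis using RB(1) by simp
  qed
  have M0: "M > 0" using Ms s by linarith
  have V0: "V > 0" using RB(2) s by linarith
  have clS: "closed S" using S(1) by (rule compact_imp_closed)
  obtain J where J: "finite J" "J \<noteq> {}" "real (card J) * s \<le> V"
    "\<And>z. z \<in> S \<Longrightarrow> \<exists>j\<in>J. s * of_int j \<le> z \<and> z \<le> s * of_int j + s"
    by (rule cell_cover[OF S s(2), folded V_def], rule that)

  define p where "p = normal_density 0 s 0"
  have p: "0 \<le> p" "p \<le> 1 / 2"
  proof -
    show "0 \<le> p" by (simp add: p_def)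
    have "2 * 2 \<le> 2 * pi" using pi_ge_two by simp
    then have "2 \<le> sqrt (2 * pi)" by (intro real_le_rsqrt) (simp add: power2_eq_square)
    then have "2 * 1 \<le> sqrt (2 * pi) * s" using s by (intro mult_mono) auto
    then show "p \<le> 1 / 2" unfolding p_def normal_density_peak[OF s(2)] by (intro divide_left_mono) auto
  qed
  define v where "v x = p / (real n)\<^sup>2 * envelope S M x" for x
  have v_meas[measurable]: "v \<in> borel_measurable borel" unfolding v_def[abs_def] by measurable
  have v0: "v x \<ge> 0" for x using p envelope_pos[of S M x] by (simp add: v_def)
  define I where "I = p / (real n)\<^sup>2 * (5 * pi * M * real (card J))"
  have I0: "I \<ge> 0" using p M0 by (simp add: I_def)
  have vI: "(\<integral>\<^sup>+x. ennreal (v x) \<partial>lborel) \<le> ennreal I"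
  proof -
    have "(\<integral>\<^sup>+x. ennreal (v x) \<partial>lborel) = (\<integral>\<^sup>+x. ennreal (p / (real n)\<^sup>2) * ennreal (envelope S M x) \<partial>lborel)"
      using p envelope_pos[of S M] by (intro nn_integral_cong) (simp add: v_def ennreal_mult less_imp_le del: times_divide_eq_left)
    also have "\<dots> = ennreal (p / (real n)\<^sup>2) * (\<integral>\<^sup>+x. ennreal (envelope S M x) \<partial>lborel)"
      by (rule nn_integral_cmult) measurable
    also have "\<dots> \<le> ennreal (p / (real n)\<^sup>2) * ennreal (5 * pi * M * real (card J))"
      by (intro mult_left_mono nn_integral_envelope_le[OF J(1) clS S(2) Ms M0 J(4)]) auto
    also have "\<dots> = ennreal I" unfolding I_def using p M0 by (intro ennreal_mult[symmetric]) auto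
    finally show ?thesis .
  qed
  define r where "r = (real n * I + 1 / real n) / 2"
  have nr: "real n * r \<le> 10 * X"
  proof -
    have "real n * r = (p * (5 * pi) * (M * real (card J)) + 1) / 2"
      unfolding r_def I_def using n0 by (simp add: field_simps power2_eq_square)
    also have "p * (5 * pi) * (M * real (card J)) \<le> 1 / 2 * (5 * 3.2) * (M * (V / s))"
    proof (rule mult_mono)
      have "5 * pi \<le> 5 * 3.2" using pi_approx by simp
      then show "p * (5 * pi) \<le> 1 / 2 * (5 * 3.2)" using p by (intro mult_mono) auto
      have "real (card J) \<le> V / s" using J(3) s by (simp add: pos_le_divide_eq)
      then show "M * real (card J) \<le> M * (V / s)" using M0 by (intro mult_left_mono) auto
    qed (use p M0 V0 s in auto)
    also have "\<dots> \<le> 8 * (V * M)"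
    proof -
      have "V / s \<le> V / 1" using s V0 by (intro divide_left_mono) auto
      then have "8 * M * (V / s) \<le> 8 * M * V" using M0 s by (intro mult_left_mono) auto
      then show ?thesis by (simp add: mult_ac)
    qed
    also have "\<dots> \<le> 18 * X"
    proof -
      have "4 / 9 \<le> l * sqrt l" using mult_mono[OF l(1) l(3)] l by simp
      then have "V * M * (4 / 9) \<le> V * M * (l * sqrt l)" using V0 M0 by (intro mult_left_mono) auto
      then have "V * M * (4 / 9) \<le> X" using RB(3) by linarith
      then show ?thesis by (simp add: mult.commute[of V M])
    qed
    finally show ?thesis using Xl' l by simp
  qed

  define \<tau> where "\<tau> = 24 * t\<^sup>2 * X"
  define y where "y = 335 * t\<^sup>2 * E"
  have ny: "real n * y = 335 * t\<^sup>2 * X" by (simp add: y_def X_def)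
  have E0: "E > 0" using X0 n0 by (simp add: X_def zero_less_mult_iff)

  define \<H> where "\<H> = {K. real_distribution K \<and> 1 - affinity s K H > y}"
  have H_real: "\<And>K. K \<in> \<H> \<Longrightarrow> real_distribution K" by (simp add: \<H>_def)
  obtain \<N> where N: "finite \<N>" "\<N> \<subseteq> \<H>" "real (card \<N>) \<le> exp (312 * (V * M * (l * sqrt l)))"
    "\<And>K. K \<in> \<H> \<Longrightarrow> \<exists>K'\<in>\<N>. \<forall>x. infdist x S \<le> M \<longrightarrow> gauss_mix s K x \<le> gauss_mix s K' x + p / (real n)\<^sup>2"
    using likelihood_net[where \<H> = \<H>, OF n s(1) RB(1)[unfolded l_def] clS S(2) J(1,3,4) H_real]
    unfolding l_def p_def by blast
  have cardN: "real (card \<N>) \<le> exp (312 * X)"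
    by (rule order_trans[OF N(3)]) (use RB(3) in simp)

  define w where "w K x = (ln (gauss_mix s K x + v x) - ln (gauss_mix s H x)) / 2" for K x
  have w_meas: "w K \<in> borel_measurable borel" if "real_distribution K" for K
  proof -
    interpret K: real_distribution K by fact
    show ?thesis unfolding w_def[abs_def] by measurable
  qed
  define e where "e x = log_excess n S M x / (2 * l)" for x
  have e_meas: "e \<in> borel_measurable borel" unfolding e_def[abs_def] by measurable
  define A where "A K = {\<omega>\<in>space (model c H n). - (\<tau> / 2) \<le> (\<Sum>i=1..n. w K (obs \<omega> i))}" for K
  define B where "B = {\<omega>\<in>space (model c H n). \<tau> / (2 * l) \<le> (\<Sum>i=1..n. e (obs \<omega> i))}"
  have A_sets: "A K \<in> sets (model c H n)" if "K \<in> \<N>" for K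
    unfolding A_def using N(2) that H_real by (intro chernoff_model(1)[OF H c] w_meas) auto
  have B_sets: "B \<in> sets (model c H n)"
    unfolding B_def by (rule chernoff_model(1)[OF H c e_meas])

  have A_le: "emeasure (model c H n) (A K) \<le> ennreal (exp (12 * t\<^sup>2 * X + 10 * X - 335 * t\<^sup>2 * X))" if "K \<in> \<N>" for K
  proof -
    have K: "real_distribution K" "1 - affinity s K H > y" using N(2) that by (auto simp: \<H>_def)
    have "emeasure (model c H n) (A K) \<le> ennreal (exp (- (- (\<tau> / 2)))) *
      (\<integral>\<^sup>+x. ennreal (exp (w K x)) * ennreal (gauss_mix (sigma_star c) H x) \<partial>lborel) ^ n"
      unfolding A_def by (rule chernoff_model(2)[OF H c w_meas[OF K(1)]])
    also have "(\<integral>\<^sup>+x. ennreal (exp (w K x)) * ennreal (gauss_mix (sigma_star c) H x) \<partial>lborel) \<le> ennreal (exp (r - y))"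
    proof -
      have "(\<integral>\<^sup>+x. ennreal (exp (w K x)) * ennreal (gauss_mix (sigma_star c) H x) \<partial>lborel) \<le> ennreal (affinity s K H + r)"
        unfolding w_def r_def s_def[symmetric] by (rule likelihood_ratio_moment[OF K(1) H s(2) v_meas v0 vI I0 n0])
      also have "\<dots> \<le> ennreal (exp (r - y))"
        using K(2) exp_ge_add_one_self[of "r - y"] by (intro ennreal_leI) linarith
      finally show ?thesis .
    qed
    then have "ennreal (exp (- (- (\<tau> / 2)))) * (\<integral>\<^sup>+x. ennreal (exp (w K x)) * ennreal (gauss_mix (sigma_star c) H x) \<partial>lborel) ^ n
      \<le> ennreal (exp (- (- (\<tau> / 2)))) * ennreal (exp (r - y)) ^ n"
      by (intro mult_left_mono power_mono_ennreal) auto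
    also have "\<dots> = ennreal (exp (\<tau> / 2 + real n * (r - y)))"
      by (simp add: ennreal_power exp_add flip: ennreal_mult exp_of_nat_mult)
    also have "\<dots> \<le> ennreal (exp (12 * t\<^sup>2 * X + 10 * X - 335 * t\<^sup>2 * X))"
      using nr ny by (intro ennreal_leI) (simp add: \<tau>_def right_diff_distrib)
    finally show ?thesis .
  qed

  have B_le: "emeasure (model c H n) B \<le> ennreal (exp (- (t\<^sup>2 * l)))"
  proof -
    define T where "T = E / l + 2 * sqrt 5 / real n"
    have T0: "T \<ge> 0" using E0 l by (simp add: T_def)
    have "(\<integral>\<^sup>+x. ennreal (tail_factor n S M x) * ennreal (gauss_mix s H x) \<partial>lborel) \<le> ennreal (E / l) + ennreal (2 * sqrt 5 / real n)"
      using tail_integral[OF n s(2) M[folded s_def] H] RB(4)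
      by (fold l_def) (rule order_trans, assumption, intro add_mono order_refl)
    also have "\<dots> = ennreal T" unfolding T_def using E0 l by (intro ennreal_plus[symmetric]) auto
    finally have T: "(\<integral>\<^sup>+x. ennreal (tail_factor n S M x) * ennreal (gauss_mix s H x) \<partial>lborel) \<le> ennreal T" .
    have "emeasure (model c H n) B \<le> ennreal (exp (- (\<tau> / (2 * l)))) *
      (\<integral>\<^sup>+x. ennreal (exp (e x)) * ennreal (gauss_mix (sigma_star c) H x) \<partial>lborel) ^ n"
      unfolding B_def by (rule chernoff_model(2)[OF H c e_meas])
    also have "\<dots> \<le> ennreal (exp (- (\<tau> / (2 * l)))) * ennreal (exp (exp 1 * T)) ^ n"
    proof (intro mult_left_mono power_mono_ennreal)
      have "(\<integral>\<^sup>+x. ennreal (exp (e x)) * ennreal (gauss_mix (sigma_star c) H x) \<partial>lborel) \<le> ennreal (1 + exp 1 * T)"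
        unfolding e_def l_def s_def[symmetric] by (rule tail_likelihood_moment[OF n M0 s(2) H T T0])
      also have "\<dots> \<le> ennreal (exp (exp 1 * T))" by (intro ennreal_leI exp_ge_add_one_self)
      finally show "(\<integral>\<^sup>+x. ennreal (exp (e x)) * ennreal (gauss_mix (sigma_star c) H x) \<partial>lborel) \<le> ennreal (exp (exp 1 * T))" .
    qed simp
    also have "\<dots> = ennreal (exp (- (\<tau> / (2 * l))) * exp (exp 1 * T) ^ n)"
      by (simp add: ennreal_power ennreal_mult)
    also have "exp (- (\<tau> / (2 * l))) * exp (exp 1 * T) ^ n = exp (- (\<tau> / (2 * l)) + real n * (exp 1 * T))"
      by (simp only: exp_add exp_of_nat_mult)
    also have "\<dots> \<le> ennreal (exp (- (t\<^sup>2 * l)))"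
    proof (intro ennreal_leI, simp only: exp_le_cancel_iff)
      have "real n * T = X / l + 2 * sqrt 5" using n0 by (simp add: T_def X_def distrib_left)
      moreover have "sqrt 5 \<le> 2.5" by (intro real_le_lsqrt) (auto simp: power2_eq_square)
      moreover have "2 \<le> X / l" using Xl' l by (simp add: pos_le_divide_eq)
      moreover have "a + 2 * b \<le> 7 / 2 * a" if "b \<le> 2.5" "2 \<le> a" for a b :: real using that by simp
      ultimately have nT: "real n * T \<le> 7 / 2 * (X / l)" by metis
      have "real n * (exp 1 * T) = exp 1 * (real n * T)" by simp
      also have "\<dots> \<le> 3 * (7 / 2 * (X / l))" using nT exp_le T0 n0 by (intro mult_mono[of "exp 1" 3 "real n * T"]) auto
      also have "\<dots> \<le> 11 * (X / l)"
      proof -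
        have "3 * (7 / 2 * a) \<le> 11 * a" if "a \<ge> 0" for a :: real using that by simp
        then show ?thesis using X0 l by (simp only: divide_nonneg_pos less_imp_le)
      qed
      also have "\<dots> \<le> 11 * (t\<^sup>2 * (X / l))"
        using t2 X0 l mult_right_mono[of 1 "t\<^sup>2" "X / l"] by simp
      finally have "real n * (exp 1 * T) \<le> 11 * (t\<^sup>2 * (X / l))" .
      moreover have "\<tau> / (2 * l) = 12 * (t\<^sup>2 * (X / l))" using l by (simp add: \<tau>_def)
      moreover have "t\<^sup>2 * l \<le> t\<^sup>2 * (X / l)" using Xl l by (intro mult_left_mono) auto
      moreover have "- (12 * a) + b \<le> - d" if "b \<le> 11 * a" "d \<le> a" for a b d :: real using that by simp
      ultimately show "- (\<tau> / (2 * l)) + real n * (exp 1 * T) \<le> - (t\<^sup>2 * l)" by metis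
    qed
    finally show ?thesis .
  qed

  have U_le: "emeasure (model c H n) (\<Union>K\<in>\<N>. A K) \<le> ennreal (exp (- (t\<^sup>2 * l)))"
  proof -
    define b where "b = exp (12 * t\<^sup>2 * X + 10 * X - 335 * t\<^sup>2 * X)"
    have "emeasure (model c H n) (\<Union>K\<in>\<N>. A K) \<le> (\<Sum>K\<in>\<N>. emeasure (model c H n) (A K))"
      using A_sets N(1) by (intro emeasure_subadditive_finite) auto
    also have "\<dots> \<le> (\<Sum>K\<in>\<N>. ennreal b)" using A_le by (intro sum_mono) (simp add: b_def)
    also have "\<dots> = ennreal (real (card \<N>) * b)"
      by (simp add: b_def ennreal_mult ennreal_of_nat_eq_real_of_nat)
    also have "\<dots> \<le> ennreal (exp (312 * X) * b)" using cardN by (intro ennreal_leI mult_right_mono) (auto simp: b_def)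
    also have "\<dots> \<le> ennreal (exp (- (t\<^sup>2 * l)))"
    proof (intro ennreal_leI)
      have "X \<le> t\<^sup>2 * X" using t2 X0 mult_right_mono[of 1 "t\<^sup>2" X] by simp
      moreover have "t\<^sup>2 * l \<le> t\<^sup>2 * X" using Xl' l by (intro mult_left_mono) auto
      ultimately have "312 * X + (12 * t\<^sup>2 * X + 10 * X - 335 * t\<^sup>2 * X) \<le> - (t\<^sup>2 * l)" by linarith
      moreover have "exp (312 * X) * b = exp (312 * X + (12 * t\<^sup>2 * X + 10 * X - 335 * t\<^sup>2 * X))"
        unfolding b_def by (simp only: exp_add)
      ultimately show "exp (312 * X) * b \<le> exp (- (t\<^sup>2 * l))" by (simp only: exp_le_cancel_iff)
    qed
    finally show ?thesis .
  qed
  define G where "G = (\<Union>K\<in>\<N>. A K) \<union> B"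
  show thesis
  proof (rule that[of G])
    have U_sets: "(\<Union>K\<in>\<N>. A K) \<in> sets (model c H n)" using A_sets N(1) by auto
    show "G \<in> sets (model c H n)" using U_sets B_sets by (auto simp: G_def)
    have "measure (model c H n) G \<le> measure (model c H n) (\<Union>K\<in>\<N>. A K) + measure (model c H n) B"
      unfolding G_def by (rule measure_Un_le[OF U_sets B_sets])
    also have "\<dots> \<le> exp (- (t\<^sup>2 * l)) + exp (- (t\<^sup>2 * l))"
      by (intro add_mono emeasure_le_ennreal_imp_measure_le U_le B_le) auto
    also have "\<dots> = 2 * real n powr (- (t\<^sup>2))" using n by (simp add: powr_def l_def)
    finally show "measure (model c H n) G \<le> 2 * real n powr (- (t\<^sup>2))" .
    fix \<omega> K
    assume \<omega>: "\<omega> \<in> space (model c H n)" "\<omega> \<notin> G" and K: "real_distribution K"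
      and lik: "(\<Sum>i=1..n. ln (f_dens c H (obs \<omega> i))) \<le> (\<Sum>i=1..n. ln (f_dens c K (obs \<omega> i)))"
    show "1 - affinity (sigma_star c) K H \<le> 335 * t\<^sup>2 * E"
    proof (rule ccontr)
      assume "\<not> ?thesis"
      then have "K \<in> \<H>" using K by (simp add: \<H>_def s_def y_def)
      then obtain K' where K': "K' \<in> \<N>" "\<And>x. infdist x S \<le> M \<Longrightarrow> gauss_mix s K x \<le> gauss_mix s K' x + p / (real n)\<^sup>2"
        using N(4) by blast
      have K'r: "real_distribution K'" using K'(1) N(2) H_real by auto
      have dom: "ln (gauss_mix s K x) \<le> ln (gauss_mix s K' x + v x) + log_excess n S M x" for x
        unfolding v_def p_def by (rule gauss_mix_dominated[OF K K'r s(2) n M0 K'(2)[unfolded p_def]])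
      have "(\<Sum>i=1..n. ln (gauss_mix s H (obs \<omega> i))) \<le> (\<Sum>i=1..n. ln (gauss_mix s K (obs \<omega> i)))"
        using lik by (simp add: f_dens_eq_gauss_mix s_def)
      also have "\<dots> \<le> (\<Sum>i=1..n. ln (gauss_mix s K' (obs \<omega> i) + v (obs \<omega> i)) + log_excess n S M (obs \<omega> i))"
        by (intro sum_mono dom)
      finally have le: "(\<Sum>i=1..n. ln (gauss_mix s H (obs \<omega> i)))
        \<le> (\<Sum>i=1..n. ln (gauss_mix s K' (obs \<omega> i) + v (obs \<omega> i)) + log_excess n S M (obs \<omega> i))" .
      have "0 \<le> (\<Sum>i=1..n. 2 * w K' (obs \<omega> i) + 2 * l * e (obs \<omega> i))"
      proof -
        have "2 * w K' x + 2 * l * e x = ln (gauss_mix s K' x + v x) + log_excess n S M x - ln (gauss_mix s H x)" for x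
        proof -
          have "2 * w K' x = ln (gauss_mix s K' x + v x) - ln (gauss_mix s H x)" by (simp add: w_def)
          moreover have "2 * l * e x = log_excess n S M x" using l by (simp add: e_def)
          ultimately show ?thesis by linarith
        qed
        then show ?thesis using le by (simp only: sum_subtractf diff_ge_0_iff_ge)
      qed
      also have "\<dots> = 2 * (\<Sum>i=1..n. w K' (obs \<omega> i)) + 2 * l * (\<Sum>i=1..n. e (obs \<omega> i))"
        by (simp add: sum.distrib sum_distrib_left)
      finally have nonneg: "0 \<le> 2 * (\<Sum>i=1..n. w K' (obs \<omega> i)) + 2 * l * (\<Sum>i=1..n. e (obs \<omega> i))" .
      have a: "(\<Sum>i=1..n. w K' (obs \<omega> i)) < - (\<tau> / 2)" using \<omega> K'(1) by (auto simp: G_def A_def)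
      have "(\<Sum>i=1..n. e (obs \<omega> i)) < \<tau> / (2 * l)" using \<omega> by (auto simp: G_def B_def)
      then have "2 * l * (\<Sum>i=1..n. e (obs \<omega> i)) < 2 * l * (\<tau> / (2 * l))" using l by (intro mult_strict_left_mono) auto
      then have "2 * l * (\<Sum>i=1..n. e (obs \<omega> i)) < \<tau>" using l by simp
      with a nonneg show False by linarith
    qed
  qed
qed

section \<open>The rate for the density of the random effects\<close>

lemma L2_norm_sq_gauss_mix_diff:
  assumes H: "real_distribution H" "real_distribution K" and c: "c > 0"
  shows "L2_norm_sq (\<lambda>\<theta>. g_dens c H \<theta> - g_dens c K \<theta>)
    = ennreal (LINT x|lborel. (gauss_mix c H x - gauss_mix c K x)\<^sup>2)"
  unfolding L2_norm_sq_def g_dens_eq_gauss_mix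
  by (rule nn_integral_eq_integral[OF gauss_mix_parseval(1)[OF H c]]) simp

lemma is_npmle_likelihood:
  assumes "is_npmle c n X K" "real_distribution H"
  shows "real_distribution K" "(\<Sum>i=1..n. ln (f_dens c H (X i))) \<le> (\<Sum>i=1..n. ln (f_dens c K (X i)))"
  using assms unfolding is_npmle_def is_arg_max_def by (auto simp: not_less)

lemma npmle_L2_concentration:
  fixes S :: "real set" and n :: nat
  assumes c: "c > 0" and H: "real_distribution H" and n: "n \<ge> 2"
    and M: "M \<ge> sqrt (10 * (sigma_star c)\<^sup>2 * ln (real n))"
    and S: "compact S" "S \<noteq> {}" and E: "eps_sq c n M S H = ennreal E" "E \<ge> 0" and t: "t \<ge> 1"
  obtains G where "G \<in> sets (model c H n)" "measure (model c H n) G \<le> 2 * real n powr (- (t\<^sup>2))"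
    "\<And>\<omega> K. \<lbrakk>\<omega> \<in> space (model c H n); \<omega> \<notin> G; is_npmle c n (obs \<omega>) K\<rbrakk>
       \<Longrightarrow> L2_norm_sq (\<lambda>\<theta>. g_dens c K \<theta> - g_dens c H \<theta>) \<le> ennreal (335 * deconv_const c * t\<^sup>2 * E powr alpha_star c)"
proof -
  obtain G where G: "G \<in> sets (model c H n)" "measure (model c H n) G \<le> 2 * real n powr (- (t\<^sup>2))"
    "\<And>\<omega> K. \<lbrakk>\<omega> \<in> space (model c H n); \<omega> \<notin> G; real_distribution K;
       (\<Sum>i=1..n. ln (f_dens c H (obs \<omega> i))) \<le> (\<Sum>i=1..n. ln (f_dens c K (obs \<omega> i)))\<rbrakk>
       \<Longrightarrow> 1 - affinity (sigma_star c) K H \<le> 335 * t\<^sup>2 * E"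
    by (rule npmle_affinity_concentration[OF c H n M S E t], rule that)
  have t2: "t\<^sup>2 \<ge> 1" using t by simp
  have "3 * (ln (real n))\<^sup>2 \<le> real n * E" by (rule rate_bounds(5)[OF n M S E])
  moreover have "3 * (ln (real n))\<^sup>2 > 0" using ln_sample_size(2)[OF n] by simp
  ultimately have "real n * E > 0" by linarith
  then have E0: "E > 0" using n by (simp add: zero_less_mult_iff)
  show thesis
  proof (rule that[OF G(1,2)])
    fix \<omega> K assume \<omega>: "\<omega> \<in> space (model c H n)" "\<omega> \<notin> G" and K: "is_npmle c n (obs \<omega>) K"
    note K' = is_npmle_likelihood[OF K H]
    have aff: "1 - affinity (sigma_star c) K H \<le> 335 * t\<^sup>2 * E" by (rule G(3)[OF \<omega> K'])
    have "(LINT x|lborel. (gauss_mix c K x - gauss_mix c H x)\<^sup>2) \<le> deconv_const c * (335 * t\<^sup>2 * E) powr alpha_star c"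
      by (rule deconvolution_affinity[OF K'(1) H c _ aff]) (use E0 t in simp)
    also have "(335 * t\<^sup>2 * E) powr alpha_star c = (335 * t\<^sup>2) powr alpha_star c * E powr alpha_star c"
      using E0 by (simp add: powr_mult)
    also have "\<dots> \<le> (335 * t\<^sup>2) powr 1 * E powr alpha_star c"
      using alpha_star_bounds[OF c] t2 by (intro mult_right_mono powr_mono) auto
    also have "(335 * t\<^sup>2) powr 1 = 335 * t\<^sup>2" using t2 by simp
    finally have "(LINT x|lborel. (gauss_mix c K x - gauss_mix c H x)\<^sup>2) \<le> deconv_const c * (335 * t\<^sup>2 * E powr alpha_star c)"
      using deconv_const_pos[OF c] by (simp add: mult_left_mono)
    then show "L2_norm_sq (\<lambda>\<theta>. g_dens c K \<theta> - g_dens c H \<theta>) \<le> ennreal (335 * deconv_const c * t\<^sup>2 * E powr alpha_star c)"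
      unfolding L2_norm_sq_gauss_mix_diff[OF K'(1) H c] by (intro ennreal_leI) (simp add: mult_ac)
  qed
qed

text \<open>Deconvolution with the trivial bound 1 for \<open>1 - affinity\<close>; used on the exceptional event.\<close>

lemma L2_norm_sq_gauss_mix_diff_le:
  assumes H: "real_distribution H" "real_distribution K" and c: "c > 0"
  shows "L2_norm_sq (\<lambda>\<theta>. g_dens c H \<theta> - g_dens c K \<theta>) \<le> ennreal (deconv_const c)"
proof -
  have "(LINT x|lborel. (gauss_mix c H x - gauss_mix c K x)\<^sup>2) \<le> deconv_const c * 1 powr alpha_star c"
    using affinity_nonneg[OF H sigma_star_pos] by (intro deconvolution_affinity[OF H c]) auto
  then show ?thesis unfolding L2_norm_sq_gauss_mix_diff[OF H c] by (intro ennreal_leI) simp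
qed

lemma epowr_eps:
  assumes "eps_sq c n M S H = ennreal E" "E \<ge> 0"
  shows "epowr (eps c n M S H) (2 * a) = ennreal (E powr a)"
  using assms by (simp add: eps_def epowr_def powr_powr)

lemma epowr_eps_top:
  assumes "eps_sq c n M S H = \<infinity>"
  shows "epowr (eps c n M S H) a = \<infinity>"
  using assms by (simp add: eps_def epowr_def)

lemma inner_prob_geI:
  assumes "A \<in> sets P" "A \<subseteq> E" "prob_space P"
  shows "measure P A \<le> inner_prob P E"
proof -
  interpret prob_space P by fact
  show ?thesis unfolding inner_prob_def using assms(1,2)
    by (intro cSUP_upper) (auto intro!: bdd_aboveI[where M = 1])
qed

theorem theorem2p1:
  fixes c :: real
  assumes "c > 0"
  shows "\<exists>C::real. C > 0 \<and>
    (\<forall>(H::real measure) (M::nat \<Rightarrow> real) (S::nat \<Rightarrow> real set).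
      real_distribution H \<longrightarrow>
      (\<forall>n\<ge>2. M n \<ge> sqrt (10 * (sigma_star c)\<^sup>2 * ln (real n))) \<longrightarrow>
      (\<forall>n\<ge>2. compact (S n) \<and> S n \<noteq> {}) \<longrightarrow>
      (\<lambda>n. eps c n (M n) (S n) H) \<longlonglongrightarrow> 0 \<longrightarrow>
      (\<forall>n\<ge>2. \<forall>Hhat :: (nat \<Rightarrow> real \<times> real \<times> real) \<Rightarrow> real measure.
        (\<forall>\<omega>\<in>space (model c H n). is_npmle c n (obs \<omega>) (Hhat \<omega>)) \<longrightarrow>
        (\<forall>t::real. t \<ge> 1 \<longrightarrow>
          inner_prob (model c H n)
            {\<omega>\<in>space (model c H n).
               L2_norm_sq (\<lambda>\<theta>. g_dens c (Hhat \<omega>) \<theta> - g_dens c H \<theta>)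
                 \<le> ennreal (C * t\<^sup>2) * epowr (eps c n (M n) (S n) H) (2 * alpha_star c)}
            \<ge> 1 - 2 * real n powr (- (t\<^sup>2))) \<and>
        outer_expectation (model c H n)
            (\<lambda>\<omega>. L2_norm_sq (\<lambda>\<theta>. g_dens c (Hhat \<omega>) \<theta> - g_dens c H \<theta>))
          \<le> ennreal C * epowr (eps c n (M n) (S n) H) (2 * alpha_star c)))"
proof (intro exI[where x = "337 * deconv_const c"] conjI allI impI)
  show C0: "337 * deconv_const c > 0" using deconv_const_pos[OF assms] by simp
  fix H :: "real measure" and M :: "nat \<Rightarrow> real" and S :: "nat \<Rightarrow> real set" and n :: nat
    and Hhat :: "(nat \<Rightarrow> real \<times> real \<times> real) \<Rightarrow> real measure"
  assume H: "real_distribution H" and "\<forall>n\<ge>2. M n \<ge> sqrt (10 * (sigma_star c)\<^sup>2 * ln (real n))"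
    and "\<forall>n\<ge>2. compact (S n) \<and> S n \<noteq> {}" and n: "n \<ge> 2"
    and hat: "\<forall>\<omega>\<in>space (model c H n). is_npmle c n (obs \<omega>) (Hhat \<omega>)"
  then have M: "M n \<ge> sqrt (10 * (sigma_star c)\<^sup>2 * ln (real n))" and S: "compact (S n)" "S n \<noteq> {}" by auto
  define P where "P = model c H n"
  interpret P: prob_space P unfolding P_def by (rule prob_space_model[OF H assms])
  define D where "D \<omega> = L2_norm_sq (\<lambda>\<theta>. g_dens c (Hhat \<omega>) \<theta> - g_dens c H \<theta>)" for \<omega>
  let ?eps = "epowr (eps c n (M n) (S n) H) (2 * alpha_star c)"
  have dc: "deconv_const c > 0" by (rule deconv_const_pos[OF assms])
  show "1 - 2 * real n powr (- (t\<^sup>2)) \<le> inner_prob (model c H n)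
      {\<omega>\<in>space (model c H n). L2_norm_sq (\<lambda>\<theta>. g_dens c (Hhat \<omega>) \<theta> - g_dens c H \<theta>)
         \<le> ennreal (337 * deconv_const c * t\<^sup>2) * ?eps}" if t: "t \<ge> 1" for t
    unfolding P_def[symmetric] D_def[symmetric]
  proof (cases "eps_sq c n (M n) (S n) H = \<infinity>")
    case True
    have t2: "t\<^sup>2 > 0" using t by simp
    have "ennreal (337 * deconv_const c * t\<^sup>2) * ?eps = \<infinity>"
      unfolding epowr_eps_top[OF True] using dc t2 by (simp add: ennreal_mult_top)
    then have "measure P (space P) \<le> inner_prob P {\<omega>\<in>space P. D \<omega> \<le> ennreal (337 * deconv_const c * t\<^sup>2) * ?eps}"
      by (intro inner_prob_geI P.prob_space_axioms) auto
    moreover have "real n powr (- (t\<^sup>2)) \<ge> 0" by simp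
    ultimately show "1 - 2 * real n powr (- (t\<^sup>2)) \<le> inner_prob P {\<omega>\<in>space P. D \<omega> \<le> ennreal (337 * deconv_const c * t\<^sup>2) * ?eps}"
      unfolding P.prob_space by linarith
  next
    case False
    then obtain E where E: "eps_sq c n (M n) (S n) H = ennreal E" "E \<ge> 0"
      by (cases "eps_sq c n (M n) (S n) H") auto
    obtain G where G: "G \<in> sets P" "measure P G \<le> 2 * real n powr (- (t\<^sup>2))"
      "\<And>\<omega> K. \<lbrakk>\<omega> \<in> space P; \<omega> \<notin> G; is_npmle c n (obs \<omega>) K\<rbrakk>
         \<Longrightarrow> L2_norm_sq (\<lambda>\<theta>. g_dens c K \<theta> - g_dens c H \<theta>) \<le> ennreal (335 * deconv_const c * t\<^sup>2 * E powr alpha_star c)"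
      by (rule npmle_L2_concentration[OF assms H n M S E t, folded P_def], rule that)
    have le: "335 * deconv_const c * t\<^sup>2 * E powr alpha_star c \<le> 337 * deconv_const c * t\<^sup>2 * E powr alpha_star c"
      using dc by (intro mult_right_mono) auto
    have "D \<omega> \<le> ennreal (337 * deconv_const c * t\<^sup>2) * ?eps" if "\<omega> \<in> space P - G" for \<omega>
    proof -
      have "D \<omega> \<le> ennreal (335 * deconv_const c * t\<^sup>2 * E powr alpha_star c)"
        unfolding D_def using that hat by (intro G(3)) (auto simp: P_def)
      also have "\<dots> \<le> ennreal (337 * deconv_const c * t\<^sup>2 * E powr alpha_star c)" using le by (rule ennreal_leI)
      also have "\<dots> = ennreal (337 * deconv_const c * t\<^sup>2) * ?eps"
        unfolding epowr_eps[OF E] using dc by (intro ennreal_mult) auto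
      finally show ?thesis .
    qed
    then have "measure P (space P - G) \<le> inner_prob P {\<omega>\<in>space P. D \<omega> \<le> ennreal (337 * deconv_const c * t\<^sup>2) * ?eps}"
      using G(1) by (intro inner_prob_geI P.prob_space_axioms) auto
    then show "1 - 2 * real n powr (- (t\<^sup>2)) \<le> inner_prob P {\<omega>\<in>space P. D \<omega> \<le> ennreal (337 * deconv_const c * t\<^sup>2) * ?eps}"
      using G(2) P.prob_compl[OF G(1)] by linarith
  qed
  show "outer_expectation (model c H n) (\<lambda>\<omega>. L2_norm_sq (\<lambda>\<theta>. g_dens c (Hhat \<omega>) \<theta> - g_dens c H \<theta>))
      \<le> ennreal (337 * deconv_const c) * ?eps"
    unfolding P_def[symmetric] D_def[symmetric]
  proof (cases "eps_sq c n (M n) (S n) H = \<infinity>")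
    case True
    have "ennreal (337 * deconv_const c) * ?eps = \<infinity>"
      unfolding epowr_eps_top[OF True] using dc by (simp add: ennreal_mult_top)
    then show "outer_expectation P D \<le> ennreal (337 * deconv_const c) * ?eps" by simp
  next
    case False
    then obtain E where E: "eps_sq c n (M n) (S n) H = ennreal E" "E \<ge> 0"
      by (cases "eps_sq c n (M n) (S n) H") auto
    define \<rho> where "\<rho> = E powr alpha_star c"
    obtain G where G: "G \<in> sets P" "measure P G \<le> 2 * real n powr (- (1\<^sup>2))"
      "\<And>\<omega> K. \<lbrakk>\<omega> \<in> space P; \<omega> \<notin> G; is_npmle c n (obs \<omega>) K\<rbrakk>
         \<Longrightarrow> L2_norm_sq (\<lambda>\<theta>. g_dens c K \<theta> - g_dens c H \<theta>) \<le> ennreal (335 * deconv_const c * 1\<^sup>2 * E powr alpha_star c)"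
      by (rule npmle_L2_concentration[OF assms H n M S E order_refl, folded P_def], rule that)
    have n0: "real n > 0" using n by simp
    \<comment> \<open>the event left out by the concentration bound for \<open>t = 1\<close> has probability at most \<open>2 / n\<close>, and the loss
        on it is bounded, so its contribution has to be absorbed into the rate; this uses \<open>alpha_star c < 1\<close>\<close>
    have "1 / real n \<le> \<rho>"
    proof (cases "E \<le> 1")
      case True
      have "(2/3)\<^sup>2 \<le> (ln (real n))\<^sup>2" using ln_sample_size(1)[OF n] by (intro power_mono) auto
      then have "1 \<le> real n * E" using rate_bounds(5)[OF n M S E] by (simp add: power2_eq_square)
      then have En: "1 / real n \<le> E" using n0 by (simp add: pos_divide_le_eq mult.commute)
      then have "E > 0" using n0 by (smt (verit) zero_less_divide_1_iff)
      then have "E powr 1 \<le> \<rho>"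
        unfolding \<rho>_def using alpha_star_bounds[OF assms] True by (intro powr_mono') auto
      then show ?thesis using En \<open>E > 0\<close> by simp
    next
      case False
      then have "1 \<le> \<rho>" unfolding \<rho>_def using alpha_star_bounds[OF assms] by (intro ge_one_powr_ge_zero) auto
      moreover have "1 / real n \<le> 1" using n by simp
      ultimately show ?thesis by linarith
    qed
    moreover have "measure P G \<le> 2 * (1 / real n)" using G(2) n0 by (simp add: powr_minus divide_inverse)
    ultimately have PG: "measure P G \<le> 2 * \<rho>" by linarith
    have \<rho>0: "\<rho> \<ge> 0" by (simp add: \<rho>_def)
    define Z where "Z \<omega> = ennreal (335 * deconv_const c * \<rho>) + ennreal (deconv_const c) * indicator G \<omega>" for \<omega>
    have [measurable]: "Z \<in> borel_measurable P" unfolding Z_def using G(1) by measurable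
    have DZ: "D \<omega> \<le> Z \<omega>" if \<omega>: "\<omega> \<in> space P" for \<omega>
    proof (cases "\<omega> \<in> G")
      case True
      have "real_distribution (Hhat \<omega>)" using is_npmle_likelihood(1) hat H \<omega> by (auto simp: P_def)
      then have "D \<omega> \<le> ennreal (deconv_const c)" unfolding D_def by (rule L2_norm_sq_gauss_mix_diff_le[OF _ H assms])
      then show ?thesis using True by (simp add: Z_def add_increasing)
    next
      case False
      have "D \<omega> \<le> ennreal (335 * deconv_const c * 1\<^sup>2 * E powr alpha_star c)"
        unfolding D_def using \<omega> hat False by (intro G(3)) (auto simp: P_def)
      then show ?thesis using False by (simp add: Z_def \<rho>_def)
    qed
    have "outer_expectation P D \<le> (\<integral>\<^sup>+\<omega>. Z \<omega> \<partial>P)"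
      unfolding outer_expectation_def using DZ by (intro INF_lower) auto
    also have "\<dots> = ennreal (335 * deconv_const c * \<rho>) + ennreal (deconv_const c) * emeasure P G"
      unfolding Z_def using G(1) by (simp add: nn_integral_add nn_integral_cmult P.emeasure_space_1)
    also have "\<dots> = ennreal (335 * deconv_const c * \<rho> + deconv_const c * measure P G)"
      using dc \<rho>0 by (simp add: P.emeasure_eq_measure ennreal_plus ennreal_mult)
    also have "\<dots> \<le> ennreal (335 * deconv_const c * \<rho> + deconv_const c * (2 * \<rho>))"
      using dc PG by (intro ennreal_leI add_mono mult_left_mono) auto
    also have "\<dots> = ennreal (337 * deconv_const c * \<rho>)" by (simp add: algebra_simps)
    also have "\<dots> = ennreal (337 * deconv_const c) * ?eps"
      unfolding epowr_eps[OF E] \<rho>_def using dc by (intro ennreal_mult) auto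
    finally show "outer_expectation P D \<le> ennreal (337 * deconv_const c) * ?eps" .
  qed
qed

end
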